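(* Let $k\ge1$ and consider the method: find $(\mathbf u_h,p_h)\in\mathbf V_h^k\times W_h^{k-1}$ such that $$(K^{-1}\mathbf u_h,\mathbf v)_Q-(p_h,\nabla\cdot\mathbf v)=-\langle\mathcal R_h^{k-1}g,\mathbf v\cdot\mathbf n\rangle_{\Gamma_D}\quad\forall\mathbf v\in\mathbf V_h^k,\qquad(\nabla\cdot\mathbf u_h,w)=(f,w)\quad\forall w\in W_h^{k-1}.$$ Let $\{\mathbf v_i\}$ and $\{w_j\}$ be bases of $\mathbf V^k_h$ and $W^{k-1}_h$, and let $A_{ij}=(K^{-1}\mathbf v_i,\mathbf v_j)_Q$ and $(B^T)_{ij}=-(\nabla\cdot\mathbf v_i,w_j)$, so that the method is the algebraic system $\begin{pmatrix} A & B^T \\ B & 0 \end{pmatrix}\begin{pmatrix} U \\ P \end{pmatrix}=\begin{pmatrix} G \\ F \end{pmatrix}$ for the velocity and pressure coefficient vectors $U,P$. Then the system for the pressure unknowns $P$ obtained by eliminating the velocity unknowns $U$, whose matrix is $BA^{-1}B^T$, is symmetric and positive definite.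
   Context: Domain and data: $\Omega\subset\mathbb R^d$ ($d=2,3$) is an open bounded polytopal domain, $\partial\Omega=\bar\Gamma_D\cup\bar\Gamma_N$, $\Gamma_D\cap\Gamma_N=\emptyset$, $\mathrm{measure}(\Gamma_D)>0$, $\mathbf n$ the outward unit normal. $K$ is a symmetric tensor with $k_0\xi^T\xi\le\xi^TK(\mathbf x)\xi\le k_1\xi^T\xi$ for all $\mathbf x\in\Omega$, $\xi\in\mathbb R^d$, for some $0<k_0<k_1<\infty$. $f\in L^2(\Omega)$, $g\in L^2(\Gamma_D)$. $(\cdot,\cdot)$ is the $L^2(\Omega)$ inner product, $\langle\cdot,\cdot\rangle_S$ that of $L^2(S)$. $\mathbf V=\{\mathbf v\in H(\mathrm{div};\Omega):\mathbf v\cdot\mathbf n=0\text{ on }\Gamma_N\}$, $W=L^2(\Omega)$. Mesh: $\mathcal T_h$ is a shape regular, quasi-uniform finite element partition of $\Omega$ into quadrilaterals ($d=2$) or hexahedra ($d=3$, possibly with nonplanar faces), $h=\max_E\mathrm{diam}(E)$. $\hat E=[-1,1]^d$; for $E\in\mathcal T_h$, $F_E:\hat E\to E$ is the bilinear (trilinear) bijection mapping the vertices of $\hat E$ to the corresponding vertices of $E$; $DF_E$ is its Jacobian matrix, $J_E=|\det DF_E|$. Shape regularity and quasi-uniformity imply $\|DF_E\|_{0,\infty,\hat E}\sim h$, $\|J_E\|_{0,\infty,\hat E}\sim h^d$, $\|DF_E^{-1}\|_{0,\infty,E}\sim h^{-1}$, $\|J_{F_E^{-1}}\|_{0,\infty,E}\sim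 h^{-d}$, where $J_{F_E^{-1}}=|\det DF_E^{-1}|$ ($\sim$: two-sided bounds with constants independent of $h$). Spaces: $\mathcal Q^m$ = polynomials of degree $\le m$ in each variable. $\hat{\mathbf V}^{m}_{RT}(\hat E)=(\mathcal Q^m+\hat x\mathcal Q^m)\times(\mathcal Q^m+\hat y\mathcal Q^m)\times(\mathcal Q^m+\hat z\mathcal Q^m)$ (third component omitted if $d=2$). For $i=1,\dots,d$, $\mathcal B_i^k$ is spanned by the vectors whose only nonzero entry is the $i$-th, equal to a monomial of degree $\le k$ in each variable and of degree exactly $k$ in at least one variable other than the $i$-th; $\tilde{\mathcal B}^k=\sum_{i=1}^d\hat\nabla\times(\hat{\mathbf x}\times\mathcal B^k_i)$ (in 2d, $\hat{\mathbf x}\times\hat{\mathbf q}=\hat xq_2-\hat yq_1$ and $\hat\nabla\times\phi=(-\partial_2\phi,\partial_1\phi)^T$). $\hat{\mathbf V}^k(\hat E)=\hat{\mathbf V}^{k-1}_{RT}(\hat E)\oplus\tilde{\mathcal B}^k(\hat E)$, $\hat W^{k-1}(\hat E)=\mathcal Q^{k-1}(\hat E)$. Transformations: $\mathbf v\leftrightarrow\hat{\mathbf v}$ means $\mathbf v=\big(\frac1{J_E}DF_E\hat{\mathbf v}\big)\circ F_E^{-1}$ (Piola), $w\leftrightarrow\hat w$ means $w=\hat w\circ F_E^{-1}$. $\mathbf V^k_h=\{\mathbf v\in\mathbf V:\mathbf v|_E\leftrightarrow\hat{\mathbf v}\in\hat{\mathbf V}^k(\hat E)\ \forall E\in\mathcal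 T_h\}$, $W^{k-1}_h=\{w\in W:w|_E\leftrightarrow\hat w\in\hat W^{k-1}(\hat E)\ \forall E\in\mathcal T_h\}$. Quadrature: with $\{\xi_k(i)\}_{i=0}^k$, $\{\lambda_k(i)\}_{i=0}^k$ the Gauss–Lobatto points and weights on $[-1,1]$, for $\boldsymbol i\in\{0,\dots,k\}^d$ put $\hat{\mathbf p}_{\boldsymbol i}=(\xi_k(\boldsymbol i_1),\dots,\xi_k(\boldsymbol i_d))$ and $w_k(\boldsymbol i)=\prod_j\lambda_k(\boldsymbol i_j)$. With $\mathcal K^{-1}=\frac1{J_E}DF_E^T(K^{-1}\circ F_E)DF_E$, $(K^{-1}\mathbf q,\mathbf v)_Q=\sum_{E\in\mathcal T_h}\sum_{\boldsymbol i}w_k(\boldsymbol i)\,\mathcal K^{-1}(\hat{\mathbf p}_{\boldsymbol i})\hat{\mathbf q}(\hat{\mathbf p}_{\boldsymbol i})\cdot\hat{\mathbf v}(\hat{\mathbf p}_{\boldsymbol i})$. Boundary data: on a boundary facet $e=F_E(\hat e)$, $\mathcal R_h^{k-1}\phi=(\hat{\mathcal R}^{k-1}_{\hat e}\hat\phi)\circ F_E^{-1}$ with $\hat\phi=\phi\circ F_E$ and $\hat{\mathcal R}^{k-1}_{\hat e}$ the $L^2(\hat e)$-orthogonal projection onto $\mathcal Q^{k-1}(\hat e)$.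
   Formalization: Two implicit assumptions are made explicit: each boundary facet of the mesh lies entirely in Γ_D or in Γ_N (else the claim can fail and R_h g is undefined), and K is symmetric with its bounds up to the boundary, since Gauss–Lobatto points lie on ∂Ω. *)

theory Defs
  imports
    "HOL-Analysis.Analysis"
    "HOL-Library.Function_Algebras"
    "HOL-Computational_Algebra.Polynomial"
begin

definition fun_scale :: "real \<Rightarrow> ('a \<Rightarrow> 'b::real_vector) \<Rightarrow> 'a \<Rightarrow> 'b" where
  "fun_scale c f = (\<lambda>x. c *\<^sub>R f x)"

definition is_basis :: "('n::finite \<Rightarrow> 'a \<Rightarrow> 'b::real_vector) \<Rightarrow> ('a \<Rightarrow> 'b) set \<Rightarrow> bool" where
  "is_basis b S \<longleftrightarrow>
     inj b \<and> \<not> module.dependent fun_scale (range b) \<and> module.span fun_scale (range b) = S"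

definition square_integrable :: "'a measure \<Rightarrow> ('a \<Rightarrow> 'b::real_normed_vector) \<Rightarrow> bool" where
  "square_integrable M f \<longleftrightarrow> f \<in> borel_measurable M \<and> integrable M (\<lambda>x. (norm (f x))\<^sup>2)"

definition L2_inner :: "(real^'d::finite) set \<Rightarrow> (real^'d \<Rightarrow> real) \<Rightarrow> (real^'d \<Rightarrow> real) \<Rightarrow> real" where
  "L2_inner \<Omega> f g = (LINT x|lebesgue_on \<Omega>. f x * g x)"

definition partial :: "'d::finite \<Rightarrow> (real^'d \<Rightarrow> real) \<Rightarrow> real^'d \<Rightarrow> real" where
  "partial j \<phi> x = frechet_derivative \<phi> (at x) (axis j 1)"

definition grad :: "(real^'d::finite \<Rightarrow> real) \<Rightarrow> real^'d \<Rightarrow> real^'d" where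
  "grad \<phi> x = (\<chi> j. partial j \<phi> x)"

primrec C_times :: "nat \<Rightarrow> (real^'d::finite \<Rightarrow> real) \<Rightarrow> bool" where
  "C_times 0 \<phi> \<longleftrightarrow> continuous_on UNIV \<phi>"
| "C_times (Suc n) \<phi> \<longleftrightarrow> (\<forall>x. \<phi> differentiable (at x)) \<and> (\<forall>j. C_times n (partial j \<phi>))"

definition smooth :: "(real^'d::finite \<Rightarrow> real) \<Rightarrow> bool" where
  "smooth \<phi> \<longleftrightarrow> (\<forall>n. C_times n \<phi>)"

definition fun_support :: "(real^'d::finite \<Rightarrow> real) \<Rightarrow> (real^'d) set" where
  "fun_support \<phi> = closure {x. \<phi> x \<noteq> 0}"

definition has_weak_div ::
    "(real^'d::finite) set \<Rightarrow> (real^'d \<Rightarrow> real^'d) \<Rightarrow> (real^'d \<Rightarrow> real) \<Rightarrow> bool" where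
  "has_weak_div \<Omega> v w \<longleftrightarrow>
     square_integrable (lebesgue_on \<Omega>) w \<and>
     (\<forall>\<phi>. smooth \<phi> \<and> compact (fun_support \<phi>) \<and> fun_support \<phi> \<subseteq> \<Omega> \<longrightarrow>
        (LINT x|lebesgue_on \<Omega>. v x \<bullet> grad \<phi> x) = - (LINT x|lebesgue_on \<Omega>. w x * \<phi> x))"

definition H_div :: "(real^'d::finite) set \<Rightarrow> (real^'d \<Rightarrow> real^'d) set" where
  "H_div \<Omega> = {v. square_integrable (lebesgue_on \<Omega>) v \<and> (\<exists>w. has_weak_div \<Omega> v w)}"

text \<open>The weak divergence is unique only up to null sets; it is used below only inside integrals.\<close>

definition weak_div :: "(real^'d::finite) set \<Rightarrow> (real^'d \<Rightarrow> real^'d) \<Rightarrow> real^'d \<Rightarrow> real" where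
  "weak_div \<Omega> v = (SOME w. has_weak_div \<Omega> v w)"

text \<open>
  The normal trace of \<open>v\<close> is the functional that maps \<open>\<phi>\<close> to the integral of
  \<open>v \<bullet> grad \<phi> + div v * \<phi>\<close>; it vanishes on the remaining
  part \<open>\<Gamma>\<^sub>N\<close> of the boundary if it annihilates all \<open>\<phi>\<close> that vanish near \<open>\<Gamma>\<^sub>D\<close>.
\<close>

definition V_space :: "(real^'d::finite) set \<Rightarrow> (real^'d) set \<Rightarrow> (real^'d \<Rightarrow> real^'d) set" where
  "V_space \<Omega> \<Gamma>\<^sub>D =
     {v \<in> H_div \<Omega>. \<forall>\<phi>. smooth \<phi> \<and> fun_support \<phi> \<inter> closure \<Gamma>\<^sub>D = {} \<longrightarrow>
        (LINT x|lebesgue_on \<Omega>. v x \<bullet> grad \<phi> x + weak_div \<Omega> v x * \<phi> x) = 0}"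

definition ref_elem :: "(real^'d::finite) set" where
  "ref_elem = cbox (- 1) 1"

definition ref_int :: "(real^'d::finite) set" where
  "ref_int = box (- 1) 1"

definition monomial :: "('d::finite \<Rightarrow> nat) \<Rightarrow> real^'d \<Rightarrow> real" where
  "monomial \<alpha> x = (\<Prod>i\<in>UNIV. (x $ i) ^ \<alpha> i)"

definition Qpoly :: "nat \<Rightarrow> (real^'d::finite \<Rightarrow> real) set" where
  "Qpoly m = module.span fun_scale {monomial \<alpha> | \<alpha>. \<forall>i. \<alpha> i \<le> m}"

definition RT_space :: "nat \<Rightarrow> (real^'d::finite \<Rightarrow> real^'d) set" where
  "RT_space m =
     {\<lambda>x. \<chi> i. a i x + x $ i * b i x | a b. \<forall>i. a i \<in> Qpoly m \<and> b i \<in> Qpoly m}"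

definition B_space :: "nat \<Rightarrow> 'd::finite \<Rightarrow> (real^'d \<Rightarrow> real^'d) set" where
  "B_space k i =
     module.span fun_scale
       {\<lambda>x. axis i (monomial \<alpha> x) | \<alpha>. (\<forall>j. \<alpha> j \<le> k) \<and> (\<exists>j. j \<noteq> i \<and> \<alpha> j = k)}"

text \<open>
  Cross product and curl depend on a numbering of the coordinates: \<open>\<iota> 1\<close>, \<open>\<iota> 2\<close> (and \<open>\<iota> 3\<close>)
  are the first, second (and third) coordinate direction.
\<close>

definition cross_2d :: "(nat \<Rightarrow> 'd) \<Rightarrow> real^'d::finite \<Rightarrow> real^'d \<Rightarrow> real" where
  "cross_2d \<iota> a b = a $ \<iota> 1 * b $ \<iota> 2 - a $ \<iota> 2 * b $ \<iota> 1"

definition curl_2d :: "(nat \<Rightarrow> 'd) \<Rightarrow> (real^'d::finite \<Rightarrow> real) \<Rightarrow> real^'d \<Rightarrow> real^'d" where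
  "curl_2d \<iota> \<phi> x = axis (\<iota> 1) (- partial (\<iota> 2) \<phi> x) + axis (\<iota> 2) (partial (\<iota> 1) \<phi> x)"

definition cross_3d :: "(nat \<Rightarrow> 'd) \<Rightarrow> real^'d::finite \<Rightarrow> real^'d \<Rightarrow> real^'d" where
  "cross_3d \<iota> a b =
     axis (\<iota> 1) (a $ \<iota> 2 * b $ \<iota> 3 - a $ \<iota> 3 * b $ \<iota> 2) +
     axis (\<iota> 2) (a $ \<iota> 3 * b $ \<iota> 1 - a $ \<iota> 1 * b $ \<iota> 3) +
     axis (\<iota> 3) (a $ \<iota> 1 * b $ \<iota> 2 - a $ \<iota> 2 * b $ \<iota> 1)"

definition curl_3d :: "(nat \<Rightarrow> 'd) \<Rightarrow> (real^'d::finite \<Rightarrow> real^'d) \<Rightarrow> real^'d \<Rightarrow> real^'d" where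
  "curl_3d \<iota> u x =
     axis (\<iota> 1) (partial (\<iota> 2) (\<lambda>y. u y $ \<iota> 3) x - partial (\<iota> 3) (\<lambda>y. u y $ \<iota> 2) x) +
     axis (\<iota> 2) (partial (\<iota> 3) (\<lambda>y. u y $ \<iota> 1) x - partial (\<iota> 1) (\<lambda>y. u y $ \<iota> 3) x) +
     axis (\<iota> 3) (partial (\<iota> 1) (\<lambda>y. u y $ \<iota> 2) x - partial (\<iota> 2) (\<lambda>y. u y $ \<iota> 1) x)"

definition curl_x_cross ::
    "(nat \<Rightarrow> 'd) \<Rightarrow> (real^'d::finite \<Rightarrow> real^'d) \<Rightarrow> real^'d \<Rightarrow> real^'d" where
  "curl_x_cross \<iota> q =
     (if CARD('d) = 2 then curl_2d \<iota> (\<lambda>x. cross_2d \<iota> x (q x))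
      else curl_3d \<iota> (\<lambda>x. cross_3d \<iota> x (q x)))"

definition B_tilde :: "(nat \<Rightarrow> 'd) \<Rightarrow> nat \<Rightarrow> (real^'d::finite \<Rightarrow> real^'d) set" where
  "B_tilde \<iota> k = {\<lambda>x. \<Sum>i\<in>UNIV. curl_x_cross \<iota> (q i) x | q. \<forall>i. q i \<in> B_space k i}"

definition V_ref :: "(nat \<Rightarrow> 'd) \<Rightarrow> nat \<Rightarrow> (real^'d::finite \<Rightarrow> real^'d) set" where
  "V_ref \<iota> k = {\<lambda>x. r x + b x | r b. r \<in> RT_space (k - 1) \<and> b \<in> B_tilde \<iota> k}"

definition ref_facet :: "'d::finite \<Rightarrow> real \<Rightarrow> (real^'d) set" where
  "ref_facet i s = {x \<in> ref_elem. x $ i = s}"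

definition to_facet :: "'d::finite \<Rightarrow> real \<Rightarrow> real^'d \<Rightarrow> real^'d" where
  "to_facet i s x = (\<chi> j. if j = i then s else x $ j)"

text \<open>
  Integral over a facet of the reference element with respect to the Lebesgue measure of dimension
  \<open>d - 1\<close>: the integrand is extended constantly in the normal direction, in which the reference
  element has length 2.
\<close>

definition facet_integral :: "'d::finite \<Rightarrow> real \<Rightarrow> (real^'d \<Rightarrow> real) \<Rightarrow> real" where
  "facet_integral i s \<psi> = (LINT x|lebesgue_on ref_elem. \<psi> (to_facet i s x)) / 2"

text \<open>
  The \<open>L\<^sup>2\<close>-orthogonal projection on a reference facet.  Polynomials on the facet are represented by
  polynomials on the whole space, so the result is determined only on the facet.
\<close>

definition facet_proj :: "nat \<Rightarrow> 'd::finite \<Rightarrow> real \<Rightarrow> (real^'d \<Rightarrow> real) \<Rightarrow> real^'d \<Rightarrow> real" where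
  "facet_proj m i s \<phi> =
     (SOME q. q \<in> Qpoly m \<and> (\<forall>r\<in>Qpoly m. facet_integral i s (\<lambda>x. (\<phi> x - q x) * r x) = 0))"

text \<open>
  The domain lies locally on one side of its boundary, as the outward unit normal requires; this is
  the condition \<open>interior (closure \<Omega>) = \<Omega>\<close>, which rules out slits.  Note that \<open>polytope\<close> means convex
  polytope.
\<close>

definition polytopal_domain :: "(real^'d::finite) set \<Rightarrow> bool" where
  "polytopal_domain \<Omega> \<longleftrightarrow>
     open \<Omega> \<and> bounded \<Omega> \<and> connected \<Omega> \<and> \<Omega> \<noteq> {} \<and> interior (closure \<Omega>) = \<Omega> \<and>
     (\<exists>\<P>. finite \<P> \<and> (\<forall>P\<in>\<P>. polytope P) \<and> closure \<Omega> = \<Union>\<P>)"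

definition DF :: "(real^'d::finite \<Rightarrow> real^'d) \<Rightarrow> real^'d \<Rightarrow> real^'d^'d" where
  "DF \<Phi> x = matrix (frechet_derivative \<Phi> (at x))"

definition Jac :: "(real^'d::finite \<Rightarrow> real^'d) \<Rightarrow> real^'d \<Rightarrow> real" where
  "Jac \<Phi> x = \<bar>det (DF \<Phi> x)\<bar>"

text \<open>
  A bilinear (trilinear) map of the reference element onto \<open>E\<close>.  A multilinear map is determined by
  the images of the vertices of the reference element, which are the vertices of \<open>E\<close>.
\<close>

definition element_map :: "(real^'d::finite) set \<Rightarrow> (real^'d \<Rightarrow> real^'d) \<Rightarrow> bool" where
  "element_map E \<Phi> \<longleftrightarrow>
     (\<forall>i. (\<lambda>x. \<Phi> x $ i) \<in> Qpoly 1) \<and> bij_betw \<Phi> ref_elem E \<and>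
     (\<forall>x\<in>ref_elem. invertible (DF \<Phi> x))"

text \<open>
  Conforming finite element partition: two distinct elements intersect in the image of a common
  proper face (of any dimension, possibly empty) of the reference element, and the two
  parametrizations of that face, which are both determined by its vertices, agree up to a symmetry
  of the reference element.
\<close>

definition fe_partition ::
    "(real^'d::finite) set \<Rightarrow> (real^'d) set set \<Rightarrow> ((real^'d) set \<Rightarrow> real^'d \<Rightarrow> real^'d) \<Rightarrow> bool" where
  "fe_partition \<Omega> \<T> F \<longleftrightarrow>
     finite \<T> \<and> \<Union>\<T> = closure \<Omega> \<and> (\<forall>E\<in>\<T>. element_map E (F E)) \<and>
     (\<forall>E\<in>\<T>. \<forall>E'\<in>\<T>. E \<noteq> E' \<longrightarrow>
        (\<exists>a a' \<sigma>. a face_of ref_elem \<and> a \<noteq> ref_elem \<and> a' face_of ref_elem \<and>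
           orthogonal_transformation \<sigma> \<and> \<sigma> ` a = a' \<and> (\<forall>x\<in>a. F E x = F E' (\<sigma> x)) \<and>
           E \<inter> E' = F E ` a))"

definition mesh_size :: "(real^'d::finite) set set \<Rightarrow> real" where
  "mesh_size \<T> = Max (diameter ` \<T>)"

definition comparable :: "real \<Rightarrow> real \<Rightarrow> real \<Rightarrow> bool" where
  "comparable C a b \<longleftrightarrow> a \<le> C * b \<and> b \<le> C * a"

text \<open>
  Shape regularity and quasi-uniformity in the form of the uniform bounds on the element maps.  The
  constant \<open>C\<close> does not depend on the mesh, so that a family of meshes is shape regular and
  quasi-uniform if all its members satisfy the predicate with the same \<open>C\<close>.  The functions of
  \<open>F\<^sub>E\<^sup>-\<^sup>1\<close> are evaluated at \<open>F\<^sub>E x\<close> with \<open>x\<close> in the reference element.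
\<close>

definition shape_regular_quasi_uniform ::
    "real \<Rightarrow> (real^'d::finite) set set \<Rightarrow> ((real^'d) set \<Rightarrow> real^'d \<Rightarrow> real^'d) \<Rightarrow> bool" where
  "shape_regular_quasi_uniform C \<T> F \<longleftrightarrow>
     C > 0 \<and>
     (\<forall>E\<in>\<T>.
        comparable C (SUP x\<in>ref_elem. norm (DF (F E) x)) (mesh_size \<T>) \<and>
        comparable C (SUP x\<in>ref_elem. Jac (F E) x) (mesh_size \<T> ^ CARD('d)) \<and>
        comparable C (SUP x\<in>ref_elem. norm (matrix_inv (DF (F E) x))) (1 / mesh_size \<T>) \<and>
        comparable C (SUP x\<in>ref_elem. \<bar>det (matrix_inv (DF (F E) x))\<bar>) (1 / mesh_size \<T> ^ CARD('d)))"

definition boundary_facets ::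
    "(real^'d::finite) set \<Rightarrow> (real^'d) set set \<Rightarrow> ((real^'d) set \<Rightarrow> real^'d \<Rightarrow> real^'d) \<Rightarrow>
     ((real^'d) set \<times> 'd \<times> real) set" where
  "boundary_facets \<Omega> \<T> F =
     {(E, i, s). E \<in> \<T> \<and> (s = - 1 \<or> s = 1) \<and> F E ` ref_facet i s \<subseteq> frontier \<Omega>}"

definition facets_in ::
    "(real^'d::finite) set \<Rightarrow> (real^'d) set \<Rightarrow> (real^'d) set set \<Rightarrow>
     ((real^'d) set \<Rightarrow> real^'d \<Rightarrow> real^'d) \<Rightarrow> ((real^'d) set \<times> 'd \<times> real) set" where
  "facets_in \<Gamma> \<Omega> \<T> F =
     {(E, i, s) \<in> boundary_facets \<Omega> \<T> F. F E ` rel_interior (ref_facet i s) \<subseteq> \<Gamma>}"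

text \<open>
  The vector \<open>DF\<^sup>-\<^sup>T n\<close>, where \<open>n\<close> is the outward unit normal of the reference element, points in the
  direction of the outward normal of \<open>E\<close>, and the surface element of the parametrized facet is
  \<open>|det DF| |DF\<^sup>-\<^sup>T n|\<close>.
\<close>

definition conormal :: "(real^'d::finite \<Rightarrow> real^'d) \<Rightarrow> 'd \<Rightarrow> real \<Rightarrow> real^'d \<Rightarrow> real^'d" where
  "conormal \<Phi> i s x = transpose (matrix_inv (DF \<Phi> x)) *v axis i s"

definition unit_normal :: "(real^'d::finite \<Rightarrow> real^'d) \<Rightarrow> 'd \<Rightarrow> real \<Rightarrow> real^'d \<Rightarrow> real^'d" where
  "unit_normal \<Phi> i s x = conormal \<Phi> i s x /\<^sub>R norm (conormal \<Phi> i s x)"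

definition surface_element :: "(real^'d::finite \<Rightarrow> real^'d) \<Rightarrow> 'd \<Rightarrow> real \<Rightarrow> real^'d \<Rightarrow> real" where
  "surface_element \<Phi> i s x = Jac \<Phi> x * norm (conormal \<Phi> i s x)"

definition surface_measure ::
    "(real^'d::finite) set \<Rightarrow> (real^'d) set set \<Rightarrow> ((real^'d) set \<Rightarrow> real^'d \<Rightarrow> real^'d) \<Rightarrow>
     (real^'d) set \<Rightarrow> real" where
  "surface_measure \<Omega> \<T> F S =
     (\<Sum>(E, i, s)\<in>boundary_facets \<Omega> \<T> F.
        facet_integral i s (\<lambda>x. indicator S (F E x) * surface_element (F E) i s x))"

text \<open>
  Each boundary facet belongs, up to its relative boundary, to exactly one of \<open>\<Gamma>\<^sub>D\<close> and \<open>\<Gamma>\<^sub>N\<close>.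
\<close>

definition boundary_partition ::
    "(real^'d::finite) set \<Rightarrow> (real^'d) set \<Rightarrow> (real^'d) set \<Rightarrow> (real^'d) set set \<Rightarrow>
     ((real^'d) set \<Rightarrow> real^'d \<Rightarrow> real^'d) \<Rightarrow> bool" where
  "boundary_partition \<Omega> \<Gamma>\<^sub>D \<Gamma>\<^sub>N \<T> F \<longleftrightarrow>
     frontier \<Omega> = closure \<Gamma>\<^sub>D \<union> closure \<Gamma>\<^sub>N \<and> \<Gamma>\<^sub>D \<inter> \<Gamma>\<^sub>N = {} \<and>
     boundary_facets \<Omega> \<T> F = facets_in \<Gamma>\<^sub>D \<Omega> \<T> F \<union> facets_in \<Gamma>\<^sub>N \<Omega> \<T> F \<and>
     surface_measure \<Omega> \<T> F \<Gamma>\<^sub>D > 0"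

definition L2_boundary ::
    "(real^'d::finite) set \<Rightarrow> (real^'d) set \<Rightarrow> (real^'d) set set \<Rightarrow>
     ((real^'d) set \<Rightarrow> real^'d \<Rightarrow> real^'d) \<Rightarrow> (real^'d \<Rightarrow> real) set" where
  "L2_boundary \<Gamma> \<Omega> \<T> F =
     {g. \<forall>(E, i, s)\<in>facets_in \<Gamma> \<Omega> \<T> F.
        square_integrable (lebesgue_on ref_elem)
          (\<lambda>x. g (F E (to_facet i s x)) * sqrt (surface_element (F E) i s (to_facet i s x)))}"

definition piola :: "(real^'d::finite \<Rightarrow> real^'d) \<Rightarrow> (real^'d \<Rightarrow> real^'d) \<Rightarrow> real^'d \<Rightarrow> real^'d" where
  "piola \<Phi> v x = (1 / Jac \<Phi> x) *\<^sub>R (DF \<Phi> x *v v x)"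

text \<open>
  The members of the discrete spaces are classes of functions modulo null sets.  Each class is
  represented by its unique member which on the interior of each element is the transform of a
  reference function everywhere, and which vanishes outside the interiors of the elements.
\<close>

definition mesh_interior ::
    "(real^'d::finite) set set \<Rightarrow> ((real^'d) set \<Rightarrow> real^'d \<Rightarrow> real^'d) \<Rightarrow> (real^'d) set" where
  "mesh_interior \<T> F = (\<Union>E\<in>\<T>. F E ` ref_int)"

definition corresponds_V ::
    "(real^'d::finite \<Rightarrow> real^'d) \<Rightarrow> (real^'d \<Rightarrow> real^'d) \<Rightarrow> (real^'d \<Rightarrow> real^'d) \<Rightarrow> bool" where
  "corresponds_V \<Phi> v v' \<longleftrightarrow> (\<forall>x\<in>ref_int. v (\<Phi> x) = piola \<Phi> v' x)"

definition corresponds_W ::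
    "(real^'d::finite \<Rightarrow> real^'d) \<Rightarrow> (real^'d \<Rightarrow> real) \<Rightarrow> (real^'d \<Rightarrow> real) \<Rightarrow> bool" where
  "corresponds_W \<Phi> w w' \<longleftrightarrow> (\<forall>x\<in>ref_int. w (\<Phi> x) = w' x)"

definition V_h ::
    "(nat \<Rightarrow> 'd) \<Rightarrow> nat \<Rightarrow> (real^'d::finite) set \<Rightarrow> (real^'d) set \<Rightarrow> (real^'d) set set \<Rightarrow>
     ((real^'d) set \<Rightarrow> real^'d \<Rightarrow> real^'d) \<Rightarrow> (real^'d \<Rightarrow> real^'d) set" where
  "V_h \<iota> k \<Omega> \<Gamma>\<^sub>D \<T> F =
     {v \<in> V_space \<Omega> \<Gamma>\<^sub>D. (\<forall>E\<in>\<T>. \<exists>v'\<in>V_ref \<iota> k. corresponds_V (F E) v v') \<and>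
        (\<forall>x. x \<notin> mesh_interior \<T> F \<longrightarrow> v x = 0)}"

definition W_h ::
    "nat \<Rightarrow> (real^'d::finite) set \<Rightarrow> (real^'d) set set \<Rightarrow>
     ((real^'d) set \<Rightarrow> real^'d \<Rightarrow> real^'d) \<Rightarrow> (real^'d \<Rightarrow> real) set" where
  "W_h k \<Omega> \<T> F =
     {w. square_integrable (lebesgue_on \<Omega>) w \<and>
        (\<forall>E\<in>\<T>. \<exists>w'\<in>Qpoly (k - 1). corresponds_W (F E) w w') \<and>
        (\<forall>x. x \<notin> mesh_interior \<T> F \<longrightarrow> w x = 0)}"

text \<open>
  The reference function of \<open>v\<close> on an element; being polynomial, it is determined by its values in
  the interior and has values at the quadrature points on the boundary of the reference element.
\<close>

definition hat ::
    "(nat \<Rightarrow> 'd) \<Rightarrow> nat \<Rightarrow> (real^'d::finite \<Rightarrow> real^'d) \<Rightarrow> (real^'d \<Rightarrow> real^'d) \<Rightarrow> real^'d \<Rightarrow> real^'d" where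
  "hat \<iota> k \<Phi> v = (THE v'. v' \<in> V_ref \<iota> k \<and> corresponds_V \<Phi> v v')"

text \<open>
  The Gauss-Lobatto rule is the unique rule with \<open>k + 1\<close> points in \<open>[-1, 1]\<close>, both end points among
  them, which is exact for polynomials of degree up to \<open>2 k - 1\<close>.
\<close>

definition gauss_lobatto :: "nat \<Rightarrow> (nat \<Rightarrow> real) \<Rightarrow> (nat \<Rightarrow> real) \<Rightarrow> bool" where
  "gauss_lobatto k \<xi> l \<longleftrightarrow>
     strict_mono_on {0..k} \<xi> \<and> \<xi> 0 = - 1 \<and> \<xi> k = 1 \<and>
     (\<forall>p :: real poly. degree p \<le> 2 * k - 1 \<longrightarrow>
        (\<Sum>i=0..k. l i * poly p (\<xi> i)) = integral {- 1..1} (poly p))"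

definition K_inv_pullback ::
    "(real^'d::finite \<Rightarrow> real^'d^'d) \<Rightarrow> (real^'d \<Rightarrow> real^'d) \<Rightarrow> real^'d \<Rightarrow> real^'d^'d" where
  "K_inv_pullback K \<Phi> x =
     (1 / Jac \<Phi> x) *\<^sub>R (transpose (DF \<Phi> x) ** matrix_inv (K (\<Phi> x)) ** DF \<Phi> x)"

definition quad_form ::
    "(nat \<Rightarrow> 'd) \<Rightarrow> nat \<Rightarrow> (nat \<Rightarrow> real) \<Rightarrow> (nat \<Rightarrow> real) \<Rightarrow> (real^'d::finite) set set \<Rightarrow>
     ((real^'d) set \<Rightarrow> real^'d \<Rightarrow> real^'d) \<Rightarrow> (real^'d \<Rightarrow> real^'d^'d) \<Rightarrow>
     (real^'d \<Rightarrow> real^'d) \<Rightarrow> (real^'d \<Rightarrow> real^'d) \<Rightarrow> real" where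
  "quad_form \<iota> k \<xi> l \<T> F K q v =
     (\<Sum>E\<in>\<T>. \<Sum>i\<in>{i :: 'd \<Rightarrow> nat. \<forall>j. i j \<le> k}.
        let p = (\<chi> j. \<xi> (i j)); w = (\<Prod>j\<in>UNIV. l (i j)) in
        w * ((K_inv_pullback K (F E) p *v hat \<iota> k (F E) q p) \<bullet> hat \<iota> k (F E) v p))"

text \<open>
  The boundary term \<open>\<langle>R g, v \<bullet> n\<rangle>\<close>, facet by facet and pulled back to the reference facets; the
  boundary values of \<open>v\<close> are the traces taken from the element to which the facet belongs.
\<close>

definition boundary_term ::
    "(nat \<Rightarrow> 'd) \<Rightarrow> nat \<Rightarrow> (real^'d::finite) set \<Rightarrow> (real^'d) set \<Rightarrow> (real^'d) set set \<Rightarrow>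
     ((real^'d) set \<Rightarrow> real^'d \<Rightarrow> real^'d) \<Rightarrow> (real^'d \<Rightarrow> real) \<Rightarrow> (real^'d \<Rightarrow> real^'d) \<Rightarrow> real" where
  "boundary_term \<iota> k \<Omega> \<Gamma>\<^sub>D \<T> F g v =
     (\<Sum>(E, i, s)\<in>facets_in \<Gamma>\<^sub>D \<Omega> \<T> F.
        facet_integral i s
          (\<lambda>x. facet_proj (k - 1) i s (g \<circ> F E) x *
               (piola (F E) (hat \<iota> k (F E) v) x \<bullet> unit_normal (F E) i s x) *
               surface_element (F E) i s x))"

definition mfmfe_solution ::
    "(nat \<Rightarrow> 'd) \<Rightarrow> nat \<Rightarrow> (nat \<Rightarrow> real) \<Rightarrow> (nat \<Rightarrow> real) \<Rightarrow> (real^'d::finite) set \<Rightarrow> (real^'d) set \<Rightarrow>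
     (real^'d) set set \<Rightarrow> ((real^'d) set \<Rightarrow> real^'d \<Rightarrow> real^'d) \<Rightarrow> (real^'d \<Rightarrow> real^'d^'d) \<Rightarrow>
     (real^'d \<Rightarrow> real) \<Rightarrow> (real^'d \<Rightarrow> real) \<Rightarrow> (real^'d \<Rightarrow> real^'d) \<Rightarrow> (real^'d \<Rightarrow> real) \<Rightarrow> bool" where
  "mfmfe_solution \<iota> k \<xi> l \<Omega> \<Gamma>\<^sub>D \<T> F K f g u p \<longleftrightarrow>
     u \<in> V_h \<iota> k \<Omega> \<Gamma>\<^sub>D \<T> F \<and> p \<in> W_h k \<Omega> \<T> F \<and>
     (\<forall>v\<in>V_h \<iota> k \<Omega> \<Gamma>\<^sub>D \<T> F.
        quad_form \<iota> k \<xi> l \<T> F K u v - L2_inner \<Omega> p (weak_div \<Omega> v) =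
        - boundary_term \<iota> k \<Omega> \<Gamma>\<^sub>D \<T> F g v) \<and>
     (\<forall>w\<in>W_h k \<Omega> \<T> F. L2_inner \<Omega> (weak_div \<Omega> u) w = L2_inner \<Omega> f w)"

text \<open>
  The bounds on \<open>K\<close> are required on the closure of the domain, because the quadrature rule evaluates
  \<open>K\<close> also on its boundary.
\<close>

definition admissible_tensor ::
    "(real^'d::finite) set \<Rightarrow> real \<Rightarrow> real \<Rightarrow> (real^'d \<Rightarrow> real^'d^'d) \<Rightarrow> bool" where
  "admissible_tensor \<Omega> k0 k1 K \<longleftrightarrow>
     0 < k0 \<and> k0 < k1 \<and>
     (\<forall>x\<in>closure \<Omega>. transpose (K x) = K x \<and>
        (\<forall>z. k0 * (z \<bullet> z) \<le> z \<bullet> (K x *v z) \<and> z \<bullet> (K x *v z) \<le> k1 * (z \<bullet> z)))"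

definition symmetric_positive_definite :: "real^'m^'m::finite \<Rightarrow> bool" where
  "symmetric_positive_definite S \<longleftrightarrow>
     transpose S = S \<and> (\<forall>x. x \<noteq> 0 \<longrightarrow> x \<bullet> (S *v x) > 0)"

end

theory Submission
  imports Defs
begin

text \<open>
  With velocity matrix \<open>A\<close> and \<open>B = transpose BT\<close>, the matrix of the pressure system is
  \<open>transpose BT ** matrix_inv A ** BT\<close>.  It is symmetric and positive definite as soon as \<open>A\<close> is
  symmetric and positive definite and \<open>BT\<close> is injective (\<open>spd_matrix_inv\<close>, \<open>spd_congruence\<close>), so
  there are two things to prove.

  \<^emph>\<open>The quadrature form is definite on the velocity space\<close> (\<open>quad_form_pos\<close>).  The Gauss-Lobatto
  weights are positive and the pulled back tensor is symmetric and positive definite at every node.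
  Thus a velocity with vanishing quadrature form has a reference field that vanishes at all
  \<open>(k + 1)^d\<close> nodes, and it remains to see that such a reference field is zero
  (\<open>enhanced_field_unisolvent\<close>).  On every grid hyperplane normal to \<open>i\<close> the component \<open>v i\<close> has
  degree at most \<open>k\<close> in each tangential variable, so it vanishes there and \<open>v i = P (x i) * c i\<close>,
  where \<open>P\<close> is the monic polynomial of degree \<open>k + 1\<close> with the nodes as roots and \<open>c i\<close> is the
  coefficient of \<open>(x i)^(k + 1)\<close>.  The divergence of a reference field has degree below \<open>k\<close> in every
  variable, because the added curls are divergence free, and the same curls tie the coefficients of
  \<open>(x i)^(k + 1) * (x j)^k\<close> in \<open>v i\<close> and of \<open>(x j)^(k + 1) * (x i)^k\<close> in \<open>v j\<close> to each other.
  Comparing top coefficients in the divergence of \<open>P (x i) * c i\<close> then gives \<open>c i = 0\<close>.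

  \<^emph>\<open>A pressure orthogonal to all divergences is zero\<close> (\<open>divergence_separates_pressures\<close>).  Injectivity is
  a statement on one fixed mesh, so three explicit families of Raviart-Thomas fields suffice.  Let \<open>p\<close> be the
  pressure on the reference element.  The field with components \<open>(1 - (x i)^2) * partial i p\<close> has no
  normal component on the boundary of the element; testing with it and integrating by parts makes the
  integral of the sum of the nonnegative terms \<open>(1 - (x i)^2) * (partial i p)^2\<close> vanish, and \<open>p\<close> is
  constant on each element.  A lowest-order field that crosses one shared facet shows that the two
  constants agree, and one that leaves the domain through a Dirichlet facet shows that the constant
  there is zero.  Every element is reached from every other one through shared facets
  (\<open>facet_connected\<close>), because the faces of codimension two do not separate the domain.

  That the test fields lie in the velocity space, and what their divergence is, follows from Green's
  formula on the mesh (\<open>green\<close>): the Piola transformation turns it into integration by parts on the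
  reference element, where all remaining terms are fluxes through reference facets.  Since the weak
  divergence is determined almost everywhere by the fundamental lemma of the calculus of variations
  (\<open>fundamental_lemma\<close>), the computed divergence may be used in its place.  The same uniqueness makes
  the weak divergence linear, and together with the linearity of the boundary term
  (\<open>boundary_term_sum\<close>) it identifies the method with the algebraic system.
\<close>

section \<open>Polynomials along coordinate lines\<close>

interpretation fun_space: vector_space "fun_scale :: real \<Rightarrow> ('a \<Rightarrow> 'b::real_vector) \<Rightarrow> 'a \<Rightarrow> 'b"
  by unfold_locales (auto simp: fun_scale_def scaleR_add_right scaleR_add_left)

lemma sum_fun_apply: "sum f A x = (\<Sum>a\<in>A. f a x)"
  by (induction A rule: infinite_finite_induct) auto

lemma to_facet_nth [simp]: "to_facet i t x $ j = (if j = i then t else x $ j)"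
  by (simp add: to_facet_def)

lemma to_facet_self [simp]: "to_facet i (x $ i) x = x"
  by (simp add: vec_eq_iff)

lemma to_facet_twice [simp]: "to_facet i t (to_facet i s x) = to_facet i t x"
  by (simp add: vec_eq_iff)

lemma to_facet_commute: "i \<noteq> j \<Longrightarrow> to_facet i t (to_facet j s x) = to_facet j s (to_facet i t x)"
  by (simp add: vec_eq_iff)

lemma to_facet_eq: "to_facet i t x = x + (t - x $ i) *\<^sub>R axis i 1"
  by (auto simp: vec_eq_iff axis_def)

text \<open>
  Degree bounds in one variable at a time are all that the grid argument below needs.  Fixing the
  other coordinates reduces them to statements about univariate polynomials.
\<close>

definition slice_poly :: "'d::finite \<Rightarrow> nat \<Rightarrow> (real^'d \<Rightarrow> real) \<Rightarrow> bool" where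
  "slice_poly i n f \<longleftrightarrow> (\<forall>x. \<exists>p. degree p \<le> n \<and> (\<forall>t. f (to_facet i t x) = poly p t))"

lemma slice_polyD:
  assumes "slice_poly i n f"
  obtains p where "degree p \<le> n" "\<And>t. f (to_facet i t x) = poly p t"
  using assms unfolding slice_poly_def by blast

lemma slice_poly_mono: "slice_poly i m f \<Longrightarrow> m \<le> n \<Longrightarrow> slice_poly i n f"
  unfolding slice_poly_def by (meson le_trans)

lemma slice_poly_add:
  assumes "slice_poly i n f" "slice_poly i n g"
  shows "slice_poly i n (\<lambda>x. f x + g x)"
  unfolding slice_poly_def
proof
  fix x
  obtain p where p: "degree p \<le> n" "\<And>t. f (to_facet i t x) = poly p t"
    using slice_polyD[OF assms(1), of x] by blast
  obtain q where q: "degree q \<le> n" "\<And>t. g (to_facet i t x) = poly q t"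
    using slice_polyD[OF assms(2), of x] by blast
  show "\<exists>p. degree p \<le> n \<and> (\<forall>t. f (to_facet i t x) + g (to_facet i t x) = poly p t)"
    using p q by (intro exI[of _ "p + q"]) (auto intro: degree_add_le)
qed

lemma slice_poly_cmult:
  assumes "slice_poly i n f"
  shows "slice_poly i n (\<lambda>x. c * f x)"
  unfolding slice_poly_def
proof
  fix x
  obtain p where p: "degree p \<le> n" "\<And>t. f (to_facet i t x) = poly p t"
    using slice_polyD[OF assms(1), of x] by blast
  show "\<exists>p. degree p \<le> n \<and> (\<forall>t. c * f (to_facet i t x) = poly p t)"
    using p by (intro exI[of _ "smult c p"]) (auto intro: order_trans[OF degree_smult_le])
qed

lemma slice_poly_0: "slice_poly i n (\<lambda>x. 0)"
  unfolding slice_poly_def by (intro allI exI[of _ 0]) auto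

lemma monomial_to_facet:
  "monomial \<alpha> (to_facet i t x) = t ^ \<alpha> i * monomial (\<alpha>(i := 0)) x"
proof -
  have "monomial \<alpha> (to_facet i t x) = (\<Prod>j\<in>UNIV. (to_facet i t x $ j) ^ \<alpha> j)"
    by (simp add: monomial_def)
  also have "\<dots> = t ^ \<alpha> i * (\<Prod>j\<in>UNIV - {i}. (x $ j) ^ \<alpha> j)"
    by (subst prod.remove[of _ i]) (auto intro!: prod.cong)
  also have "(\<Prod>j\<in>UNIV - {i}. (x $ j) ^ \<alpha> j) = monomial (\<alpha>(i := 0)) x"
    unfolding monomial_def by (subst prod.remove[of _ i]) (auto intro!: prod.cong)
  finally show ?thesis .
qed

lemma monomial_split: "monomial \<alpha> x = (x $ i) ^ \<alpha> i * monomial (\<alpha>(i := 0)) x"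
  using monomial_to_facet[of \<alpha> i "x $ i" x] by simp

lemma monomial_Suc: "monomial (\<alpha>(i := Suc (\<alpha> i))) x = x $ i * monomial \<alpha> x"
  by (subst (1 2) monomial_split[of _ _ i]) simp

lemma slice_poly_monomial: "\<alpha> i \<le> n \<Longrightarrow> slice_poly i n (monomial \<alpha>)"
  unfolding slice_poly_def
  by (auto intro!: exI[of _ "monom (monomial (\<alpha>(i := 0)) _) (\<alpha> i)"]
      intro: order_trans[OF degree_monom_le] simp: poly_monom monomial_to_facet)

lemma slice_poly_span:
  assumes "f \<in> fun_space.span S" "\<And>g. g \<in> S \<Longrightarrow> slice_poly i n g"
  shows "slice_poly i n f"
  using assms(1)
proof (induction rule: fun_space.span_induct_alt)
  case base
  then show ?case using slice_poly_0 by (simp add: zero_fun_def)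
next
  case (step c x y)
  show ?case
    using slice_poly_add[OF slice_poly_cmult[OF assms(2)[OF step(1)], of c] step(2)]
    by (simp add: fun_scale_def plus_fun_def)
qed

text \<open>
  Induction on the set \<open>J\<close> of coordinates that are not yet fixed: along one coordinate line, a
  polynomial with more zeros than its degree vanishes.
\<close>

lemma poly_zero_on_grid:
  fixes f :: "real^'d::finite \<Rightarrow> real"
  assumes "\<And>j. j \<in> J \<Longrightarrow> slice_poly j n f"
    and N: "\<And>j. j \<in> J \<Longrightarrow> infinite (N j) \<or> card (N j) > n"
    and zero: "\<And>y. (\<forall>j\<in>J. y $ j \<in> N j) \<Longrightarrow> (\<forall>j. j \<notin> J \<longrightarrow> y $ j = x $ j) \<Longrightarrow> f y = 0"
  shows "f x = 0"
  using finite[of J] assms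
proof (induction J arbitrary: x rule: finite_induct)
  case empty
  then show ?case by (metis empty_iff)
next
  case (insert i J)
  obtain p where p: "degree p \<le> n" "\<And>t. f (to_facet i t x) = poly p t"
    using slice_polyD insert.prems(1)[of i] by blast
  have "poly p t = 0" if "t \<in> N i" for t
  proof -
    have "f (to_facet i t x) = 0"
    proof (rule insert.IH)
      fix y assume "\<forall>j\<in>J. y $ j \<in> N j" "\<forall>j. j \<notin> J \<longrightarrow> y $ j = to_facet i t x $ j"
      then show "f y = 0"
        using insert.prems(3)[of y] that insert.hyps by auto
    qed (use insert.prems in auto)
    then show ?thesis using p by simp
  qed
  then have sub: "N i \<subseteq> {t. poly p t = 0}" by auto
  have "p = 0"
  proof (rule ccontr)
    assume "p \<noteq> 0"
    then have "finite {t. poly p t = 0}" "card {t. poly p t = 0} \<le> degree p"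
      by (auto intro: poly_roots_finite card_poly_roots_bound)
    then have "finite (N i) \<and> card (N i) \<le> n"
      using sub p(1) by (meson card_mono finite_subset le_trans)
    then show False using insert.prems(2)[of i] by simp
  qed
  then show ?case using p(2)[of "x $ i"] by simp
qed

text \<open>
  For a function that is polynomial of degree at most \<open>n\<close> in coordinate \<open>i\<close>, this is the coefficient
  of \<open>(x i)^n\<close>, a function of the other coordinates.  It is written as the divided difference over the
  points \<open>0, ..., n\<close>, so that linearity and commutation in different coordinates hold for
  arbitrary functions.
\<close>

definition lead :: "'d::finite \<Rightarrow> nat \<Rightarrow> (real^'d \<Rightarrow> real) \<Rightarrow> real^'d \<Rightarrow> real" where
  "lead i n f x = (\<Sum>m\<le>n. f (to_facet i (real m) x) / (\<Prod>l\<in>{..n} - {m}. real m - real l))"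

text \<open>
  The polynomial equals its Lagrange interpolant at \<open>0, ..., n\<close>, and the products in the interpolant
  are monic of degree \<open>n\<close>.
\<close>

lemma lagrange_lead_coeff:
  fixes p :: "real poly"
  assumes "degree p \<le> n"
  shows "(\<Sum>m\<le>n. poly p (real m) / (\<Prod>l\<in>{..n} - {m}. real m - real l)) = coeff p n"
proof -
  define L where "L m = (\<Prod>l\<in>{..n} - {m}. [:- real l, 1:])" for m
  define d where "d m = (\<Prod>l\<in>{..n} - {m}. real m - real l)" for m
  define q where "q = (\<Sum>m\<le>n. smult (poly p (real m) / d m) (L m))"
  have deg: "degree (L m) = n" if "m \<le> n" for m
    unfolding L_def by (subst degree_prod_sum_eq) (use that in auto)
  have mon: "coeff (L m) n = 1" if "m \<le> n" for m
  proof -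
    have "lead_coeff (L m) = 1" unfolding L_def by (simp add: lead_coeff_prod)
    then show ?thesis using deg[OF that] by simp
  qed
  have d: "d m \<noteq> 0" for m unfolding d_def by simp
  have ev: "poly (L m) (real j) = (if j = m then d m else 0)" if "j \<le> n" for m j
    using that by (auto simp: L_def d_def poly_prod)
  have "poly q (real j) = poly p (real j)" if "j \<le> n" for j
  proof -
    have "poly q (real j) = (\<Sum>m\<le>n. poly p (real m) / d m * (if j = m then d m else 0))"
      by (simp add: q_def poly_sum ev[OF that])
    also have "\<dots> = (\<Sum>m\<le>n. if j = m then poly p (real m) else 0)"
      by (rule sum.cong) (use d in auto)
    finally show ?thesis using that by simp
  qed
  then have sub: "real ` {..n} \<subseteq> {t. poly (p - q) t = 0}" by auto
  have "degree q \<le> n"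
    unfolding q_def by (rule degree_sum_le) (simp_all add: order_trans[OF degree_smult_le] deg)
  then have deg_diff: "degree (p - q) \<le> n"
    using assms by (simp add: degree_diff_le)
  have "p - q = 0"
  proof (rule ccontr)
    assume "p - q \<noteq> 0"
    then have "card (real ` {..n}) \<le> degree (p - q)"
      using card_mono[OF poly_roots_finite sub] card_poly_roots_bound le_trans by blast
    then show False using deg_diff by (simp add: card_image inj_on_def)
  qed
  then have "coeff p n = coeff q n" by simp
  also have "\<dots> = (\<Sum>m\<le>n. poly p (real m) / d m)"
    unfolding q_def by (simp add: coeff_sum mon)
  finally show ?thesis by (simp add: d_def)
qed

lemma lead_slice:
  assumes "\<And>t. f (to_facet i t x) = poly p t" "degree p \<le> n"
  shows "lead i n f x = coeff p n"
  unfolding lead_def assms(1) by (rule lagrange_lead_coeff[OF assms(2)])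

lemma lead_add: "lead i n (\<lambda>x. f x + g x) = (\<lambda>x. lead i n f x + lead i n g x)"
  by (rule ext) (simp add: lead_def sum.distrib add_divide_distrib)

lemma lead_0 [simp]: "lead i n (\<lambda>x. 0) = (\<lambda>x. 0)"
  by (rule ext) (simp add: lead_def)

lemma lead_cmult: "lead i n (\<lambda>x. c * f x) = (\<lambda>x. c * lead i n f x)"
  by (rule ext) (simp add: lead_def sum_distrib_left)

lemma lead_sum: "lead i n (\<lambda>x. \<Sum>a\<in>A. f a x) = (\<lambda>x. \<Sum>a\<in>A. lead i n (f a) x)"
  by (induction A rule: infinite_finite_induct) (auto simp: lead_add)

lemma lead_commute:
  assumes "i \<noteq> j"
  shows "lead i n (lead j m f) = lead j m (lead i n f)"
proof
  fix x
  show "lead i n (lead j m f) x = lead j m (lead i n f) x"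
    unfolding lead_def sum_divide_distrib
    by (subst sum.swap) (simp add: to_facet_commute[OF assms] mult.commute)
qed

lemma lead_mult_other:
  assumes "\<And>t x. g (to_facet i t x) = g x"
  shows "lead i n (\<lambda>x. g x * f x) = (\<lambda>x. g x * lead i n f x)"
  by (rule ext) (simp add: lead_def assms sum_distrib_left)

lemma lead_to_facet [simp]: "lead i n f (to_facet i t x) = lead i n f x"
  by (simp add: lead_def)

lemma lead_monomial:
  assumes "\<alpha> i \<le> n"
  shows "lead i n (monomial \<alpha>) = (\<lambda>x. if \<alpha> i = n then monomial (\<alpha>(i := 0)) x else 0)"
proof
  fix x
  have "lead i n (monomial \<alpha>) x = coeff (monom (monomial (\<alpha>(i := 0)) x) (\<alpha> i)) n"
    using assms by (intro lead_slice) (auto simp: poly_monom monomial_to_facet intro: order_trans[OF degree_monom_le])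
  then show "lead i n (monomial \<alpha>) x = (if \<alpha> i = n then monomial (\<alpha>(i := 0)) x else 0)"
    by simp
qed

section \<open>Partial derivatives\<close>

lemma partial_slice:
  assumes "f differentiable at x"
  shows "((\<lambda>t. f (to_facet j t x)) has_real_derivative partial j f x) (at (x $ j))"
proof -
  have f: "(f has_derivative frechet_derivative f (at x)) (at (to_facet j (x $ j) x))"
    using assms[unfolded frechet_derivative_works] by simp
  have "((\<lambda>t. to_facet j t x) has_derivative (\<lambda>h. h *\<^sub>R axis j 1)) (at (x $ j))"
    unfolding to_facet_eq by (auto intro!: derivative_eq_intros)
  from diff_chain_at[OF this f]
  have "((\<lambda>t. f (to_facet j t x)) has_derivative (\<lambda>h. frechet_derivative f (at x) (h *\<^sub>R axis j 1))) (at (x $ j))"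
    by (simp add: o_def)
  moreover have "frechet_derivative f (at x) (h *\<^sub>R axis j 1) = partial j f x * h" for h
    using linear_cmul[OF linear_frechet_derivative[OF assms], of h "axis j 1"]
    by (simp add: partial_def)
  ultimately show ?thesis by (simp add: has_field_derivative_def)
qed

lemma partial_eqI:
  assumes "f differentiable at x"
    and "((\<lambda>t. f (to_facet j t x)) has_real_derivative D) (at (x $ j))"
  shows "partial j f x = D"
  using DERIV_unique[OF partial_slice[OF assms(1)] assms(2)] .

lemma partial_add:
  assumes "f differentiable at x" "g differentiable at x"
  shows "partial j (\<lambda>x. f x + g x) x = partial j f x + partial j g x"
  by (rule partial_eqI) (auto intro!: assms derivative_intros partial_slice)

lemma partial_cmult:
  assumes "f differentiable at x"
  shows "partial j (\<lambda>x. c * f x) x = c * partial j f x"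
  by (rule partial_eqI) (auto intro!: assms derivative_eq_intros partial_slice)

lemma partial_minus:
  assumes "f differentiable at x"
  shows "partial j (\<lambda>x. - f x) x = - partial j f x"
  by (rule partial_eqI) (auto intro!: assms derivative_intros partial_slice)

lemma partial_mult:
  assumes "f differentiable at x" "g differentiable at x"
  shows "partial j (\<lambda>x. f x * g x) x = partial j f x * g x + f x * partial j g x"
  by (rule partial_eqI[OF differentiable_mult[OF assms]])
    (auto intro!: assms derivative_eq_intros partial_slice)

lemma partial_const [simp]: "partial j (\<lambda>x. c) x = 0"
  by (rule partial_eqI) auto

lemma differentiable_vec_nth: "(\<lambda>x. x $ i) differentiable at (x :: real^'d::finite)"
  by (rule bounded_linear_imp_differentiable[OF bounded_linear_vec_nth])

lemma differentiable_monomial: "monomial \<alpha> differentiable at x"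
proof -
  have "(\<lambda>x. \<Prod>i\<in>A. (x $ i) ^ \<alpha> i) differentiable at x" for A
    by (induction A rule: infinite_finite_induct)
      (simp_all add: differentiable_mult differentiable_power differentiable_vec_nth)
  then show ?thesis by (simp add: monomial_def[abs_def])
qed

lemma partial_monomial:
  "partial j (monomial \<alpha>) = (\<lambda>x. real (\<alpha> j) * monomial (\<alpha>(j := \<alpha> j - 1)) x)"
proof
  fix x
  have "((\<lambda>t. t ^ \<alpha> j * monomial (\<alpha>(j := 0)) x) has_real_derivative
      (real (\<alpha> j) * (x $ j) ^ (\<alpha> j - 1)) * monomial (\<alpha>(j := 0)) x) (at (x $ j))"
    by (auto intro!: derivative_eq_intros)
  then have "partial j (monomial \<alpha>) x = (real (\<alpha> j) * (x $ j) ^ (\<alpha> j - 1)) * monomial (\<alpha>(j := 0)) x"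
    by (intro partial_eqI[OF differentiable_monomial]) (simp add: monomial_to_facet)
  also have "\<dots> = real (\<alpha> j) * monomial (\<alpha>(j := \<alpha> j - 1)) x"
    by (subst (2) monomial_split[of _ _ j]) simp
  finally show "partial j (monomial \<alpha>) x = real (\<alpha> j) * monomial (\<alpha>(j := \<alpha> j - 1)) x" .
qed

section \<open>Positivity of the Gauss-Lobatto weights\<close>

lemma gauss_lobatto_nodes:
  assumes "gauss_lobatto k \<xi> l" "k \<ge> 1"
  shows "inj_on \<xi> {0..k}" "\<And>i. i \<le> k \<Longrightarrow> - 1 \<le> \<xi> i" "\<And>i. i \<le> k \<Longrightarrow> \<xi> i \<le> 1"
    "\<And>i. i \<le> k \<Longrightarrow> i \<noteq> 0 \<Longrightarrow> - 1 < \<xi> i" "\<And>i. i \<le> k \<Longrightarrow> i \<noteq> k \<Longrightarrow> \<xi> i < 1"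
proof -
  have mono: "strict_mono_on {0..k} \<xi>" and ends: "\<xi> 0 = - 1" "\<xi> k = 1"
    using assms by (auto simp: gauss_lobatto_def)
  show "inj_on \<xi> {0..k}" using mono by (rule strict_mono_on_imp_inj_on)
  show lt0: "- 1 < \<xi> i" if "i \<le> k" "i \<noteq> 0" for i
    using strict_mono_onD[OF mono, of 0 i] that ends by auto
  show ltk: "\<xi> i < 1" if "i \<le> k" "i \<noteq> k" for i
    using strict_mono_onD[OF mono, of i k] that ends by auto
  show "- 1 \<le> \<xi> i" if "i \<le> k" for i
    using lt0[of i] that ends by (cases "i = 0") auto
  show "\<xi> i \<le> 1" if "i \<le> k" for i
    using ltk[of i] that ends by (cases "i = k") auto
qed

text \<open>
  The rule integrates exactly a nonnegative polynomial that vanishes at all nodes but the one of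
  interest: \<open>(x - \<xi> m)^2\<close> for the other interior nodes and the linear factors \<open>1 - x\<close>, \<open>1 + x\<close> for the
  other end points.  Linear factors are enough at the end points, because they do not change sign on
  the interval; this keeps the degree at most \<open>2 * k - 1\<close>.
\<close>

lemma gauss_lobatto_weight_pos:
  assumes gl: "gauss_lobatto k \<xi> l" and k: "k \<ge> 1" and j: "j \<le> k"
  shows "l j > 0"
proof -
  note nodes = gauss_lobatto_nodes[OF gl k]
  define N where "N = {1..<k} - {j}"
  define p1 p2 p3 :: "real poly" where "p1 = (\<Prod>m\<in>N. [:- \<xi> m, 1:] ^ 2)"
    and "p2 = (if j = k then 1 else [:1, - 1:])" and "p3 = (if j = 0 then 1 else [:1, 1:])"
  define p where "p = p1 * p2 * p3"
  have ends: "\<xi> 0 = - 1" "\<xi> k = 1" using gl by (auto simp: gauss_lobatto_def)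
  have "degree p1 \<le> (\<Sum>m\<in>N. degree ([:- \<xi> m, 1:] ^ 2))"
    unfolding p1_def using degree_prod_sum_le[of N "\<lambda>m. [:- \<xi> m, 1:] ^ 2"] by (simp add: N_def o_def)
  also have "\<dots> = 2 * card N" by (simp add: degree_power_eq)
  finally have "degree p \<le> 2 * card N + degree p2 + degree p3"
    unfolding p_def by (meson add_mono degree_mult_le le_trans order_refl)
  also have "\<dots> \<le> 2 * k - 1"
  proof -
    have "card N = (if j = 0 \<or> j = k then k - 1 else k - 2)"
      using j k by (auto simp: N_def card_Diff_singleton_if)
    then show ?thesis using j k by (auto simp: p2_def p3_def)
  qed
  finally have deg: "degree p \<le> 2 * k - 1" .
  have zero: "poly p (\<xi> i) = 0" if "i \<le> k" "i \<noteq> j" for i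
  proof -
    have "i = 0 \<or> i = k \<or> i \<in> N" using that unfolding N_def by auto
    then consider "i = 0" | "i = k" | "i \<in> N" by blast
    then show ?thesis
    proof cases
      case 1 then show ?thesis using that ends by (simp add: p_def p3_def)
    next
      case 2 then show ?thesis using that ends by (simp add: p_def p2_def)
    next
      case 3 then have "finite N" "poly ([:- \<xi> i, 1:] ^ 2) (\<xi> i) = 0" by (auto simp: N_def)
      then show ?thesis using 3 by (auto simp: p_def p1_def poly_prod)
    qed
  qed
  have nonneg: "poly p x \<ge> 0" if "x \<in> {- 1..1}" for x
    using that by (auto simp: p_def p1_def p2_def p3_def poly_prod intro!: mult_nonneg_nonneg prod_nonneg)
  have "\<xi> j \<noteq> \<xi> m" if "m \<in> N" for m
    using nodes(1) that j by (auto simp: N_def inj_on_def)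
  then have pos: "poly p (\<xi> j) > 0"
    using nodes(4)[OF j] nodes(5)[OF j]
    by (auto simp: p_def p1_def p2_def p3_def poly_prod intro!: mult_pos_pos prod_pos)
  have "integral {- 1..1} (poly p) \<ge> 0"
    by (rule integral_nonneg) (auto intro!: integrable_continuous_real continuous_intros nonneg)
  moreover have "integral {- 1..1} (poly p) \<noteq> 0"
    using integral_eq_0_iff[of "- 1" 1 "poly p"] nonneg pos nodes(2,3)[OF j]
    by (force intro!: continuous_intros)
  moreover have "integral {- 1..1} (poly p) = (\<Sum>i=0..k. l i * poly p (\<xi> i))"
    using gl deg by (simp add: gauss_lobatto_def)
  moreover have "\<dots> = l j * poly p (\<xi> j)"
    by (subst sum.remove[of _ j]) (use j zero in auto)
  ultimately show ?thesis using pos by (simp add: zero_less_mult_iff order_le_less)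
qed

section \<open>Generators of the reference velocity space\<close>

definition rt_generators :: "nat \<Rightarrow> (real^'d::finite \<Rightarrow> real^'d) set" where
  "rt_generators k =
     {\<lambda>x. axis i (monomial \<alpha> x) | i \<alpha>. (\<forall>j. j \<noteq> i \<longrightarrow> \<alpha> j < k) \<and> \<alpha> i \<le> k}"

text \<open>
  Up to sign this is \<open>curl (x \<times> q)\<close> for the field \<open>q\<close> whose only nonzero component is the \<open>i\<close>-th, equal
  to \<open>monomial \<alpha>\<close>; the formula is the same in two and in three dimensions and does not depend on the
  numbering of the coordinates.  For \<open>\<alpha> i = 0\<close> the truncated exponent \<open>\<alpha> i - 1\<close> is harmless, because the
  coefficient \<open>\<alpha> i\<close> in front of it vanishes.
\<close>

definition bubble :: "'d::finite \<Rightarrow> ('d \<Rightarrow> nat) \<Rightarrow> real^'d \<Rightarrow> real^'d" where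
  "bubble i \<alpha> x =
     (\<chi> j. if j = i then (\<Sum>l\<in>UNIV - {i}. real (Suc (\<alpha> l))) * monomial \<alpha> x
           else - real (\<alpha> i) * monomial (\<alpha>(i := \<alpha> i - 1, j := Suc (\<alpha> j))) x)"

definition bubble_generators :: "nat \<Rightarrow> (real^'d::finite \<Rightarrow> real^'d) set" where
  "bubble_generators k = {bubble i \<alpha> | i \<alpha>. (\<forall>j. \<alpha> j \<le> k) \<and> (\<exists>j. j \<noteq> i \<and> \<alpha> j = k)}"

lemma axis_in_span:
  assumes "f \<in> fun_space.span S" "\<And>g. g \<in> S \<Longrightarrow> (\<lambda>x. axis i (u x * g x)) \<in> fun_space.span T"
  shows "(\<lambda>x. axis i (u x * f x) :: real^'d::finite) \<in> fun_space.span T"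
  using assms(1)
proof (induction rule: fun_space.span_induct_alt)
  case base
  have "(\<lambda>x. axis i (u x * (0 :: _ \<Rightarrow> real) x) :: real^'d) = 0"
    by (auto simp: fun_eq_iff vec_eq_iff axis_def)
  then show ?case using fun_space.span_zero by metis
next
  case (step c x y)
  have "(\<lambda>z. axis i (u z * (fun_scale c x + y) z)) =
      fun_scale c (\<lambda>z. axis i (u z * x z)) + (\<lambda>z. axis i (u z * y z))"
    by (auto simp: fun_eq_iff fun_scale_def vec_eq_iff axis_def algebra_simps)
  then show ?case
    using fun_space.span_add[OF fun_space.span_scale[OF assms(2)[OF step(1)]] step(2)] by metis
qed

lemma RT_space_subset_span:
  assumes "k \<ge> 1"
  shows "RT_space (k - 1) \<subseteq> fun_space.span (rt_generators k)"
proof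
  fix v :: "real^'d \<Rightarrow> real^'d"
  assume "v \<in> RT_space (k - 1)"
  then obtain a b where v: "v = (\<lambda>x. \<chi> i. a i x + x $ i * b i x)"
    and ab: "\<And>i. a i \<in> Qpoly (k - 1)" "\<And>i. b i \<in> Qpoly (k - 1)"
    unfolding RT_space_def by blast
  have a: "(\<lambda>x. axis i (1 * a i x)) \<in> fun_space.span (rt_generators k)" for i
  proof (rule axis_in_span[OF ab(1)[unfolded Qpoly_def]])
    fix g :: "real^'d \<Rightarrow> real" assume "g \<in> {monomial \<alpha> | \<alpha>. \<forall>i. \<alpha> i \<le> k - 1}"
    then obtain \<alpha> where g: "g = monomial \<alpha>" and le: "\<And>i. \<alpha> i \<le> k - 1" by blast
    have "\<alpha> j < k" for j using le[of j] assms by linarith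
    then have "(\<lambda>x. axis i (1 * g x)) \<in> rt_generators k"
      unfolding rt_generators_def g by (auto intro!: exI[of _ i] exI[of _ \<alpha>] less_imp_le)
    then show "(\<lambda>x. axis i (1 * g x)) \<in> fun_space.span (rt_generators k)"
      by (rule fun_space.span_base)
  qed
  have b: "(\<lambda>x. axis i (x $ i * b i x)) \<in> fun_space.span (rt_generators k)" for i
  proof (rule axis_in_span[OF ab(2)[unfolded Qpoly_def]])
    fix g :: "real^'d \<Rightarrow> real" assume "g \<in> {monomial \<alpha> | \<alpha>. \<forall>i. \<alpha> i \<le> k - 1}"
    then obtain \<alpha> where g: "g = monomial \<alpha>" and le: "\<And>i. \<alpha> i \<le> k - 1" by blast
    have "\<alpha> j < k" for j using le[of j] assms by linarith
    then have "(\<lambda>x. axis i (x $ i * g x)) \<in> rt_generators k"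
      unfolding rt_generators_def g monomial_Suc[symmetric]
      by (auto intro!: exI[of _ i] exI[of _ "\<alpha>(i := Suc (\<alpha> i))"] simp: Suc_le_eq)
    then show "(\<lambda>x. axis i (x $ i * g x)) \<in> fun_space.span (rt_generators k)"
      by (rule fun_space.span_base)
  qed
  have "v = (\<Sum>i\<in>UNIV. (\<lambda>x. axis i (1 * a i x)) + (\<lambda>x. axis i (x $ i * b i x)))"
  proof
    fix x
    have "(\<Sum>i\<in>UNIV. axis i (1 * a i x) + axis i (x $ i * b i x)) $ j = v x $ j" for j
    proof -
      have "(\<Sum>i\<in>UNIV. axis i (1 * a i x) + axis i (x $ i * b i x)) $ j =
          (\<Sum>i\<in>UNIV. if i = j then a j x + x $ j * b j x else 0)"
        unfolding sum_component by (rule sum.cong) (auto simp: axis_def)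
      then show ?thesis by (simp add: v)
    qed
    then show "v x = (\<Sum>i\<in>UNIV. (\<lambda>x. axis i (1 * a i x)) + (\<lambda>x. axis i (x $ i * b i x))) x"
      by (simp add: sum_fun_apply vec_eq_iff)
  qed
  then show "v \<in> fun_space.span (rt_generators k)"
    using a b by (auto intro!: fun_space.span_sum fun_space.span_add)
qed

lemma differentiable_cross_3d:
  assumes "\<And>i. (\<lambda>x. q x $ i) differentiable at x"
  shows "(\<lambda>y. cross_3d \<iota> y (q y) $ j) differentiable at x"
  by (cases "j = \<iota> 1"; cases "j = \<iota> 2"; cases "j = \<iota> 3")
    (simp_all add: cross_3d_def axis_def assms differentiable_vec_nth)

lemma differentiable_cross_2d:
  assumes "\<And>i. (\<lambda>x. q x $ i) differentiable at x"
  shows "(\<lambda>y. cross_2d \<iota> y (q y)) differentiable at x"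
  by (simp add: cross_2d_def assms differentiable_vec_nth)

text \<open>
  Differentiability is required because the derivative of a nondifferentiable function is arbitrary
  and hence not additive.
\<close>

lemma curl_x_cross_linear:
  fixes q r :: "real^'d::finite \<Rightarrow> real^'d"
  assumes q: "\<And>i x. (\<lambda>x. q x $ i) differentiable at x"
    and r: "\<And>i x. (\<lambda>x. r x $ i) differentiable at x"
  shows "curl_x_cross \<iota> (fun_scale c q + r) = fun_scale c (curl_x_cross \<iota> q) + curl_x_cross \<iota> r"
proof (cases "CARD('d) = 2")
  case True
  have eq: "(\<lambda>x. cross_2d \<iota> x ((fun_scale c q + r) x)) =
      (\<lambda>x. c * cross_2d \<iota> x (q x) + cross_2d \<iota> x (r x))"
    by (auto simp: cross_2d_def fun_scale_def algebra_simps)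
  show ?thesis
    unfolding curl_x_cross_def if_P[OF True] eq
    by (auto simp: fun_eq_iff curl_2d_def fun_scale_def partial_add partial_cmult
        differentiable_cross_2d q r vec_eq_iff axis_def algebra_simps)
next
  case False
  have eq: "(\<lambda>x. cross_3d \<iota> x ((fun_scale c q + r) x) $ j) =
      (\<lambda>x. c * cross_3d \<iota> x (q x) $ j + cross_3d \<iota> x (r x) $ j)" for j
    by (auto simp: cross_3d_def fun_scale_def axis_def algebra_simps)
  show ?thesis
    unfolding curl_x_cross_def if_not_P[OF False] curl_3d_def eq
    by (auto simp: fun_eq_iff curl_3d_def fun_scale_def partial_add partial_cmult
        differentiable_cross_3d q r vec_eq_iff axis_def algebra_simps)
qed

lemma curl_x_cross_zero: "curl_x_cross \<iota> (0 :: real^'d::finite \<Rightarrow> real^'d) = 0"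
proof -
  have "curl_x_cross \<iota> (fun_scale (- 1) 0 + 0) = fun_scale (- 1) (curl_x_cross \<iota> 0) + curl_x_cross \<iota> (0 :: real^'d \<Rightarrow> real^'d)"
    by (rule curl_x_cross_linear) simp_all
  moreover have "fun_scale (- 1) f + f = 0" for f :: "real^'d \<Rightarrow> real^'d"
    by (simp add: fun_scale_def fun_eq_iff)
  ultimately show ?thesis by metis
qed

lemma coordinates_2:
  fixes \<iota> :: "nat \<Rightarrow> 'd::finite"
  assumes "bij_betw \<iota> {1..CARD('d)} UNIV" "CARD('d) = 2"
  shows "\<iota> 1 \<noteq> \<iota> 2" "(UNIV :: 'd set) = {\<iota> 1, \<iota> 2}"
proof -
  have "{1..2 :: nat} = {1, 2}" by auto
  then show "\<iota> 1 \<noteq> \<iota> 2" "(UNIV :: 'd set) = {\<iota> 1, \<iota> 2}"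
    using assms by (auto simp: bij_betw_def inj_on_def)
qed

lemma coordinates_3:
  fixes \<iota> :: "nat \<Rightarrow> 'd::finite"
  assumes "bij_betw \<iota> {1..CARD('d)} UNIV" "CARD('d) = 3"
  shows "\<iota> 1 \<noteq> \<iota> 2" "\<iota> 1 \<noteq> \<iota> 3" "\<iota> 2 \<noteq> \<iota> 3" "(UNIV :: 'd set) = {\<iota> 1, \<iota> 2, \<iota> 3}"
proof -
  have "{1..3 :: nat} = {1, 2, 3}" by auto
  then show "\<iota> 1 \<noteq> \<iota> 2" "\<iota> 1 \<noteq> \<iota> 3" "\<iota> 2 \<noteq> \<iota> 3" "(UNIV :: 'd set) = {\<iota> 1, \<iota> 2, \<iota> 3}"
    using assms by (auto simp: bij_betw_def inj_on_def)
qed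

text \<open>
  The sign depends on the dimension because \<open>curl\<close> of a scalar is \<open>(- \<partial>\<^sub>2, \<partial>\<^sub>1)\<close> in the plane.
\<close>

lemma curl_x_cross_monomial:
  fixes \<iota> :: "nat \<Rightarrow> 'd::finite"
  assumes dim: "CARD('d) = 2 \<or> CARD('d) = 3" and \<iota>: "bij_betw \<iota> {1..CARD('d)} UNIV"
  shows "curl_x_cross \<iota> (\<lambda>x. axis i (monomial \<alpha> x)) =
    fun_scale (if CARD('d) = 2 then 1 else - 1) (bubble i \<alpha>)"
proof (cases "CARD('d) = 2")
  case True
  note c = coordinates_2[OF \<iota> True] 
  have cross: "(\<lambda>x. cross_2d \<iota> x (axis (\<iota> 1) (monomial \<alpha> x))) =
      (\<lambda>x. - monomial (\<alpha>(\<iota> 2 := Suc (\<alpha> (\<iota> 2)))) x)"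
    "(\<lambda>x. cross_2d \<iota> x (axis (\<iota> 2) (monomial \<alpha> x))) = monomial (\<alpha>(\<iota> 1 := Suc (\<alpha> (\<iota> 1))))"
    using c(1) by (auto simp: fun_eq_iff cross_2d_def axis_def monomial_Suc)
  have all: "(\<forall>j. P j) \<longleftrightarrow> P (\<iota> 1) \<and> P (\<iota> 2)" for P
    using c(2) by (metis UNIV_I empty_iff insert_iff)
  consider "i = \<iota> 1" | "i = \<iota> 2" using c by auto
  then show ?thesis
  proof cases
    case 1
    have "UNIV - {\<iota> 1} = {\<iota> 2}" using c(1) unfolding c(2) by auto
    then have s: "(\<Sum>l\<in>UNIV - {\<iota> 1}. real (Suc (\<alpha> l))) = real (\<alpha> (\<iota> 2)) + 1" by simp
    show ?thesis
      unfolding curl_x_cross_def if_P[OF True] curl_2d_def 1 cross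
      using c(1)
      by (simp add: s[simplified] fun_eq_iff partial_minus partial_monomial differentiable_monomial
          vec_eq_iff all axis_def bubble_def fun_scale_def fun_upd_twist algebra_simps)
  next
    case 2
    have "UNIV - {\<iota> 2} = {\<iota> 1}" using c(1) unfolding c(2) by auto
    then have s: "(\<Sum>l\<in>UNIV - {\<iota> 2}. real (Suc (\<alpha> l))) = real (\<alpha> (\<iota> 1)) + 1" by simp
    show ?thesis
      unfolding curl_x_cross_def if_P[OF True] curl_2d_def 2 cross
      using c(1)
      by (simp add: s[simplified] fun_eq_iff partial_minus partial_monomial differentiable_monomial
          vec_eq_iff all axis_def bubble_def fun_scale_def fun_upd_twist algebra_simps)
  qed
next
  case False
  then have d3: "CARD('d) = 3" using dim by simp
  note c = coordinates_3[OF \<iota> d3] 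
  have n: "\<iota> 2 \<noteq> \<iota> 1" "\<iota> 3 \<noteq> \<iota> 1" "\<iota> 3 \<noteq> \<iota> 2" using c by auto
  have neq: "a \<noteq> b \<Longrightarrow> UNIV - {a} = {b, c'} \<Longrightarrow> b \<noteq> c' \<Longrightarrow>
     (\<Sum>l\<in>UNIV - {a}. real (Suc (\<alpha> l))) = real (\<alpha> b) + real (\<alpha> c') + 2" for a b c' :: 'd by simp
  have all: "(\<forall>j. P j) \<longleftrightarrow> P (\<iota> 1) \<and> P (\<iota> 2) \<and> P (\<iota> 3)" for P
    using c(4) by (metis UNIV_I empty_iff insert_iff)
  consider "i = \<iota> 1" | "i = \<iota> 2" | "i = \<iota> 3" using c by auto
  then show ?thesis
  proof cases
    case 1
    have "UNIV - {\<iota> 1} = {\<iota> 2, \<iota> 3}" using c(1-3) unfolding c(4) by auto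
    note s = neq[OF c(1) this c(3)]
    have cross: "(\<lambda>x. cross_3d \<iota> x (axis (\<iota> 1) (monomial \<alpha> x)) $ \<iota> 1) = (\<lambda>x. 0)"
      "(\<lambda>x. cross_3d \<iota> x (axis (\<iota> 1) (monomial \<alpha> x)) $ \<iota> 2) = monomial (\<alpha>(\<iota> 3 := Suc (\<alpha> (\<iota> 3))))"
      "(\<lambda>x. cross_3d \<iota> x (axis (\<iota> 1) (monomial \<alpha> x)) $ \<iota> 3) = (\<lambda>x. - monomial (\<alpha>(\<iota> 2 := Suc (\<alpha> (\<iota> 2)))) x)"
      using c(1-3) n by (auto simp: fun_eq_iff cross_3d_def axis_def monomial_Suc)
    show ?thesis
      unfolding curl_x_cross_def if_not_P[OF False] curl_3d_def 1 cross
      using c(1-3) n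
      by (simp add: s[simplified] fun_eq_iff partial_minus partial_monomial differentiable_monomial
          vec_eq_iff all axis_def bubble_def fun_scale_def fun_upd_twist algebra_simps)
  next
    case 2
    have "UNIV - {\<iota> 2} = {\<iota> 1, \<iota> 3}" using c(1-3) unfolding c(4) by auto
    note s = neq[OF n(1) this c(2)]
    have cross: "(\<lambda>x. cross_3d \<iota> x (axis (\<iota> 2) (monomial \<alpha> x)) $ \<iota> 2) = (\<lambda>x. 0)"
      "(\<lambda>x. cross_3d \<iota> x (axis (\<iota> 2) (monomial \<alpha> x)) $ \<iota> 3) = monomial (\<alpha>(\<iota> 1 := Suc (\<alpha> (\<iota> 1))))"
      "(\<lambda>x. cross_3d \<iota> x (axis (\<iota> 2) (monomial \<alpha> x)) $ \<iota> 1) = (\<lambda>x. - monomial (\<alpha>(\<iota> 3 := Suc (\<alpha> (\<iota> 3)))) x)"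
      using c(1-3) n by (auto simp: fun_eq_iff cross_3d_def axis_def monomial_Suc)
    show ?thesis
      unfolding curl_x_cross_def if_not_P[OF False] curl_3d_def 2 cross
      using c(1-3) n
      by (simp add: s[simplified] fun_eq_iff partial_minus partial_monomial differentiable_monomial
          vec_eq_iff all axis_def bubble_def fun_scale_def fun_upd_twist algebra_simps)
  next
    case 3
    have "UNIV - {\<iota> 3} = {\<iota> 1, \<iota> 2}" using c(1-3) unfolding c(4) by auto
    note s = neq[OF n(2) this c(1)]
    have cross: "(\<lambda>x. cross_3d \<iota> x (axis (\<iota> 3) (monomial \<alpha> x)) $ \<iota> 3) = (\<lambda>x. 0)"
      "(\<lambda>x. cross_3d \<iota> x (axis (\<iota> 3) (monomial \<alpha> x)) $ \<iota> 1) = monomial (\<alpha>(\<iota> 2 := Suc (\<alpha> (\<iota> 2))))"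
      "(\<lambda>x. cross_3d \<iota> x (axis (\<iota> 3) (monomial \<alpha> x)) $ \<iota> 2) = (\<lambda>x. - monomial (\<alpha>(\<iota> 1 := Suc (\<alpha> (\<iota> 1)))) x)"
      using c(1-3) n by (auto simp: fun_eq_iff cross_3d_def axis_def monomial_Suc)
    show ?thesis
      unfolding curl_x_cross_def if_not_P[OF False] curl_3d_def 3 cross
      using c(1-3) n
      by (simp add: s[simplified] fun_eq_iff partial_minus partial_monomial differentiable_monomial
          vec_eq_iff all axis_def bubble_def fun_scale_def fun_upd_twist algebra_simps)
  qed
qed

lemma B_space_curl:
  fixes \<iota> :: "nat \<Rightarrow> 'd::finite"
  assumes dim: "CARD('d) = 2 \<or> CARD('d) = 3" and \<iota>: "bij_betw \<iota> {1..CARD('d)} UNIV"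
    and q: "q \<in> B_space k i"
  shows "(\<lambda>x. q x $ j) differentiable at x" "curl_x_cross \<iota> q \<in> fun_space.span (bubble_generators k)"
proof -
  have diff: "(\<lambda>x. axis i (monomial \<alpha> x) $ j) differentiable at x" for \<alpha> j and x :: "real^'d"
    by (cases "j = i") (simp_all add: axis_def differentiable_monomial)
  have "(\<forall>j x. (\<lambda>x. q x $ j) differentiable at x) \<and> curl_x_cross \<iota> q \<in> fun_space.span (bubble_generators k)"
    using q unfolding B_space_def
  proof (induction rule: fun_space.span_induct_alt)
    case base
    show ?case
    proof (intro conjI allI)
      show "(\<lambda>x. (0 :: real^'d \<Rightarrow> real^'d) x $ j) differentiable at x" for j x by simp
      show "curl_x_cross \<iota> (0 :: real^'d \<Rightarrow> real^'d) \<in> fun_space.span (bubble_generators k)"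
        unfolding curl_x_cross_zero by (rule fun_space.span_zero)
    qed
  next
    case (step c g y)
    then obtain \<alpha> where g: "g = (\<lambda>x. axis i (monomial \<alpha> x))"
      and \<alpha>: "\<forall>j. \<alpha> j \<le> k" "\<exists>j. j \<noteq> i \<and> \<alpha> j = k" by auto
    have "bubble i \<alpha> \<in> bubble_generators k" unfolding bubble_generators_def using \<alpha> by blast
    then have "curl_x_cross \<iota> g \<in> fun_space.span (bubble_generators k)"
      unfolding g curl_x_cross_monomial[OF dim \<iota>] by (intro fun_space.span_scale fun_space.span_base)
    moreover have "curl_x_cross \<iota> (fun_scale c g + y) = fun_scale c (curl_x_cross \<iota> g) + curl_x_cross \<iota> y"
      using step(2) by (intro curl_x_cross_linear) (simp_all only: g diff)
    moreover have "(\<lambda>x. (fun_scale c g + y) x $ j) differentiable at x" for j x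
      using step(2) diff by (simp add: fun_scale_def g)
    moreover have "fun_scale c (curl_x_cross \<iota> g) + curl_x_cross \<iota> y \<in> fun_space.span (bubble_generators k)"
      using step(2) calculation(1) by (intro fun_space.span_add fun_space.span_scale) auto
    ultimately show ?case by metis
  qed
  then show "(\<lambda>x. q x $ j) differentiable at x" "curl_x_cross \<iota> q \<in> fun_space.span (bubble_generators k)"
    by auto
qed

lemma V_ref_subset_span:
  fixes \<iota> :: "nat \<Rightarrow> 'd::finite"
  assumes dim: "CARD('d) = 2 \<or> CARD('d) = 3" and \<iota>: "bij_betw \<iota> {1..CARD('d)} UNIV" and k: "k \<ge> 1"
  shows "V_ref \<iota> k \<subseteq> fun_space.span (rt_generators k \<union> bubble_generators k)"
proof
  fix v assume "v \<in> V_ref \<iota> k"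
  then obtain r q where v: "v = (\<lambda>x. r x + (\<Sum>i\<in>UNIV. curl_x_cross \<iota> (q i) x))"
    and r: "r \<in> RT_space (k - 1)" and q: "\<And>i. q i \<in> B_space k i"
    unfolding V_ref_def B_tilde_def by blast
  have "v = r + (\<Sum>i\<in>UNIV. curl_x_cross \<iota> (q i))"
    by (simp add: v fun_eq_iff sum_fun_apply)
  moreover have "r \<in> fun_space.span (rt_generators k \<union> bubble_generators k)"
    using RT_space_subset_span[OF k] r fun_space.span_mono[of "rt_generators k" "rt_generators k \<union> bubble_generators k"] by blast
  moreover have "curl_x_cross \<iota> (q i) \<in> fun_space.span (rt_generators k \<union> bubble_generators k)" for i
    using B_space_curl(2)[OF dim \<iota> q] fun_space.span_mono[of "bubble_generators k" "rt_generators k \<union> bubble_generators k"] by blast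
  ultimately show "v \<in> fun_space.span (rt_generators k \<union> bubble_generators k)"
    by (simp add: fun_space.span_add fun_space.span_sum)
qed

section \<open>Unisolvence of the velocity nodes\<close>

text \<open>
  Linear conditions that all reference velocities satisfy and that suffice for unisolvence.  Beyond
  the degree bounds they say that the divergence has no term of degree \<open>k\<close> in any variable, that the
  coefficients of \<open>(x i)^(k + 1) * (x j)^k\<close> in component \<open>i\<close> and of \<open>(x j)^(k + 1) * (x i)^k\<close> in component
  \<open>j\<close> agree, and that in three dimensions component \<open>l\<close> does not contain
  \<open>(x l)^(k + 1) * (x i)^k * (x j)^k\<close>.
\<close>

definition enhanced_field :: "nat \<Rightarrow> (real^'d::finite \<Rightarrow> real^'d) \<Rightarrow> bool" where
  "enhanced_field k v \<longleftrightarrow>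
     (\<forall>i x. (\<lambda>x. v x $ i) differentiable at x) \<and>
     (\<forall>i. slice_poly i (Suc k) (\<lambda>x. v x $ i)) \<and>
     (\<forall>i j. i \<noteq> j \<longrightarrow> slice_poly j k (\<lambda>x. v x $ i)) \<and>
     (\<forall>j. lead j k (\<lambda>x. \<Sum>i\<in>UNIV. partial i (\<lambda>x. v x $ i) x) = (\<lambda>x. 0)) \<and>
     (\<forall>i j. i \<noteq> j \<longrightarrow>
        lead j k (lead i (Suc k) (\<lambda>x. v x $ i)) = lead i k (lead j (Suc k) (\<lambda>x. v x $ j))) \<and>
     (\<forall>i j l. i \<noteq> j \<longrightarrow> i \<noteq> l \<longrightarrow> j \<noteq> l \<longrightarrow> CARD('d) = 3 \<longrightarrow>
        lead j k (lead i k (lead l (Suc k) (\<lambda>x. v x $ l))) = (\<lambda>x. 0))"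

lemma enhanced_field_linear:
  fixes v w :: "real^'d::finite \<Rightarrow> real^'d"
  assumes v: "enhanced_field k v" and w: "enhanced_field k w"
  shows "enhanced_field k (fun_scale c v + w)"
proof -
  have comp: "(\<lambda>x. (fun_scale c v + w) x $ i) = (\<lambda>x. c * (v x $ i) + w x $ i)" for i
    by (simp add: fun_scale_def)
  have dv: "(\<lambda>x. v x $ i) differentiable at x" and dw: "(\<lambda>x. w x $ i) differentiable at x" for i x
    using v w by (simp_all add: enhanced_field_def)
  have part: "partial i (\<lambda>x. c * (v x $ i) + w x $ i) =
      (\<lambda>x. c * partial i (\<lambda>x. v x $ i) x + partial i (\<lambda>x. w x $ i) x)" for i
    by (simp add: fun_eq_iff partial_add partial_cmult dv dw)
  have div: "(\<lambda>x. \<Sum>i\<in>UNIV. partial i (\<lambda>x. c * (v x $ i) + w x $ i) x) =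
      (\<lambda>x. c * (\<Sum>i\<in>UNIV. partial i (\<lambda>x. v x $ i) x) + (\<Sum>i\<in>UNIV. partial i (\<lambda>x. w x $ i) x))"
    by (simp add: part sum.distrib sum_distrib_left)
  show ?thesis
    unfolding enhanced_field_def comp div lead_add lead_cmult
    using v w
    by (simp add: enhanced_field_def slice_poly_add slice_poly_cmult)
qed

lemma enhanced_field_0: "enhanced_field k (0 :: real^'d::finite \<Rightarrow> real^'d)"
  by (simp add: enhanced_field_def slice_poly_0)

lemma lead_monomial_less: "\<alpha> i < n \<Longrightarrow> lead i n (monomial \<alpha>) = (\<lambda>x. 0)"
  by (simp add: lead_monomial)

lemma enhanced_field_rt:
  assumes v: "v \<in> rt_generators k" and k: "k \<ge> 1"
  shows "enhanced_field k v"
proof -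
  obtain m \<alpha> where v: "v = (\<lambda>x. axis m (monomial \<alpha> x))"
    and \<alpha>: "\<And>j. j \<noteq> m \<Longrightarrow> \<alpha> j < k" "\<alpha> m \<le> k"
    using v unfolding rt_generators_def by blast
  have comp: "(\<lambda>x. v x $ i) = (if i = m then monomial \<alpha> else (\<lambda>x. 0))" for i
    by (auto simp: v axis_def)
  have le: "\<alpha> j \<le> k" for j using \<alpha>(1)[of j] \<alpha>(2) by (cases "j = m") auto
  have div: "(\<lambda>x. \<Sum>i\<in>UNIV. partial i (if i = m then monomial \<alpha> else (\<lambda>x. 0)) x) =
     (\<lambda>x. real (\<alpha> m) * monomial (\<alpha>(m := \<alpha> m - 1)) x)"
  proof
    fix x
    have "(\<Sum>i\<in>UNIV. partial i (if i = m then monomial \<alpha> else (\<lambda>x. 0)) x) =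
        (\<Sum>i\<in>UNIV. if i = m then partial i (monomial \<alpha>) x else 0)"
      by (rule sum.cong) auto
    then show "(\<Sum>i\<in>UNIV. partial i (if i = m then monomial \<alpha> else (\<lambda>x. 0)) x) =
      real (\<alpha> m) * monomial (\<alpha>(m := \<alpha> m - 1)) x"
      by (simp add: partial_monomial)
  qed
  have leaddiv: "lead j k (\<lambda>x. real (\<alpha> m) * monomial (\<alpha>(m := \<alpha> m - 1)) x) = (\<lambda>x. 0)" for j
  proof (cases "\<alpha> m = 0")
    case False
    have "(\<alpha>(m := \<alpha> m - 1)) j < k" using False \<alpha>(1)[of j] \<alpha>(2) by auto
    then show ?thesis unfolding lead_cmult by (simp add: lead_monomial_less)
  qed simp
  have top: "lead i (Suc k) (if i = m then monomial \<alpha> else (\<lambda>x. 0)) = (\<lambda>x. 0)" for i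
    using le[of m] by (auto simp: lead_monomial_less)
  show ?thesis
    unfolding enhanced_field_def comp div leaddiv top
    using le by (auto simp: differentiable_monomial slice_poly_0 intro: slice_poly_monomial le_SucI)
qed

text \<open>
  The bubbles are divergence free.  With \<open>m\<close> the index of the field and \<open>\<alpha>\<close> its exponent, only the
  components \<open>i \<noteq> m\<close> reach degree \<open>k + 1\<close> in their own variable, and then with degree \<open>\<alpha> m - 1 < k\<close> in
  variable \<open>m\<close>.  So the mixed top coefficients can be nonzero only for two indices different from \<open>m\<close>,
  where both are the same monomial with coefficient \<open>- \<alpha> m\<close>.
\<close>

lemma enhanced_field_bubble:
  fixes v :: "real^'d::finite \<Rightarrow> real^'d"
  assumes v: "v \<in> bubble_generators k" and k: "k \<ge> 1"
  shows "enhanced_field k v"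
proof -
  obtain m \<alpha> where v: "v = bubble m \<alpha>" and le: "\<And>j. \<alpha> j \<le> k"
    using v unfolding bubble_generators_def by blast
  define c where "c = (\<Sum>l\<in>UNIV - {m}. real (Suc (\<alpha> l)))"
  define \<beta> where "\<beta> i = \<alpha>(m := \<alpha> m - 1, i := Suc (\<alpha> i))" for i
  have comp_m: "(\<lambda>x. v x $ m) = (\<lambda>x. c * monomial \<alpha> x)"
    by (simp add: v bubble_def c_def)
  have comp: "(\<lambda>x. v x $ i) = (\<lambda>x. - real (\<alpha> m) * monomial (\<beta> i) x)" if "i \<noteq> m" for i
    using that by (simp add: v bubble_def \<beta>_def)
  have \<beta>_i: "\<beta> i i = Suc (\<alpha> i)" and \<beta>_m: "i \<noteq> m \<Longrightarrow> \<beta> i m = \<alpha> m - 1"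
    and \<beta>_j: "j \<noteq> i \<Longrightarrow> j \<noteq> m \<Longrightarrow> \<beta> i j = \<alpha> j" for i j
    by (auto simp: \<beta>_def)
  have dm: "\<alpha> m - 1 < k" using le[of m] k by linarith
  have diff: "(\<lambda>x. v x $ i) differentiable at x" for i x
    by (cases "i = m") (simp_all add: comp comp_m differentiable_mult differentiable_monomial)
  have slice_top: "slice_poly i (Suc k) (\<lambda>x. v x $ i)" for i
  proof (cases "i = m")
    case True
    then show ?thesis using le by (auto simp: comp_m le_SucI intro!: slice_poly_cmult slice_poly_monomial)
  next
    case False
    then show ?thesis
      unfolding comp[OF False] using le by (intro slice_poly_cmult slice_poly_monomial) (simp add: \<beta>_i)
  qed
  have slice: "slice_poly j k (\<lambda>x. v x $ i)" if "i \<noteq> j" for i j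
  proof (cases "i = m")
    case False
    have "\<beta> i j \<le> k"
      using that False \<beta>_m[of i] \<beta>_j[of j i] dm le[of j] by (cases "j = m") auto
    then show ?thesis unfolding comp[OF False] by (intro slice_poly_cmult slice_poly_monomial)
  qed (use le in \<open>auto simp: comp_m intro!: slice_poly_cmult slice_poly_monomial\<close>)
  have div: "(\<lambda>x. \<Sum>i\<in>UNIV. partial i (\<lambda>x. v x $ i) x) = (\<lambda>x. 0)"
  proof
    fix x
    define M where "M = real (\<alpha> m) * monomial (\<alpha>(m := \<alpha> m - 1)) x"
    have m: "partial m (\<lambda>x. v x $ m) x = c * M"
      by (simp add: comp_m partial_cmult differentiable_monomial partial_monomial M_def)
    have i: "partial i (\<lambda>x. v x $ i) x = - real (Suc (\<alpha> i)) * M" if "i \<noteq> m" for i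
    proof -
      have "(\<beta> i)(i := \<beta> i i - 1) = \<alpha>(m := \<alpha> m - 1)"
        using that by (auto simp: \<beta>_def fun_eq_iff)
      then show ?thesis
        by (simp only: comp[OF that] partial_cmult[OF differentiable_monomial] partial_monomial \<beta>_i M_def) (simp add: algebra_simps)
    qed
    have "(\<Sum>i\<in>UNIV. partial i (\<lambda>x. v x $ i) x) =
        partial m (\<lambda>x. v x $ m) x + (\<Sum>i\<in>UNIV - {m}. partial i (\<lambda>x. v x $ i) x)"
      by (rule sum.remove) auto
    also have "\<dots> = c * M + (\<Sum>i\<in>UNIV - {m}. - real (Suc (\<alpha> i)) * M)"
      using m i by simp
    also have "\<dots> = 0" unfolding c_def sum_distrib_right by (simp only: minus_mult_left[symmetric] sum_negf add.right_inverse)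
    finally show "(\<Sum>i\<in>UNIV. partial i (\<lambda>x. v x $ i) x) = 0" .
  qed
  have top_m: "lead m (Suc k) (\<lambda>x. v x $ m) = (\<lambda>x. 0)"
    unfolding comp_m lead_cmult using le[of m] by (simp add: lead_monomial_less)
  have top: "lead i (Suc k) (\<lambda>x. v x $ i) =
      (\<lambda>x. (if \<alpha> i = k then - real (\<alpha> m) else 0) * monomial ((\<beta> i)(i := 0)) x)" if "i \<noteq> m" for i
    unfolding comp[OF that] lead_cmult using le[of i]
    by (subst lead_monomial) (auto simp: \<beta>_i fun_eq_iff)
  have top2_m: "lead m k (lead i (Suc k) (\<lambda>x. v x $ i)) = (\<lambda>x. 0)" if "i \<noteq> m" for i
    unfolding top[OF that] lead_cmult using that dm by (simp add: lead_monomial_less \<beta>_m)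
  have top2: "lead j k (lead i (Suc k) (\<lambda>x. v x $ i)) =
      (\<lambda>x. (if \<alpha> i = k \<and> \<alpha> j = k then - real (\<alpha> m) else 0) * monomial (\<alpha>(m := \<alpha> m - 1, i := 0, j := 0)) x)"
    if "i \<noteq> m" "j \<noteq> m" "i \<noteq> j" for i j
  proof -
    have "(\<beta> i)(i := 0, j := 0) = \<alpha>(m := \<alpha> m - 1, i := 0, j := 0)"
      by (auto simp: \<beta>_def fun_eq_iff)
    then show ?thesis
      unfolding top[OF that(1)] lead_cmult using that le[of j] \<beta>_j[of j i]
      by (subst lead_monomial) (simp_all add: fun_eq_iff[of "\<lambda>x. _ x * _ x"])
  qed
  have sym: "lead j k (lead i (Suc k) (\<lambda>x. v x $ i)) = lead i k (lead j (Suc k) (\<lambda>x. v x $ j))"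
    if "i \<noteq> j" for i j
  proof -
    consider "i = m" | "j = m" | "i \<noteq> m" "j \<noteq> m" by blast
    then show ?thesis
    proof cases
      case 1 then show ?thesis using that by (simp add: top_m top2_m)
    next
      case 2 then show ?thesis using that by (simp add: top_m top2_m)
    next
      case 3
      have "\<alpha>(m := \<alpha> m - 1, i := 0, j := 0) = \<alpha>(m := \<alpha> m - 1, j := 0, i := 0)"
        using that by (simp add: fun_upd_twist)
      then show ?thesis using 3 that by (simp add: top2 conj_commute)
    qed
  qed
  have all: "lead j k (lead i k (lead l (Suc k) (\<lambda>x. v x $ l))) = (\<lambda>x. 0)"
    if neq: "i \<noteq> j" "i \<noteq> l" "j \<noteq> l" and "CARD('d) = 3" for i j l
  proof -
    have "{i, j, l} = UNIV" using that by (intro card_subset_eq) auto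
    then consider "m = l" | "m = i" | "m = j" by blast
    then show ?thesis
    proof cases
      case 1 then show ?thesis using top_m by simp
    next
      case 2 then show ?thesis using top2_m[of l] neq by simp
    next
      case 3
      then have "lead i k (lead j k (lead l (Suc k) (\<lambda>x. v x $ l))) = (\<lambda>x. 0)"
        using top2_m[of l] neq by simp
      then show ?thesis using lead_commute[of i j] neq(1) by metis
    qed
  qed
  show ?thesis
    unfolding enhanced_field_def div using diff slice_top slice sym all by simp
qed

lemma V_ref_enhanced_field:
  fixes \<iota> :: "nat \<Rightarrow> 'd::finite"
  assumes dim: "CARD('d) = 2 \<or> CARD('d) = 3" and \<iota>: "bij_betw \<iota> {1..CARD('d)} UNIV" and k: "k \<ge> 1"
    and v: "v \<in> V_ref \<iota> k"
  shows "enhanced_field k v"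
proof -
  have "v \<in> fun_space.span (rt_generators k \<union> bubble_generators k)"
    using V_ref_subset_span[OF dim \<iota> k] v by blast
  then show ?thesis
  proof (induction rule: fun_space.span_induct_alt)
    case base
    show ?case by (rule enhanced_field_0)
  next
    case (step c g y)
    then have "enhanced_field k g" using k enhanced_field_rt enhanced_field_bubble by blast
    then show ?case by (rule enhanced_field_linear) (rule step)
  qed
qed

lemma enhanced_field_determined_on_ref_int:
  fixes v :: "real^'d::finite \<Rightarrow> real^'d"
  assumes v: "enhanced_field k v" and "\<And>x. x \<in> ref_int \<Longrightarrow> v x = 0"
  shows "v x = 0"
proof -
  have "v x $ i = 0" for i
  proof (rule poly_zero_on_grid[of UNIV "Suc k" "\<lambda>x. v x $ i" "\<lambda>_. {- 1<..<1}"])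
    show "slice_poly j (Suc k) (\<lambda>x. v x $ i)" for j
      using v slice_poly_mono[of j k _ "Suc k"] by (cases "i = j") (auto simp: enhanced_field_def)
    show "v y $ i = 0" if "\<forall>j\<in>UNIV. y $ j \<in> {- 1<..<1}" for y
      using assms(2)[of y] that by (simp add: ref_int_def mem_box_cart)
  qed (simp_all add: infinite_Ioo)
  then show ?thesis by (simp add: vec_eq_iff)
qed

text \<open>
  Each component factors as \<open>P (x i) * c i\<close> with \<open>P\<close> the nodal polynomial.  Taking the top coefficient of
  the divergence in \<open>x i\<close> gives
  \<open>(k + 1) * c i + (\<Sum>l \<noteq> i. P' (x l) * lead i k (c l)) = 0\<close>.  Taking the top coefficient in
  another variable \<open>x j\<close> leaves \<open>2 * (k + 1) * lead j k (c i) = 0\<close>: the two mixed coefficients agree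
  and the terms with three different indices are absent.  Hence the sum above is zero, and so is \<open>c i\<close>.
\<close>

theorem enhanced_field_unisolvent:
  fixes v :: "real^'d::finite \<Rightarrow> real^'d"
  assumes dim: "CARD('d) = 2 \<or> CARD('d) = 3" and v: "enhanced_field k v"
    and N: "finite N" "card N = Suc k"
    and zero: "\<And>y. (\<And>j. y $ j \<in> N) \<Longrightarrow> v y = 0"
  shows "v x = 0"
proof -
  define f where "f i x = v x $ i" for i x
  define c where "c i = lead i (Suc k) (f i)" for i
  define P where "P = (\<Prod>t\<in>N. [:- t, 1:])"
  have diff: "f i differentiable at x" and slice_top: "slice_poly i (Suc k) (f i)"
    and slice: "i \<noteq> j \<Longrightarrow> slice_poly j k (f i)"
    and div: "lead j k (\<lambda>x. \<Sum>i\<in>UNIV. partial i (f i) x) = (\<lambda>x. 0)"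
    and sym: "i \<noteq> j \<Longrightarrow> lead j k (c i) = lead i k (c j)"
    and all: "i \<noteq> j \<Longrightarrow> i \<noteq> l \<Longrightarrow> j \<noteq> l \<Longrightarrow> CARD('d) = 3 \<Longrightarrow> lead j k (lead i k (c l)) = (\<lambda>x. 0)"
    for i j l x
    using v by (auto simp: enhanced_field_def f_def[abs_def] c_def)
  have P0: "poly P t = 0" if "t \<in> N" for t
    using that N by (auto simp: P_def poly_prod)
  have degP: "degree P = Suc k"
    unfolding P_def by (subst degree_prod_sum_eq) (use N in auto)
  have leadP: "coeff P (Suc k) = 1"
    using degP lead_coeff_prod[of "\<lambda>t. [:- t, 1:]" N] by (simp add: P_def)
  have on_facet: "f i (to_facet i t x) = 0" if "t \<in> N" for i t x
  proof (rule poly_zero_on_grid[of "UNIV - {i}" k "f i" "\<lambda>_. N"])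
    show "f i y = 0" if "\<forall>j\<in>UNIV - {i}. y $ j \<in> N" "\<forall>j. j \<notin> UNIV - {i} \<longrightarrow> y $ j = to_facet i t x $ j" for y
    proof -
      have "y $ j \<in> N" for j using that \<open>t \<in> N\<close> by (cases "j = i") auto
      then show ?thesis using zero by (simp add: f_def)
    qed
  qed (use slice N in auto)
  \<comment> \<open>On the line through \<open>x\<close> in direction \<open>i\<close>, both sides have degree \<open>k + 1\<close>, the same top coefficient
    and the \<open>k + 1\<close> common zeros \<open>N\<close>.\<close>
  have factor: "f i x = poly P (x $ i) * c i x" for i x
  proof -
    obtain p where p: "degree p \<le> Suc k" "\<And>t. f i (to_facet i t x) = poly p t"
      using slice_polyD[OF slice_top[of i], of x] by blast
    have c: "c i x = coeff p (Suc k)" unfolding c_def by (rule lead_slice) (use p in auto)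
    define q where "q = p - smult (c i x) P"
    have "degree q \<le> Suc k"
      unfolding q_def by (rule degree_diff_le) (use p degP in \<open>auto intro: order_trans[OF degree_smult_le]\<close>)
    moreover have "coeff q (Suc k) = 0" by (simp add: q_def c leadP)
    ultimately have degq: "q = 0 \<or> degree q < Suc k"
      by (metis le_neq_implies_less leading_coeff_0_iff)
    have "N \<subseteq> {t. poly q t = 0}"
      using p(2) on_facet P0 by (auto simp: q_def) metis
    then have "q = 0"
      using degq N card_mono[OF poly_roots_finite, of q N] card_poly_roots_bound[of q]
      by (metis leD le_trans)
    then have "p = smult (c i x) P" by (simp add: q_def)
    then show ?thesis using p(2)[of "x $ i"] by (simp add: mult.commute)
  qed
  have c_indep: "c i (to_facet i t x) = c i x" for i t x by (simp add: c_def)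
  have part: "partial i (f i) x = poly (pderiv P) (x $ i) * c i x" for i x
  proof (rule partial_eqI[OF diff])
    have "((\<lambda>t. poly P t * c i x) has_real_derivative poly (pderiv P) (x $ i) * c i x) (at (x $ i))"
      by (auto intro!: derivative_eq_intros)
    then show "((\<lambda>t. f i (to_facet i t x)) has_real_derivative poly (pderiv P) (x $ i) * c i x) (at (x $ i))"
      by (simp add: factor c_indep)
  qed
  have lead_own: "lead i k (\<lambda>x. poly (pderiv P) (x $ i) * g x) = (\<lambda>x. (real k + 1) * g x)"
    if "\<And>t x. g (to_facet i t x) = g x" for i and g :: "real^'d \<Rightarrow> real"
  proof
    fix x
    have "lead i k (\<lambda>x. poly (pderiv P) (x $ i) * g x) x = coeff (smult (g x) (pderiv P)) k"
      by (rule lead_slice) (auto simp: that degree_pderiv degP intro: order_trans[OF degree_smult_le])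
    then show "lead i k (\<lambda>x. poly (pderiv P) (x $ i) * g x) x = (real k + 1) * g x"
      by (simp add: coeff_pderiv leadP)
  qed
  have lead_other: "lead j k (\<lambda>x. poly (pderiv P) (x $ i) * g x) =
      (\<lambda>x. poly (pderiv P) (x $ i) * lead j k g x)" if "i \<noteq> j" for i j g
    using that by (intro lead_mult_other) simp
  \<comment> \<open>The coefficient of \<open>(x i)^k\<close> in the divergence; only the \<open>i\<close>-th summand is differentiated in \<open>x i\<close>.\<close>
  have first: "(real k + 1) * c i x + (\<Sum>l\<in>UNIV - {i}. poly (pderiv P) (x $ l) * lead i k (c l) x) = 0" for i x
  proof -
    have "(\<lambda>x. \<Sum>l\<in>UNIV. partial l (f l) x) =
        (\<lambda>x. poly (pderiv P) (x $ i) * c i x + (\<Sum>l\<in>UNIV - {i}. poly (pderiv P) (x $ l) * c l x))"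
      by (rule ext) (simp add: part sum.remove[of UNIV i])
    moreover have "lead i k \<dots> = (\<lambda>x. (real k + 1) * c i x +
        (\<Sum>l\<in>UNIV - {i}. poly (pderiv P) (x $ l) * lead i k (c l) x))"
    proof -
      have "lead i k (\<lambda>x. poly (pderiv P) (x $ l) * c l x) x = poly (pderiv P) (x $ l) * lead i k (c l) x"
        if "l \<in> UNIV - {i}" for l x
        using lead_other[of l i "c l"] that by auto
      then show ?thesis unfolding lead_add lead_own[of "c i", OF c_indep] lead_sum by simp
    qed
    ultimately show ?thesis using div[of i] by (metis (no_types, lifting))
  qed
  have mixed: "lead j k (c i) = (\<lambda>x. 0)" if ij: "i \<noteq> j" for i j
  proof
    fix x
    have indep: "lead i k (c j) (to_facet j t x) = lead i k (c j) x" for t x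
      unfolding c_def lead_commute[OF ij] by simp
    have third: "lead j k (lead i k (c l)) x = 0" if "l \<in> UNIV - {i} - {j}" for l x
    proof -
      have "CARD('d) \<ge> card {i, j, l}" by (rule card_mono) auto
      then have "CARD('d) = 3" using that ij dim by auto
      then show ?thesis using all[of i j l] that ij by auto
    qed
    have "(\<lambda>x. 0) = (\<lambda>x. (real k + 1) * c i x + (poly (pderiv P) (x $ j) * lead i k (c j) x +
        (\<Sum>l\<in>UNIV - {i} - {j}. poly (pderiv P) (x $ l) * lead i k (c l) x)))"
      using first[of i] ij by (auto simp: fun_eq_iff sum.remove[of "UNIV - {i}" j])
    then have "lead j k (\<lambda>x. 0) x = lead j k (\<lambda>x. (real k + 1) * c i x + (poly (pderiv P) (x $ j) * lead i k (c j) x +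
        (\<Sum>l\<in>UNIV - {i} - {j}. poly (pderiv P) (x $ l) * lead i k (c l) x))) x"
      by simp
    also have "\<dots> = (real k + 1) * lead j k (c i) x + ((real k + 1) * lead i k (c j) x +
        (\<Sum>l\<in>UNIV - {i} - {j}. poly (pderiv P) (x $ l) * lead j k (lead i k (c l)) x))"
    proof -
      have "lead j k (\<lambda>x. poly (pderiv P) (x $ l) * lead i k (c l) x) x =
          poly (pderiv P) (x $ l) * lead j k (lead i k (c l)) x"
        if "l \<in> UNIV - {i} - {j}" for l x
        using lead_other[of l j "lead i k (c l)"] that by auto
      then show ?thesis
        unfolding lead_add lead_cmult lead_own[of "lead i k (c j)", OF indep] lead_sum by simp
    qed
    also have "\<dots> = 2 * (real k + 1) * lead j k (c i) x"
      using third sym[OF ij] by simp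
    finally show "lead j k (c i) x = 0" by simp
  qed
  have "c i x = 0" for i
  proof -
    have "(\<Sum>l\<in>UNIV - {i}. poly (pderiv P) (x $ l) * lead i k (c l) x) = 0"
      by (rule sum.neutral) (auto simp: mixed)
    then show ?thesis using first[of i x] by simp
  qed
  then show ?thesis using factor by (simp add: vec_eq_iff f_def)
qed

section \<open>Square integrable functions\<close>

lemma square_integrable_mult:
  fixes f g :: "'a \<Rightarrow> real"
  assumes "square_integrable M f" "square_integrable M g"
  shows "integrable M (\<lambda>x. f x * g x)"
proof (rule Bochner_Integration.integrable_bound)
  show "integrable M (\<lambda>x. (norm (f x))\<^sup>2 + (norm (g x))\<^sup>2)"
    using assms by (auto simp: square_integrable_def)
  show "(\<lambda>x. f x * g x) \<in> borel_measurable M"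
    using assms by (auto simp: square_integrable_def)
  show "AE x in M. norm (f x * g x) \<le> norm ((norm (f x))\<^sup>2 + (norm (g x))\<^sup>2)"
  proof (rule AE_I2)
    fix x
    have "2 * (\<bar>f x\<bar> * \<bar>g x\<bar>) \<le> (f x)\<^sup>2 + (g x)\<^sup>2"
      using sum_squares_bound[of "\<bar>f x\<bar>" "\<bar>g x\<bar>"] by (simp add: mult.assoc)
    moreover have "0 \<le> \<bar>f x\<bar> * \<bar>g x\<bar>" by simp
    ultimately have "\<bar>f x\<bar> * \<bar>g x\<bar> \<le> (f x)\<^sup>2 + (g x)\<^sup>2" by linarith
    then show "norm (f x * g x) \<le> norm ((norm (f x))\<^sup>2 + (norm (g x))\<^sup>2)"
      by (simp add: abs_mult)
  qed
qed

lemma square_integrable_imp_integrable: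
  fixes f :: "'a \<Rightarrow> 'b::{banach, second_countable_topology}"
  assumes "finite_measure M" "square_integrable M f"
  shows "integrable M f"
proof (rule Bochner_Integration.integrable_bound)
  show "integrable M (\<lambda>x. 1 + (norm (f x))\<^sup>2)"
    using assms by (auto simp: square_integrable_def finite_measure.integrable_const)
  show "f \<in> borel_measurable M" using assms by (simp add: square_integrable_def)
  show "AE x in M. norm (f x) \<le> norm (1 + (norm (f x))\<^sup>2)"
  proof (rule AE_I2)
    fix x
    have "2 * norm (f x) \<le> 1 + (norm (f x))\<^sup>2"
      using sum_squares_bound[of 1 "norm (f x)"] by simp
    then have "norm (f x) \<le> 1 + (norm (f x))\<^sup>2" using norm_ge_zero[of "f x"] by linarith
    then show "norm (f x) \<le> norm (1 + (norm (f x))\<^sup>2)" by simp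
  qed
qed

lemma square_integrable_scaleR:
  fixes f :: "'a \<Rightarrow> 'b::{real_normed_vector, second_countable_topology}"
  shows "square_integrable M f \<Longrightarrow> square_integrable M (\<lambda>x. c *\<^sub>R f x)"
  by (auto simp: square_integrable_def power_mult_distrib)

lemma square_integrable_add:
  fixes f g :: "'a \<Rightarrow> 'b::{real_normed_vector, second_countable_topology}"
  assumes "square_integrable M f" "square_integrable M g"
  shows "square_integrable M (\<lambda>x. f x + g x)"
proof -
  have meas: "f \<in> borel_measurable M" "g \<in> borel_measurable M"
    using assms by (auto simp: square_integrable_def)
  have "integrable M (\<lambda>x. (norm (f x + g x))\<^sup>2)"
  proof (rule Bochner_Integration.integrable_bound)
    show "integrable M (\<lambda>x. 2 * (norm (f x))\<^sup>2 + 2 * (norm (g x))\<^sup>2)"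
      using assms by (auto simp: square_integrable_def)
    show "(\<lambda>x. (norm (f x + g x))\<^sup>2) \<in> borel_measurable M" using meas by simp
    show "AE x in M. norm ((norm (f x + g x))\<^sup>2) \<le> norm (2 * (norm (f x))\<^sup>2 + 2 * (norm (g x))\<^sup>2)"
    proof (rule AE_I2)
      fix x
      have "(norm (f x + g x))\<^sup>2 \<le> (norm (f x) + norm (g x))\<^sup>2"
        by (intro power_mono norm_triangle_ineq) simp
      also have "\<dots> \<le> 2 * (norm (f x))\<^sup>2 + 2 * (norm (g x))\<^sup>2"
        using sum_squares_bound[of "norm (f x)" "norm (g x)"] by (simp add: power2_sum)
      finally show "norm ((norm (f x + g x))\<^sup>2) \<le> norm (2 * (norm (f x))\<^sup>2 + 2 * (norm (g x))\<^sup>2)"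
        by simp
    qed
  qed
  then show ?thesis using meas by (simp add: square_integrable_def)
qed

lemma square_integrable_sum:
  fixes f :: "'i \<Rightarrow> 'a \<Rightarrow> 'b::{real_normed_vector, second_countable_topology}"
  assumes "\<And>i. i \<in> I \<Longrightarrow> square_integrable M (f i)"
  shows "square_integrable M (\<lambda>x. \<Sum>i\<in>I. f i x)"
  using assms
proof (induction I rule: infinite_finite_induct)
  case (insert i I)
  then show ?case using square_integrable_add[of M "f i" "\<lambda>x. \<Sum>i\<in>I. f i x"] by simp
qed (simp_all add: square_integrable_def)

section \<open>Smooth bump functions\<close>

lemma C_times_Suc_imp: "C_times (Suc n) f \<Longrightarrow> C_times n f"
proof (induction n arbitrary: f)
  case 0
  then show ?case
    by (auto simp: continuous_on_eq_continuous_at intro: differentiable_imp_continuous_within)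
qed auto

lemma C_times_const: "C_times n (\<lambda>x::real^'d::finite. c)"
proof (induction n arbitrary: c)
  case (Suc n)
  have "partial j (\<lambda>x::real^'d. c) = (\<lambda>x. 0)" for j by auto
  then show ?case using Suc by simp
qed auto

lemma C_times_add: "C_times n f \<Longrightarrow> C_times n g \<Longrightarrow> C_times n (\<lambda>x. f x + g x)"
proof (induction n arbitrary: f g)
  case (Suc n)
  have "partial j (\<lambda>x. f x + g x) = (\<lambda>x. partial j f x + partial j g x)" for j
    using Suc.prems by (auto simp: partial_add)
  then show ?case using Suc by simp
qed (auto intro: continuous_intros)

lemma C_times_mult: "C_times n f \<Longrightarrow> C_times n g \<Longrightarrow> C_times n (\<lambda>x. f x * g x)"
proof (induction n arbitrary: f g)
  case (Suc n)
  have part: "partial j (\<lambda>x. f x * g x) = (\<lambda>x. partial j f x * g x + f x * partial j g x)" for j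
    using Suc.prems by (auto simp: partial_mult)
  have "C_times n f" "C_times n g" using Suc.prems by (auto intro: C_times_Suc_imp simp del: C_times.simps)
  then have "C_times n (\<lambda>x. partial j f x * g x + f x * partial j g x)" for j
    using Suc by (intro C_times_add Suc.IH) auto
  then show ?case using Suc.prems part by simp
qed (auto intro: continuous_intros)

lemma C_times_prod: "(\<And>i. i \<in> I \<Longrightarrow> C_times n (f i)) \<Longrightarrow> C_times n (\<lambda>x. \<Prod>i\<in>I. f i x)"
  by (induction I rule: infinite_finite_induct) (auto intro: C_times_mult C_times_const)

text \<open>
  A class of univariate functions closed under differentiation consists of smooth functions, so all
  orders are handled by one induction.
\<close>

lemma C_times_coordinate:
  assumes "\<And>g. g \<in> G \<Longrightarrow> \<exists>g'\<in>G. \<forall>t. (g has_real_derivative g' t) (at t)" "g \<in> G"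
  shows "C_times n (\<lambda>x::real^'d::finite. g (x $ i))"
  using assms(2)
proof (induction n arbitrary: g)
  case 0
  obtain g' where "\<And>t. (g has_real_derivative g' t) (at t)" using assms(1)[OF 0] by blast
  then have "continuous_on UNIV g" by (meson DERIV_isCont continuous_at_imp_continuous_on)
  then show ?case by (auto intro!: continuous_on_compose2[of UNIV g] continuous_intros)
next
  case (Suc n)
  obtain g' where g': "g' \<in> G" "\<And>t. (g has_real_derivative g' t) (at t)" using assms(1)[OF Suc.prems] by blast
  have diff: "(\<lambda>x::real^'d. g (x $ i)) differentiable at x" for x
  proof (rule differentiable_compose[of g])
    show "g differentiable at (x $ i)" using g'(2) real_differentiable_def by blast
  qed (rule differentiable_vec_nth)
  have "partial j (\<lambda>x::real^'d. g (x $ i)) = (if j = i then (\<lambda>x. g' (x $ i)) else (\<lambda>x. 0))" for j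
    by (rule ext, rule partial_eqI[OF diff]) (auto simp: g'(2))
  then show ?case using diff Suc.IH[OF g'(1)] by (simp add: C_times_const)
qed

text \<open>
  The functions \<open>p (1 / t) * exp (- 1 / t)\<close>, extended by zero to \<open>t \<le> 0\<close>, form a class that contains
  \<open>exp (- 1 / t)\<close> and is closed under differentiation.
\<close>

definition flat_exp :: "real poly \<Rightarrow> real \<Rightarrow> real" where
  "flat_exp p t = (if t \<le> 0 then 0 else poly p (1 / t) * exp (- (1 / t)))"

lemma poly_exp_tendsto_0: "((\<lambda>s. poly p s * exp (- s)) \<longlongrightarrow> (0::real)) at_top"
proof -
  have "((\<lambda>s. \<Sum>i\<le>degree p. coeff p i * (s ^ i / exp s)) \<longlongrightarrow> (\<Sum>i\<le>degree p. coeff p i * 0)) at_top"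
    by (intro tendsto_sum tendsto_mult tendsto_const tendsto_power_div_exp_0)
  then show ?thesis
    by (simp add: poly_altdef sum_distrib_right exp_minus divide_inverse mult.assoc)
qed

lemma flat_exp_has_derivative:
  "(flat_exp p has_real_derivative flat_exp ([:0, 0, 1:] * (p - pderiv p)) t) (at t)"
proof -
  consider "t < 0" | "t = 0" | "t > 0" by linarith
  then show ?thesis
  proof cases
    case 1
    have "((\<lambda>t. 0) has_real_derivative 0) (at t)" by simp
    moreover have "eventually (\<lambda>s. s \<in> {..<0}) (nhds t)"
      using 1 by (intro eventually_nhds_in_open) auto
    then have "eventually (\<lambda>s. 0 = flat_exp p s) (nhds t)"
      by eventually_elim (simp add: flat_exp_def)
    ultimately have "(flat_exp p has_real_derivative 0) (at t)"
      using DERIV_cong_ev[of t t "\<lambda>t. 0" "flat_exp p" 0 0] by simp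
    then show ?thesis using 1 by (simp add: flat_exp_def)
  next
    case 3
    have "((\<lambda>t. poly p (1 / t) * exp (- (1 / t))) has_real_derivative
        (poly (pderiv p) (1 / t) * (- (1 / t\<^sup>2))) * exp (- (1 / t)) +
        poly p (1 / t) * (exp (- (1 / t)) * (1 / t\<^sup>2))) (at t)"
      using 3 by (auto intro!: derivative_eq_intros DERIV_chain2[of "poly p"] simp: power2_eq_square)
    moreover have "eventually (\<lambda>s. s \<in> {0<..}) (nhds t)"
      using 3 by (intro eventually_nhds_in_open) auto
    then have "eventually (\<lambda>s. poly p (1 / s) * exp (- (1 / s)) = flat_exp p s) (nhds t)"
      by eventually_elim (simp add: flat_exp_def)
    moreover have "(poly (pderiv p) (1 / t) * (- (1 / t\<^sup>2))) * exp (- (1 / t)) +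
        poly p (1 / t) * (exp (- (1 / t)) * (1 / t\<^sup>2)) = flat_exp ([:0, 0, 1:] * (p - pderiv p)) t"
      using 3 by (simp add: flat_exp_def power2_eq_square algebra_simps)
    ultimately show ?thesis
      using DERIV_cong_ev[of t t "\<lambda>t. poly p (1 / t) * exp (- (1 / t))" "flat_exp p"] by simp
  next
    case 2
    \<comment> \<open>At the origin the right difference quotient is \<open>s * p s * exp (- s)\<close> with \<open>s = 1 / h\<close>.\<close>
    have lim: "((\<lambda>s. poly ([:0, 1:] * p) s * exp (- s)) \<longlongrightarrow> 0) at_top"
      by (rule poly_exp_tendsto_0)
    have "((\<lambda>h. poly ([:0, 1:] * p) (inverse h) * exp (- inverse h)) \<longlongrightarrow> 0) (at_right 0)"
      by (rule filterlim_compose[OF lim filterlim_inverse_at_top_right])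
    moreover have "eventually (\<lambda>h. poly ([:0, 1:] * p) (inverse h) * exp (- inverse h) =
        (flat_exp p (0 + h) - flat_exp p 0) / h) (at_right (0::real))"
      using eventually_at_right_less[of 0]
      by eventually_elim (simp add: flat_exp_def field_simps)
    ultimately have right: "((\<lambda>h. (flat_exp p (0 + h) - flat_exp p 0) / h) \<longlongrightarrow> 0) (at_right 0)"
      by (rule Lim_transform_eventually)
    have left: "((\<lambda>h. (flat_exp p (0 + h) - flat_exp p 0) / h) \<longlongrightarrow> 0) (at_left 0)"
    proof (rule Lim_transform_eventually)
      show "((\<lambda>h. 0) \<longlongrightarrow> (0::real)) (at_left 0)" by simp
      show "eventually (\<lambda>h. 0 = (flat_exp p (0 + h) - flat_exp p 0) / h) (at_left (0::real))"
        by (simp add: eventually_at_filter flat_exp_def)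
    qed
    have "(flat_exp p has_real_derivative 0) (at 0)"
      unfolding DERIV_def filterlim_at_split using left right by simp
    then show ?thesis using 2 by (simp add: flat_exp_def)
  qed
qed

text \<open>
  As \<open>n\<close> grows, these functions tend to the indicator of the box.  The shift by 1 keeps the support
  at distance \<open>1 / n\<close> from the faces of the box.
\<close>

definition box_bump :: "real^'d::finite \<Rightarrow> real^'d \<Rightarrow> nat \<Rightarrow> real^'d \<Rightarrow> real" where
  "box_bump a b n x =
     (\<Prod>i\<in>UNIV. flat_exp 1 (real n * (x $ i - a $ i) - 1) * flat_exp 1 (real n * (b $ i - x $ i) - 1))"

lemma smooth_box_bump: "smooth (box_bump a b n)"
proof -
  have aff: "C_times m (\<lambda>x::real^'d::finite. flat_exp p (c * x $ i + d))" for m p c d i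
  proof (rule C_times_coordinate[of "{\<lambda>t. flat_exp p (c * t + d) | p. True}"])
    fix g assume "g \<in> {\<lambda>t. flat_exp p (c * t + d) | p. True}"
    then obtain p where g: "g = (\<lambda>t. flat_exp p (c * t + d))" by blast
    have "flat_exp (smult c q) s = c * flat_exp q s" for q s by (simp add: flat_exp_def)
    then have "(g has_real_derivative flat_exp (smult c ([:0, 0, 1:] * (p - pderiv p))) (c * t + d)) (at t)" for t
    proof -
      have "((\<lambda>t. c * t + d) has_real_derivative c) (at t)" by (auto intro!: derivative_eq_intros)
      from DERIV_chain2[OF flat_exp_has_derivative this, of p] \<open>\<And>q s. flat_exp (smult c q) s = c * flat_exp q s\<close>
      show ?thesis unfolding g by (simp only: mult.commute)
    qed
    then show "\<exists>g'\<in>{\<lambda>t. flat_exp p (c * t + d) | p. True}. \<forall>t. (g has_real_derivative g' t) (at t)"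
      by (intro bexI[of _ "\<lambda>t. flat_exp (smult c ([:0, 0, 1:] * (p - pderiv p))) (c * t + d)"]) blast+
  qed blast
  have "C_times m (\<lambda>x. flat_exp 1 (real n * (x $ i - a $ i) - 1) * flat_exp 1 (real n * (b $ i - x $ i) - 1))" for m i
    using C_times_mult[OF aff[of m 1 "real n" i "- real n * a $ i - 1"] aff[of m 1 "- real n" i "real n * b $ i - 1"]]
    by (simp add: algebra_simps)
  then show ?thesis
    unfolding smooth_def box_bump_def[abs_def] by (intro allI C_times_prod)
qed

lemma flat_exp_1_bounds: "0 \<le> flat_exp 1 t" "flat_exp 1 t \<le> 1"
  by (auto simp: flat_exp_def)

lemma box_bump_bounds: "0 \<le> box_bump a b n x" "box_bump a b n x \<le> 1"
  unfolding box_bump_def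
  by (auto intro!: prod_nonneg prod_le_1 mult_nonneg_nonneg mult_le_one flat_exp_1_bounds)

lemma box_bump_support:
  "compact (fun_support (box_bump a b n))" "fun_support (box_bump a b n) \<subseteq> box a b"
proof -
  define C where "C = {x. \<forall>i. 1 \<le> real n * (x $ i - a $ i) \<and> 1 \<le> real n * (b $ i - x $ i)}"
  have "closed C"
    unfolding C_def Collect_all_eq
    by (intro closed_INT ballI closed_Collect_conj closed_Collect_le continuous_intros)
  have sub: "C \<subseteq> box a b"
  proof
    fix x assume "x \<in> C"
    have "a $ i < x $ i \<and> x $ i < b $ i" for i
    proof -
      have "0 < real n * (x $ i - a $ i)" "0 < real n * (b $ i - x $ i)"
        using \<open>x \<in> C\<close> unfolding C_def by (auto intro: less_le_trans[of 0 1])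
      then show ?thesis by (simp add: zero_less_mult_iff)
    qed
    then show "x \<in> box a b" by (simp add: mem_box_cart)
  qed
  have "{x. box_bump a b n x \<noteq> 0} \<subseteq> C"
  proof
    fix x assume "x \<in> {x. box_bump a b n x \<noteq> 0}"
    then have "flat_exp 1 (real n * (x $ i - a $ i) - 1) \<noteq> 0 \<and> flat_exp 1 (real n * (b $ i - x $ i) - 1) \<noteq> 0" for i
      by (auto simp: box_bump_def)
    then show "x \<in> C" unfolding C_def flat_exp_def by (auto split: if_splits) (metis diff_gt_0_iff_gt less_eq_real_def linorder_not_le)+
  qed
  then have supp: "fun_support (box_bump a b n) \<subseteq> C"
    unfolding fun_support_def using \<open>closed C\<close> by (rule closure_minimal)
  then show "fun_support (box_bump a b n) \<subseteq> box a b" using sub by blast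
  then show "compact (fun_support (box_bump a b n))"
    unfolding compact_eq_bounded_closed fun_support_def
    by (meson bounded_box bounded_subset closed_closure)
qed

lemma box_bump_tendsto: "(\<lambda>n. box_bump a b n x) \<longlonglongrightarrow> indicat_real (box a b) x"
proof (cases "x \<in> box a b")
  case True
  have one: "(\<lambda>n. flat_exp 1 (real n * c - 1)) \<longlonglongrightarrow> 1" if "c > 0" for c
  proof -
    have lim: "filterlim (\<lambda>n. real n * c - 1) at_top sequentially"
      using that by (intro filterlim_tendsto_add_at_top[of "\<lambda>_. - 1", OF tendsto_const, simplified])
        (auto intro!: filterlim_at_top_mult_tendsto_pos[OF tendsto_const _ filterlim_real_sequentially])
    have "(\<lambda>n. exp (- (1 / (real n * c - 1)))) \<longlonglongrightarrow> exp (- 0)"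
      by (intro tendsto_exp tendsto_minus real_tendsto_divide_at_top[OF tendsto_const lim])
    moreover have "eventually (\<lambda>n. exp (- (1 / (real n * c - 1))) = flat_exp 1 (real n * c - 1)) sequentially"
      using filterlim_at_top_dense[THEN iffD1, OF lim, rule_format, of 0]
      by eventually_elim (simp add: flat_exp_def)
    ultimately show ?thesis using Lim_transform_eventually by fastforce
  qed
  have "(\<lambda>n. box_bump a b n x) \<longlonglongrightarrow> (\<Prod>i\<in>(UNIV :: 'a set). 1 * 1)"
    unfolding box_bump_def
    using True by (intro tendsto_prod tendsto_mult one) (auto simp: mem_box_cart)
  then show ?thesis using True by simp
next
  case False
  have "box_bump a b n x = 0" for n
    using False box_bump_support(2)[of a b n] closure_subset[of "{x. box_bump a b n x \<noteq> 0}"]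
    unfolding fun_support_def by blast
  then show ?thesis using False by simp
qed

section \<open>The fundamental lemma of the calculus of variations\<close>

text \<open>
  Boxes generate the Borel sets and are stable under intersection, so by Dynkin's argument the
  integral vanishes over every Borel set, hence over every Lebesgue measurable one, and in particular
  over the sets where the function is positive or negative.
\<close>

lemma integral_sub_box_zero_AE_zero:
  fixes u :: "real^'d::finite \<Rightarrow> real"
  assumes u: "integrable lebesgue (\<lambda>x. indicator (box c d) x * u x)"
    and zero: "\<And>a b. box a b \<subseteq> box c d \<Longrightarrow> (LINT x|lebesgue. indicator (box a b) x * u x) = 0"
  shows "AE x in lebesgue. indicator (box c d) x * u x = 0"
proof -
  define f where "f x = indicator (box c d) x * u x" for x
  have f: "integrable lebesgue f" using u by (simp add: f_def[abs_def])
  have borel: "(LINT x:A|lebesgue. f x) = 0" if "A \<in> sets borel" for A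
  proof -
    have sig: "A \<in> sigma_sets UNIV (range (\<lambda>(a, b). box a b))"
      using that by (simp add: borel_eq_box)
    have stable: "Int_stable (range (\<lambda>(a, b). box a b :: (real^'d) set))"
    proof (unfold Int_stable_def, safe)
      fix a b c d :: "real^'d"
      show "box a b \<inter> box c d \<in> range (\<lambda>(a, b). box a b)"
        unfolding box_Int_box by (rule range_eqI[of _ _ "(_, _)"]) simp
    qed
    from sig show ?thesis
    proof (induction rule: sigma_sets_induct_disjoint[OF stable, of UNIV, simplified, consumes 1, case_names basic empty compl union])
      case (basic A)
      then obtain a b where A: "A = box a b" by auto
      obtain a' b' where ab: "box a b \<inter> box c d = box a' b'" using box_Int_box by blast
      have "(LINT x:A|lebesgue. f x) = (LINT x|lebesgue. indicator (box a' b') x * u x)"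
        unfolding set_lebesgue_integral_def ab[symmetric] A f_def
        by (intro Bochner_Integration.integral_cong) (auto simp: indicator_def)
      then show ?case using zero[of a' b'] ab by auto
    next
      case empty
      then show ?case by (simp add: set_lebesgue_integral_def)
    next
      case (compl A)
      have "A \<in> sets borel" using compl(1) by (simp add: borel_eq_box)
      then have Al: "A \<in> sets lebesgue" by simp
      have "(LINT x:UNIV - A|lebesgue. f x) = (LINT x|lebesgue. f x - indicator A x *\<^sub>R f x)"
        unfolding set_lebesgue_integral_def
        by (intro Bochner_Integration.integral_cong) (auto simp: indicator_def)
      also have "\<dots> = (LINT x|lebesgue. f x) - (LINT x:A|lebesgue. f x)"
        unfolding set_lebesgue_integral_def
        by (intro Bochner_Integration.integral_diff f integrable_mult_indicator Al)
      also have "\<dots> = 0" using compl(2) zero[of c d] by (simp add: f_def)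
      finally show ?case .
    next
      case (union A)
      have "A i \<in> sets borel" for i using union(2) by (auto simp: borel_eq_box)
      then have Al: "A i \<in> sets lebesgue" for i by simp
      have "(LINT x:(\<Union>i. A i)|lebesgue. f x) = (\<Sum>i. (LINT x:A i|lebesgue. f x))"
      proof (rule lebesgue_integral_countable_add)
        show "A i \<inter> A j = {}" if "i \<noteq> j" for i j using union(1) that by (auto simp: disjoint_family_on_def)
        show "set_integrable lebesgue (\<Union>i. A i) f"
          unfolding set_integrable_def by (intro integrable_mult_indicator f sets.countable_UN) (use Al in auto)
      qed (rule Al)
      then show ?case using union(3) by simp
    qed
  qed
  have set_zero: "(LINT x:A|lebesgue. f x) = 0" if A: "A \<in> sets lebesgue" for A
  proof -
    define B where "B = main_part lborel A"
    have B: "B \<in> sets lborel" "A = B \<union> null_part lborel A"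
      unfolding B_def using main_part_sets[OF A] main_part_null_part_Un[OF A] by auto
    obtain N where N: "N \<in> null_sets lborel" "null_part lborel A \<subseteq> N"
      using null_part[OF A] by blast
    have "AE x in lebesgue. x \<notin> N"
      using N(1) by (intro AE_not_in) (auto intro: null_sets_completionI)
    then have "AE x in lebesgue. indicator A x *\<^sub>R f x = indicator B x *\<^sub>R f x"
      by eventually_elim (use B N in \<open>auto simp: indicator_def\<close>)
    moreover have "(\<lambda>x. indicator A x *\<^sub>R f x) \<in> borel_measurable lebesgue"
      "(\<lambda>x. indicator B x *\<^sub>R f x) \<in> borel_measurable lebesgue"
      using A B(1) sets_completionI_sets[OF B(1)]
      by (intro borel_measurable_scaleR borel_measurable_indicator borel_measurable_integrable[OF f]; simp)+
    ultimately have "(LINT x:A|lebesgue. f x) = (LINT x:B|lebesgue. f x)"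
      unfolding set_lebesgue_integral_def by (intro integral_cong_AE) auto
    then show "(LINT x:A|lebesgue. f x) = 0" using borel[of B] B by simp
  qed
  have sign_zero: "AE x in lebesgue. \<not> s * f x > 0" for s :: real
  proof -
    define A where "A = {x. s * f x > 0}"
    have "A = {x \<in> space lebesgue. s * f x > 0}" by (simp add: A_def)
    also have "\<dots> \<in> sets lebesgue"
      using f by (intro borel_measurable_less) auto
    finally have A: "A \<in> sets lebesgue" .
    have "integrable lebesgue (\<lambda>x. indicator A x *\<^sub>R f x)" by (rule integrable_mult_indicator[OF A f])
    then have int: "integrable lebesgue (\<lambda>x. s * (indicator A x *\<^sub>R f x))" by simp
    have nonneg: "AE x in lebesgue. 0 \<le> s * (indicator A x *\<^sub>R f x)"
      by (rule AE_I2) (auto simp: A_def indicator_def)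
    have "(LINT x|lebesgue. s * (indicator A x *\<^sub>R f x)) = 0"
      using set_zero[OF A] by (simp add: set_lebesgue_integral_def)
    then have "AE x in lebesgue. s * (indicator A x *\<^sub>R f x) = 0"
      using integral_nonneg_eq_0_iff_AE[OF int nonneg] by simp
    then show ?thesis by eventually_elim (auto simp: A_def indicator_def split: if_splits)
  qed
  have "AE x in lebesgue. f x = 0"
    using sign_zero[of 1] sign_zero[of "- 1"] by eventually_elim auto
  then show ?thesis by (simp add: f_def)
qed

text \<open>
  By dominated convergence along the bumps, the integral over every box in \<open>\<Omega>\<close> vanishes, and \<open>\<Omega>\<close> is a
  countable union of boxes.
\<close>

lemma fundamental_lemma:
  fixes u :: "real^'d::finite \<Rightarrow> real"
  assumes \<Omega>: "open \<Omega>" and u: "integrable (lebesgue_on \<Omega>) u"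
    and zero: "\<And>\<phi>. smooth \<phi> \<Longrightarrow> compact (fun_support \<phi>) \<Longrightarrow> fun_support \<phi> \<subseteq> \<Omega> \<Longrightarrow>
      (LINT x|lebesgue_on \<Omega>. u x * \<phi> x) = 0"
  shows "AE x in lebesgue_on \<Omega>. u x = 0"
proof -
  have \<Omega>l: "\<Omega> \<in> sets lebesgue" using \<Omega> by simp
  have box: "(LINT x|lebesgue_on \<Omega>. u x * indicator (box a b) x) = 0" if "box a b \<subseteq> \<Omega>" for a b
  proof -
    have "(\<lambda>n. LINT x|lebesgue_on \<Omega>. u x * box_bump a b n x) \<longlonglongrightarrow>
        (LINT x|lebesgue_on \<Omega>. u x * indicator (box a b) x)"
    proof (rule integral_dominated_convergence)
      show "integrable (lebesgue_on \<Omega>) (\<lambda>x. norm (u x))" using u by simp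
      show "(\<lambda>x. u x * indicator (box a b) x) \<in> borel_measurable (lebesgue_on \<Omega>)"
        using that by (intro borel_measurable_times borel_measurable_integrable[OF u] borel_measurable_indicator)
          (auto simp: sets_restrict_space intro!: image_eqI[of _ _ "box a b"])
      show "(\<lambda>x. u x * box_bump a b n x) \<in> borel_measurable (lebesgue_on \<Omega>)" for n
      proof (intro borel_measurable_times borel_measurable_integrable[OF u])
        have "continuous_on UNIV (box_bump a b n)"
          using smooth_box_bump[of a b n] unfolding smooth_def using C_times.simps(1) by blast
        then show "box_bump a b n \<in> borel_measurable (lebesgue_on \<Omega>)"
          by (intro continuous_imp_measurable_on_sets_lebesgue \<Omega>l) (auto intro: continuous_on_subset)
      qed
      show "AE x in lebesgue_on \<Omega>. (\<lambda>n. u x * box_bump a b n x) \<longlonglongrightarrow> u x * indicator (box a b) x"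
        by (intro AE_I2 tendsto_intros box_bump_tendsto)
      show "AE x in lebesgue_on \<Omega>. norm (u x * box_bump a b n x) \<le> norm (u x)" for n
        by (intro AE_I2) (auto simp: abs_mult box_bump_bounds intro!: mult_left_le)
    qed
    moreover have "(LINT x|lebesgue_on \<Omega>. u x * box_bump a b n x) = 0" for n
      using zero[OF smooth_box_bump box_bump_support(1)] box_bump_support(2)[of a b n] that by blast
    ultimately show ?thesis by (simp add: LIMSEQ_const_iff)
  qed
  have on_box: "AE x in lebesgue. x \<in> box c d \<longrightarrow> u x = 0" if cd: "box c d \<subseteq> \<Omega>" for c d
  proof -
    have restr: "(LINT x|lebesgue_on \<Omega>. u x * indicator (box a b) x) = (LINT x|lebesgue. indicator (box a b) x * u x)"
      if "box a b \<subseteq> \<Omega>" for a b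
      unfolding integral_restrict_space[of \<Omega> lebesgue "\<lambda>x. u x * indicator (box a b) x", simplified, OF \<Omega>l]
      by (intro Bochner_Integration.integral_cong) (use that in \<open>auto simp: indicator_def\<close>)
    have "integrable lebesgue (\<lambda>x. indicator \<Omega> x *\<^sub>R u x)"
      using u \<Omega>l by (subst integrable_restrict_space[symmetric]) simp_all
    then have "integrable lebesgue (\<lambda>x. indicator (box c d) x *\<^sub>R (indicator \<Omega> x *\<^sub>R u x))"
      by (rule integrable_mult_indicator[rotated]) auto
    moreover have "(\<lambda>x. indicator (box c d) x *\<^sub>R (indicator \<Omega> x *\<^sub>R u x)) = (\<lambda>x. indicator (box c d) x * u x)"
      using cd by (auto simp: indicator_def fun_eq_iff)
    ultimately have int: "integrable lebesgue (\<lambda>x. indicator (box c d) x * u x)" by simp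
    have "AE x in lebesgue. indicator (box c d) x * u x = 0"
    proof (rule integral_sub_box_zero_AE_zero[OF int])
      fix a b assume "box a b \<subseteq> box c d"
      then have "box a b \<subseteq> \<Omega>" using cd by blast
      then show "(LINT x|lebesgue. indicator (box a b) x * u x) = 0" using restr box by simp
    qed
    then show ?thesis by eventually_elim (auto simp: indicator_def)
  qed
  obtain \<D> where \<D>: "countable \<D>" "\<D> \<subseteq> Pow \<Omega>" "\<And>X. X \<in> \<D> \<Longrightarrow> \<exists>a b. X = box a b" "\<Union>\<D> = \<Omega>"
    by (rule open_countable_Union_open_box[OF \<Omega>]) (assumption | rule)+
  have "AE x in lebesgue. x \<in> X \<longrightarrow> u x = 0" if "X \<in> \<D>" for X
    using \<D>(2,3) on_box that by blast
  then have "AE x in lebesgue. \<forall>X\<in>\<D>. x \<in> X \<longrightarrow> u x = 0"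
    by (subst AE_ball_countable[OF \<D>(1)]) blast
  then have "AE x in lebesgue. x \<in> \<Omega> \<longrightarrow> u x = 0"
    by eventually_elim (use \<D>(4) in blast)
  then show ?thesis by (simp add: AE_restrict_space_iff \<Omega>l)
qed

section \<open>Weak divergences\<close>

lemma smooth_differentiable: "smooth \<phi> \<Longrightarrow> \<phi> differentiable at x"
  unfolding smooth_def using C_times.simps(2)[of 0 \<phi>] by blast

lemma smooth_continuous: "smooth \<phi> \<Longrightarrow> continuous_on S \<phi>"
  unfolding smooth_def using C_times.simps(1)[of \<phi>] continuous_on_subset by blast

lemma smooth_continuous_partial: "smooth \<phi> \<Longrightarrow> continuous_on S (partial j \<phi>)"
  unfolding smooth_def using C_times.simps(2)[of 0 \<phi>] C_times.simps(1) continuous_on_subset by blast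

lemma smooth_continuous_grad: "smooth \<phi> \<Longrightarrow> continuous_on S (grad \<phi>)"
  unfolding grad_def[abs_def] by (intro continuous_on_vec_lambda smooth_continuous_partial)

text \<open>
  A factor that is continuous on the whole space is bounded on the bounded set \<open>\<Omega>\<close>.  The pairing \<open>h\<close>
  stands for both the product of numbers and the inner product.
\<close>

lemma integrable_bilinear_bounded:
  fixes f :: "real^'d::finite \<Rightarrow> 'a::{banach, second_countable_topology}"
    and g :: "real^'d \<Rightarrow> 'b::{banach, second_countable_topology}"
    and h :: "'a \<Rightarrow> 'b \<Rightarrow> real"
  assumes \<Omega>: "\<Omega> \<in> sets lebesgue" "bounded \<Omega>" and f: "integrable (lebesgue_on \<Omega>) f"
    and g: "continuous_on UNIV g"
    and h: "\<And>x y. norm (h x y) \<le> norm x * norm y" "continuous_on UNIV (\<lambda>(x, y). h x y)"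
  shows "integrable (lebesgue_on \<Omega>) (\<lambda>x. h (f x) (g x))"
proof -
  have "compact (g ` closure \<Omega>)"
    using \<Omega>(2) g by (intro compact_continuous_image) (auto intro: continuous_on_subset)
  then obtain C where C: "\<And>x. x \<in> \<Omega> \<Longrightarrow> norm (g x) \<le> C"
    using closure_subset by (force dest!: compact_imp_bounded simp: bounded_iff)
  have gm: "g \<in> borel_measurable (lebesgue_on \<Omega>)"
    using g \<Omega> by (intro continuous_imp_measurable_on_sets_lebesgue) (auto intro: continuous_on_subset)
  show ?thesis
  proof (rule Bochner_Integration.integrable_bound)
    show "integrable (lebesgue_on \<Omega>) (\<lambda>x. C * norm (f x))" using f by simp
    have "(\<lambda>x. (\<lambda>(x, y). h x y) (f x, g x)) \<in> borel_measurable (lebesgue_on \<Omega>)"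
      using f gm by (intro measurable_compose[OF _ borel_measurable_continuous_onI[OF h(2)]] borel_measurable_Pair) auto
    then show "(\<lambda>x. h (f x) (g x)) \<in> borel_measurable (lebesgue_on \<Omega>)" by simp
    show "AE x in lebesgue_on \<Omega>. norm (h (f x) (g x)) \<le> norm (C * norm (f x))"
    proof (rule AE_I2)
      fix x assume "x \<in> space (lebesgue_on \<Omega>)"
      then have "norm (g x) \<le> C" using C by simp
      then have "norm (f x) * norm (g x) \<le> C * norm (f x)"
        by (metis mult.commute mult_right_mono norm_ge_zero)
      then show "norm (h (f x) (g x)) \<le> norm (C * norm (f x))"
        using h(1)[of "f x" "g x"] by (metis abs_ge_self order_trans real_norm_def)
    qed
  qed
qed

lemma lebesgue_on_finite: "\<Omega> \<in> sets lebesgue \<Longrightarrow> bounded \<Omega> \<Longrightarrow> finite_measure (lebesgue_on (\<Omega> :: (real^'d::finite) set))"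
  by (intro finite_measure_lebesgue_on bounded_set_imp_lmeasurable)

lemma integrable_inner_smooth_grad:
  fixes v :: "real^'d::finite \<Rightarrow> real^'d"
  assumes \<Omega>: "\<Omega> \<in> sets lebesgue" "bounded \<Omega>"
    and v: "square_integrable (lebesgue_on \<Omega>) v" and \<phi>: "smooth \<phi>"
  shows "integrable (lebesgue_on \<Omega>) (\<lambda>x. v x \<bullet> grad \<phi> x)"
proof (rule integrable_bilinear_bounded[OF \<Omega>, where h = "(\<bullet>)"])
  show "integrable (lebesgue_on \<Omega>) v"
    by (rule square_integrable_imp_integrable[OF lebesgue_on_finite[OF \<Omega>] v])
  show "continuous_on UNIV (grad \<phi>)" by (rule smooth_continuous_grad[OF \<phi>])
  show "norm (x \<bullet> y) \<le> norm x * norm y" for x y :: "real^'d"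
    by (simp add: Cauchy_Schwarz_ineq2)
  show "continuous_on UNIV (\<lambda>(x :: real^'d, y). x \<bullet> y)"
    unfolding case_prod_unfold by (intro continuous_intros)
qed

lemma integrable_mult_smooth:
  fixes w :: "real^'d::finite \<Rightarrow> real"
  assumes \<Omega>: "\<Omega> \<in> sets lebesgue" "bounded \<Omega>"
    and w: "square_integrable (lebesgue_on \<Omega>) w" and \<phi>: "smooth \<phi>"
  shows "integrable (lebesgue_on \<Omega>) (\<lambda>x. w x * \<phi> x)"
proof (rule integrable_bilinear_bounded[OF \<Omega>, where h = "(*)"])
  show "integrable (lebesgue_on \<Omega>) w"
    by (rule square_integrable_imp_integrable[OF lebesgue_on_finite[OF \<Omega>] w])
  show "continuous_on UNIV \<phi>" by (rule smooth_continuous[OF \<phi>])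
  show "norm (x * y) \<le> norm x * norm y" for x y :: real by (simp add: abs_mult)
  show "continuous_on UNIV (\<lambda>(x :: real, y). x * y)"
    unfolding case_prod_unfold by (intro continuous_intros)
qed

lemma has_weak_div_square_integrable:
  "has_weak_div \<Omega> v w \<Longrightarrow> square_integrable (lebesgue_on \<Omega>) w"
  unfolding has_weak_div_def by blast

lemma has_weak_divD:
  "has_weak_div \<Omega> v w \<Longrightarrow> smooth \<phi> \<Longrightarrow> compact (fun_support \<phi>) \<Longrightarrow> fun_support \<phi> \<subseteq> \<Omega> \<Longrightarrow>
    (LINT x|lebesgue_on \<Omega>. v x \<bullet> grad \<phi> x) = - (LINT x|lebesgue_on \<Omega>. w x * \<phi> x)"
  unfolding has_weak_div_def by blast

lemma has_weak_div_unique: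
  fixes v :: "real^'d::finite \<Rightarrow> real^'d"
  assumes \<Omega>: "open \<Omega>" "bounded \<Omega>" and w: "has_weak_div \<Omega> v w1" "has_weak_div \<Omega> v w2"
  shows "AE x in lebesgue_on \<Omega>. w1 x = w2 x"
proof -
  have \<Omega>l: "\<Omega> \<in> sets lebesgue" using \<Omega> by simp
  have sq: "square_integrable (lebesgue_on \<Omega>) w1" "square_integrable (lebesgue_on \<Omega>) w2"
    using w has_weak_div_square_integrable by blast+
  have "AE x in lebesgue_on \<Omega>. w1 x - w2 x = 0"
  proof (rule fundamental_lemma[OF \<Omega>(1)])
    show "integrable (lebesgue_on \<Omega>) (\<lambda>x. w1 x - w2 x)"
      using square_integrable_imp_integrable[OF lebesgue_on_finite[OF \<Omega>l \<Omega>(2)]] sq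
      by (intro Bochner_Integration.integrable_diff) blast+
    fix \<phi> :: "real^'d \<Rightarrow> real"
    assume \<phi>: "smooth \<phi>" "compact (fun_support \<phi>)" "fun_support \<phi> \<subseteq> \<Omega>"
    have "(LINT x|lebesgue_on \<Omega>. (w1 x - w2 x) * \<phi> x) = (LINT x|lebesgue_on \<Omega>. w1 x * \<phi> x - w2 x * \<phi> x)"
      by (simp only: left_diff_distrib)
    also have "\<dots> = (LINT x|lebesgue_on \<Omega>. w1 x * \<phi> x) - (LINT x|lebesgue_on \<Omega>. w2 x * \<phi> x)"
      by (rule Bochner_Integration.integral_diff[OF integrable_mult_smooth[OF \<Omega>l \<Omega>(2) sq(1) \<phi>(1)]
            integrable_mult_smooth[OF \<Omega>l \<Omega>(2) sq(2) \<phi>(1)]])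
    also have "\<dots> = 0" 
    proof -
      have "(LINT x|lebesgue_on \<Omega>. v x \<bullet> grad \<phi> x) = - (LINT x|lebesgue_on \<Omega>. w1 x * \<phi> x)"
        by (rule has_weak_divD[OF w(1) \<phi>])
      moreover have "(LINT x|lebesgue_on \<Omega>. v x \<bullet> grad \<phi> x) = - (LINT x|lebesgue_on \<Omega>. w2 x * \<phi> x)"
        by (rule has_weak_divD[OF w(2) \<phi>])
      ultimately show ?thesis by linarith
    qed
    finally show "(LINT x|lebesgue_on \<Omega>. (w1 x - w2 x) * \<phi> x) = 0" .
  qed
  then show ?thesis by eventually_elim simp
qed

lemma weak_div_AE_eq:
  fixes v :: "real^'d::finite \<Rightarrow> real^'d"
  assumes "open \<Omega>" "bounded \<Omega>" "has_weak_div \<Omega> v w"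
  shows "has_weak_div \<Omega> v (weak_div \<Omega> v)" "AE x in lebesgue_on \<Omega>. weak_div \<Omega> v x = w x"
proof -
  show *: "has_weak_div \<Omega> v (weak_div \<Omega> v)" unfolding weak_div_def by (rule someI[where P = "has_weak_div \<Omega> v", OF assms(3)])
  show "AE x in lebesgue_on \<Omega>. weak_div \<Omega> v x = w x" by (rule has_weak_div_unique[OF assms(1,2) * assms(3)])
qed

lemma has_weak_div_sum:
  fixes v :: "'i \<Rightarrow> real^'d::finite \<Rightarrow> real^'d"
  assumes \<Omega>: "open \<Omega>" "bounded \<Omega>" and v: "\<And>i. i \<in> I \<Longrightarrow> square_integrable (lebesgue_on \<Omega>) (v i)"
    and w: "\<And>i. i \<in> I \<Longrightarrow> has_weak_div \<Omega> (v i) (w i)"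
  shows "has_weak_div \<Omega> (\<lambda>x. \<Sum>i\<in>I. c i *\<^sub>R v i x) (\<lambda>x. \<Sum>i\<in>I. c i * w i x)"
  unfolding has_weak_div_def
proof (intro conjI allI impI)
  have \<Omega>l: "\<Omega> \<in> sets lebesgue" using \<Omega> by simp
  have sq: "\<And>i. i \<in> I \<Longrightarrow> square_integrable (lebesgue_on \<Omega>) (w i)" using w has_weak_div_square_integrable by blast
  then show "square_integrable (lebesgue_on \<Omega>) (\<lambda>x. \<Sum>i\<in>I. c i * w i x)"
    using square_integrable_sum[of I "lebesgue_on \<Omega>" "\<lambda>i x. c i *\<^sub>R w i x"] by (simp add: square_integrable_scaleR[of _ "w _", simplified])
  fix \<phi> :: "real^'d \<Rightarrow> real"
  assume \<phi>: "smooth \<phi> \<and> compact (fun_support \<phi>) \<and> fun_support \<phi> \<subseteq> \<Omega>"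
  have "(LINT x|lebesgue_on \<Omega>. (\<Sum>i\<in>I. c i *\<^sub>R v i x) \<bullet> grad \<phi> x) =
      (LINT x|lebesgue_on \<Omega>. (\<Sum>i\<in>I. c i * (v i x \<bullet> grad \<phi> x)))"
    by (simp add: inner_sum_left)
  also have "\<dots> = (\<Sum>i\<in>I. c i * (LINT x|lebesgue_on \<Omega>. v i x \<bullet> grad \<phi> x))"
    using \<phi> by (subst Bochner_Integration.integral_sum)
      (auto intro!: integrable_inner_smooth_grad \<Omega>l \<Omega> v)
  also have "\<dots> = (\<Sum>i\<in>I. c i * - (LINT x|lebesgue_on \<Omega>. w i x * \<phi> x))"
    using has_weak_divD[OF w] \<phi> by (intro sum.cong) auto
  also have "\<dots> = - (LINT x|lebesgue_on \<Omega>. (\<Sum>i\<in>I. c i * (w i x * \<phi> x)))"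
    using \<phi> by (subst Bochner_Integration.integral_sum)
      (auto intro!: integrable_mult_smooth \<Omega>l \<Omega> sq simp: sum_negf)
  also have "\<dots> = - (LINT x|lebesgue_on \<Omega>. (\<Sum>i\<in>I. c i * w i x) * \<phi> x)"
    by (simp add: sum_distrib_right mult.assoc)
  finally show "(LINT x|lebesgue_on \<Omega>. (\<Sum>i\<in>I. c i *\<^sub>R v i x) \<bullet> grad \<phi> x) =
      - (LINT x|lebesgue_on \<Omega>. (\<Sum>i\<in>I. c i * w i x) * \<phi> x)" .
qed

lemma L2_inner_AE_cong:
  assumes "square_integrable (lebesgue_on \<Omega>) f" "square_integrable (lebesgue_on \<Omega>) f'"
    "square_integrable (lebesgue_on \<Omega>) g" "AE x in lebesgue_on \<Omega>. f x = f' x"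
  shows "L2_inner \<Omega> f g = L2_inner \<Omega> f' g"
  unfolding L2_inner_def
proof (rule integral_cong_AE)
  show "AE x in lebesgue_on \<Omega>. f x * g x = f' x * g x" using assms(4) by eventually_elim simp
qed (use assms in \<open>auto simp: square_integrable_def\<close>)

lemma L2_inner_sum_left:
  assumes "\<And>i. i \<in> I \<Longrightarrow> square_integrable (lebesgue_on \<Omega>) (f i)" "square_integrable (lebesgue_on \<Omega>) g"
  shows "L2_inner \<Omega> (\<lambda>x. \<Sum>i\<in>I. c i * f i x) g = (\<Sum>i\<in>I. c i * L2_inner \<Omega> (f i) g)"
proof -
  have "L2_inner \<Omega> (\<lambda>x. \<Sum>i\<in>I. c i * f i x) g = (LINT x|lebesgue_on \<Omega>. (\<Sum>i\<in>I. c i * (f i x * g x)))"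
    by (simp add: L2_inner_def sum_distrib_right mult.assoc)
  also have "\<dots> = (\<Sum>i\<in>I. c i * L2_inner \<Omega> (f i) g)"
    unfolding L2_inner_def
    by (subst Bochner_Integration.integral_sum) (auto intro!: square_integrable_mult assms)
  finally show ?thesis .
qed

lemma L2_inner_commute: "L2_inner \<Omega> f g = L2_inner \<Omega> g f"
  by (simp add: L2_inner_def mult.commute)

text \<open>
  The weak divergence is a choice among functions that agree almost everywhere; only inside an
  integral is it linear.
\<close>

lemma L2_inner_weak_div_sum:
  fixes v :: "'i \<Rightarrow> real^'d::finite \<Rightarrow> real^'d"
  assumes \<Omega>: "open \<Omega>" "bounded \<Omega>" and v: "\<And>i. i \<in> I \<Longrightarrow> v i \<in> H_div \<Omega>"
    and g: "square_integrable (lebesgue_on \<Omega>) g"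
  shows "L2_inner \<Omega> (weak_div \<Omega> (\<lambda>x. \<Sum>i\<in>I. c i *\<^sub>R v i x)) g =
    (\<Sum>i\<in>I. c i * L2_inner \<Omega> (weak_div \<Omega> (v i)) g)"
proof -
  have sq: "square_integrable (lebesgue_on \<Omega>) (v i)" and w: "has_weak_div \<Omega> (v i) (weak_div \<Omega> (v i))"
    if "i \<in> I" for i
    using v[OF that] weak_div_AE_eq(1)[OF \<Omega>] unfolding H_div_def by blast+
  note d = has_weak_div_sum[where c = c and I = I and v = v, OF \<Omega> sq w]
  note e = weak_div_AE_eq[OF \<Omega> d]
  have "L2_inner \<Omega> (weak_div \<Omega> (\<lambda>x. \<Sum>i\<in>I. c i *\<^sub>R v i x)) g =
      L2_inner \<Omega> (\<lambda>x. \<Sum>i\<in>I. c i * weak_div \<Omega> (v i) x) g"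
    by (rule L2_inner_AE_cong[OF has_weak_div_square_integrable[OF e(1)]
          has_weak_div_square_integrable[OF d] g e(2)])
  also have "\<dots> = (\<Sum>i\<in>I. c i * L2_inner \<Omega> (weak_div \<Omega> (v i)) g)"
    by (rule L2_inner_sum_left[OF has_weak_div_square_integrable[OF w] g])
  finally show ?thesis .
qed

section \<open>Integration by parts on the reference element\<close>

lemma prod_Basis_vec: "(\<Prod>b\<in>Basis. (v :: real^'d::finite) \<bullet> b) = (\<Prod>i\<in>UNIV. v $ i)"
proof -
  have B: "(Basis :: (real^'d) set) = (\<lambda>i. axis i 1) ` UNIV" by (auto simp: Basis_vec_def)
  have "inj (\<lambda>i :: 'd. axis i (1::real))" by (auto simp: inj_on_def axis_eq_axis)
  then show ?thesis unfolding B by (subst prod.reindex) (auto simp: inner_axis)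
qed

lemma emeasure_box_cart:
  fixes l u :: "real^'d::finite"
  assumes "\<And>i. l $ i \<le> u $ i"
  shows "emeasure lborel (box l u) = ennreal (\<Prod>i\<in>UNIV. u $ i - l $ i)"
proof -
  have "l \<bullet> b \<le> u \<bullet> b" if "b \<in> Basis" for b
    using that assms by (auto simp: Basis_vec_def inner_axis)
  then show ?thesis
    using prod_Basis_vec[of "u - l"] by (simp add: emeasure_lborel_box)
qed

lemma to_facet_measurable [measurable]:
  "(\<lambda>(t, x). to_facet i t (x :: real^'d::finite)) \<in> borel_measurable (borel \<Otimes>\<^sub>M borel)"
proof -
  have "continuous_on UNIV (\<lambda>(t, x). to_facet i t (x :: real^'d))"
    unfolding to_facet_eq case_prod_unfold by (intro continuous_intros)
  then show ?thesis by (simp add: borel_prod borel_measurable_continuous_onI)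
qed

text \<open>
  Fubini's theorem in one coordinate without decomposing the space into a product: replacing
  coordinate \<open>i\<close> of \<open>x\<close> by an independent variable \<open>t\<close> yields Lebesgue measure if the forgotten coordinate
  ranges over an interval of total mass 1, here \<open>(- 1, 1)\<close> with density \<open>1 / 2\<close>.  This is the
  normalization of the integral over a facet as an integral over the reference element.
\<close>

lemma lborel_eq_slab:
  fixes i :: "'d::finite"
  defines "w \<equiv> \<lambda>(t::real, x::real^'d). ennreal (indicator {x. - 1 < x $ i \<and> x $ i < 1} x / 2)"
  shows "lborel = distr (density (lborel \<Otimes>\<^sub>M lborel) w) borel (\<lambda>(t, x). to_facet i t x)"
proof (rule lborel_eqI)
  have slab: "{x :: real^'d. - 1 < x $ i \<and> x $ i < 1} \<in> sets borel"
    by (intro borel_open open_Collect_conj open_Collect_less continuous_intros)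
  have w[measurable]: "w \<in> borel_measurable (lborel \<Otimes>\<^sub>M lborel)"
    unfolding w_def using slab by measurable
  fix l u :: "real^'d"
  assume lu: "\<And>b. b \<in> Basis \<Longrightarrow> l \<bullet> b \<le> u \<bullet> b"
  have le: "l $ j \<le> u $ j" for j
    using lu[of "axis j 1"] by (simp add: inner_axis)
  define S where "S = box (to_facet i (- 1) l) (to_facet i 1 u)"
  have "emeasure (distr (density (lborel \<Otimes>\<^sub>M lborel) w) borel (\<lambda>(t, x). to_facet i t x)) (box l u) =
      emeasure (density (lborel \<Otimes>\<^sub>M lborel) w) ((\<lambda>(t, x). to_facet i t x) -` box l u)"
    by (subst emeasure_distr) (auto simp: space_pair_measure)
  also have "\<dots> = (\<integral>\<^sup>+ z. w z * indicator ((\<lambda>(t, x). to_facet i t x) -` box l u) z \<partial>(lborel \<Otimes>\<^sub>M lborel))"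
    using measurable_sets[OF to_facet_measurable[of i], of "box l u"]
    by (intro emeasure_density w) (auto simp: space_pair_measure sets_pair_measure_cong[OF sets_lborel sets_lborel])
  also have "\<dots> = (\<integral>\<^sup>+ z. ennreal (1 / 2) * indicator ({l $ i<..<u $ i} \<times> S) z \<partial>(lborel \<Otimes>\<^sub>M lborel))"
  proof (intro nn_integral_cong)
    fix z :: "real \<times> (real^'d)"
    obtain t x where z: "z = (t, x)" by (cases z)
    have "(- 1 < x $ i \<and> x $ i < 1 \<and> to_facet i t x \<in> box l u) \<longleftrightarrow> t \<in> {l $ i<..<u $ i} \<and> x \<in> S"
      unfolding S_def mem_box_cart by (auto split: if_splits) (metis+)?
    then show "w z * indicator ((\<lambda>(t, x). to_facet i t x) -` box l u) z =
        ennreal (1 / 2) * indicator ({l $ i<..<u $ i} \<times> S) z"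
      by (auto simp: w_def z indicator_def)
  qed
  also have "\<dots> = ennreal (1 / 2) * emeasure (lborel \<Otimes>\<^sub>M lborel) ({l $ i<..<u $ i} \<times> S)"
    by (subst nn_integral_cmult_indicator) (auto simp: S_def)
  also have "emeasure (lborel \<Otimes>\<^sub>M lborel) ({l $ i<..<u $ i} \<times> S) =
      emeasure lborel {l $ i<..<u $ i} * emeasure lborel S"
    by (subst lborel.emeasure_pair_measure_Times) (auto simp: S_def)
  also have "emeasure lborel S = ennreal (2 * (\<Prod>j\<in>UNIV - {i}. u $ j - l $ j))"
    unfolding S_def using le
    by (subst emeasure_box_cart) (auto simp: prod.remove[of UNIV i])
  also have "emeasure lborel {l $ i<..<u $ i} = ennreal (u $ i - l $ i)"
    using le by simp
  also have "ennreal (1 / 2) * (ennreal (u $ i - l $ i) * ennreal (2 * (\<Prod>j\<in>UNIV - {i}. u $ j - l $ j))) =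
      ennreal (1 / 2 * ((u $ i - l $ i) * (2 * (\<Prod>j\<in>UNIV - {i}. u $ j - l $ j))))"
  proof -
    have "ennreal (1 / 2) * (ennreal a * ennreal b) = ennreal (1 / 2 * (a * b))" if "0 \<le> a" "0 \<le> b" for a b
      using that ennreal_mult[of a b] ennreal_mult[of "1 / 2" "a * b"] by (metis mult_nonneg_nonneg divide_nonneg_nonneg zero_le_numeral zero_le_one)
    then show ?thesis using le by (simp add: prod_nonneg)
  qed
  also have "\<dots> = (\<Prod>b\<in>Basis. (u - l) \<bullet> b)"
    unfolding prod_Basis_vec by (simp add: prod.remove[of UNIV i])
  finally show "emeasure (distr (density (lborel \<Otimes>\<^sub>M lborel) w) borel (\<lambda>(t, x). to_facet i t x)) (box l u) =
    (\<Prod>b\<in>Basis. (u - l) \<bullet> b)" .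
qed simp

lemma mem_ref_elem: "x \<in> ref_elem \<longleftrightarrow> (\<forall>j. - 1 \<le> x $ j \<and> x $ j \<le> 1)"
  by (simp add: ref_elem_def mem_box_cart)

lemma mem_ref_int: "x \<in> ref_int \<longleftrightarrow> (\<forall>j. - 1 < x $ j \<and> x $ j < 1)"
  by (simp add: ref_int_def mem_box_cart)

lemma ref_int_subset: "ref_int \<subseteq> ref_elem"
  by (auto simp: mem_ref_int mem_ref_elem less_imp_le)

text \<open>
  Passing to the open cube turns all indicator conditions into strict inequalities.
\<close>

lemma ref_boundary_null: "AE x in lborel. x \<in> ref_elem \<longleftrightarrow> x \<in> (ref_int :: (real^'d::finite) set)"
proof -
  have "negligible (ref_elem - ref_int :: (real^'d) set)"
    unfolding ref_elem_def ref_int_def using negligible_frontier_interval .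
  then have "ref_elem - ref_int \<in> null_sets (lebesgue :: (real^'d) measure)"
    by (simp add: negligible_iff_null_sets)
  then have "ref_elem - ref_int \<in> null_sets (lborel :: (real^'d) measure)"
    by (subst (asm) null_sets_completion_iff) (simp_all add: ref_elem_def ref_int_def)
  then have "AE x in lborel. x \<notin> (ref_elem - ref_int :: (real^'d) set)" by (rule AE_not_in)
  then show ?thesis by eventually_elim (use ref_int_subset in auto)
qed

lemma LINT_ref_elem:
  fixes f :: "real^'d::finite \<Rightarrow> real"
  assumes [measurable]: "f \<in> borel_measurable borel"
  shows "(LINT x|lebesgue_on ref_elem. f x) = (LINT x|lborel. indicator ref_int x * f x)"
    "integrable (lebesgue_on ref_elem) f \<longleftrightarrow> integrable lborel (\<lambda>x. indicator ref_int x * f x)"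
proof -
  have meas[measurable]: "ref_elem \<in> sets borel" "(ref_int :: (real^'d) set) \<in> sets borel"
    by (auto simp: ref_elem_def ref_int_def)
  have AE: "AE x in lborel. indicator ref_elem x * f x = indicator ref_int x * f x"
    using ref_boundary_null by eventually_elim (auto simp: indicator_def)
  have "(LINT x|lebesgue_on ref_elem. f x) = (LINT x|lebesgue. indicator ref_elem x * f x)"
    by (subst integral_restrict_space) (auto simp: ref_elem_def)
  also have "\<dots> = (LINT x|lborel. indicator ref_elem x * f x)" by (rule integral_completion) measurable
  also have "\<dots> = (LINT x|lborel. indicator ref_int x * f x)"
    by (rule integral_cong_AE) (use AE in \<open>auto intro: borel_measurable_times\<close>)
  finally show "(LINT x|lebesgue_on ref_elem. f x) = (LINT x|lborel. indicator ref_int x * f x)" .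
  have "integrable (lebesgue_on ref_elem) f \<longleftrightarrow> integrable lebesgue (\<lambda>x. indicator ref_elem x * f x)"
    by (subst integrable_restrict_space) (auto simp: ref_elem_def)
  also have "\<dots> \<longleftrightarrow> integrable lborel (\<lambda>x. indicator ref_elem x * f x)" by (rule integrable_completion) measurable
  also have "\<dots> \<longleftrightarrow> integrable lborel (\<lambda>x. indicator ref_int x * f x)"
    by (rule integrable_cong_AE) (use AE in \<open>auto intro: borel_measurable_times\<close>)
  finally show "integrable (lebesgue_on ref_elem) f \<longleftrightarrow> integrable lborel (\<lambda>x. indicator ref_int x * f x)" .
qed

lemma integrable_ref_continuous:
  fixes g :: "real^'d::finite \<Rightarrow> real"
  assumes "continuous_on UNIV g"
  shows "integrable (lebesgue_on ref_elem) g"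
  unfolding ref_elem_def
  by (intro continuous_imp_integrable continuous_on_subset[OF assms]) auto

lemma ref_elem_fubini:
  fixes g :: "real^'d::finite \<Rightarrow> real"
  assumes g: "continuous_on UNIV g"
  shows "(LINT x|lebesgue_on ref_elem. g x) =
    (LINT x|lebesgue_on ref_elem. integral {- 1..1} (\<lambda>t. g (to_facet i t x))) / 2"
proof -
  define slab where "slab = {x :: real^'d. - 1 < x $ i \<and> x $ i < 1}"
  define h where "h x = indicator ref_int x * g x" for x
  have gm[measurable]: "g \<in> borel_measurable borel" using g by (rule borel_measurable_continuous_onI)
  have slab[measurable]: "slab \<in> sets borel" unfolding slab_def
    by (intro borel_open open_Collect_conj open_Collect_less continuous_intros)
  have ri[measurable]: "(ref_int :: (real^'d) set) \<in> sets borel" by (simp add: ref_int_def)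
  have hm[measurable]: "h \<in> borel_measurable borel" unfolding h_def by measurable
  have h: "integrable lborel h"
    using integrable_ref_continuous[OF g] LINT_ref_elem(2)[OF gm] by (simp add: h_def[abs_def])
  define w :: "real \<times> (real^'d) \<Rightarrow> real" where "w = (\<lambda>(t, x). indicator slab x / 2)"
  have wm[measurable]: "w \<in> borel_measurable (lborel \<Otimes>\<^sub>M lborel)" unfolding w_def by measurable
  have w0: "AE z in lborel \<Otimes>\<^sub>M lborel. 0 \<le> w z" by (rule AE_I2) (auto simp: w_def)
  have lb: "lborel = distr (density (lborel \<Otimes>\<^sub>M lborel) w) borel (\<lambda>(t, x). to_facet i t x)"
    using lborel_eq_slab[of i] unfolding w_def slab_def by (simp add: case_prod_unfold)
  have Tm[measurable]: "(\<lambda>(t, x). to_facet i t x) \<in> measurable (lborel \<Otimes>\<^sub>M lborel) (borel :: (real^'d) measure)"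
    using to_facet_measurable[of i] by (simp cong: measurable_cong_sets sets_pair_measure_cong)
  have Tm': "(\<lambda>(t, x). to_facet i t x) \<in> measurable (density (lborel \<Otimes>\<^sub>M lborel) w) (borel :: (real^'d) measure)"
    using Tm by simp
  define k where "k z = w z * h (case z of (t, x) \<Rightarrow> to_facet i t x)" for z
  have hT[measurable]: "(\<lambda>z. h (case z of (t, x) \<Rightarrow> to_facet i t x)) \<in> borel_measurable (lborel \<Otimes>\<^sub>M lborel)"
    by (rule measurable_compose[OF Tm hm])
  have "integrable (distr (density (lborel \<Otimes>\<^sub>M lborel) w) borel (\<lambda>(t, x). to_facet i t x)) h"
    using h lb by simp
  then have "integrable (density (lborel \<Otimes>\<^sub>M lborel) w) (\<lambda>z. h (case z of (t, x) \<Rightarrow> to_facet i t x))"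
    by (subst (asm) integrable_distr_eq[OF Tm' hm]) 
  then have k: "integrable (lborel \<Otimes>\<^sub>M lborel) k"
    unfolding k_def by (subst (asm) integrable_density[OF hT wm w0]) simp
  have "(LINT x|lborel. h x) = (LINT x|(distr (density (lborel \<Otimes>\<^sub>M lborel) w) borel (\<lambda>(t, x). to_facet i t x)). h x)"
    using lb by simp
  also have "\<dots> = (LINT z|(density (lborel \<Otimes>\<^sub>M lborel) w). h (case z of (t, x) \<Rightarrow> to_facet i t x))"
    by (rule integral_distr[OF Tm' hm])
  also have "\<dots> = (LINT z|(lborel \<Otimes>\<^sub>M lborel). k z)"
    unfolding k_def by (subst integral_density[OF hT wm w0]) simp
  also have "\<dots> = (LINT x|lborel. (LINT t|lborel. k (t, x)))"
    using lborel_pair.integral_snd[of "\<lambda>t x. k (t, x)"] k by simp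
  also have "\<dots> = (LINT x|lborel. indicator ref_int x * (integral {- 1..1} (\<lambda>t. g (to_facet i t x)) / 2))"
  proof (rule Bochner_Integration.integral_cong[OF refl])
    fix x :: "real^'d"
    have kx: "k (t, x) = indicator ref_int x / 2 * (indicator {- 1<..<1} t *\<^sub>R g (to_facet i t x))" for t
    proof -
      have "(x \<in> slab \<and> to_facet i t x \<in> ref_int) \<longleftrightarrow> (x \<in> ref_int \<and> t \<in> {- 1<..<1})"
        unfolding slab_def mem_ref_int by auto (metis+)?
      then show ?thesis by (auto simp: k_def w_def h_def indicator_def)
    qed
    have cont: "continuous_on UNIV (\<lambda>t. g (to_facet i t x))"
      unfolding to_facet_eq by (intro continuous_on_compose2[OF g] continuous_intros) auto
    have int: "set_integrable lborel {- 1..1} (\<lambda>t. g (to_facet i t x))"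
      by (rule borel_integrable_atLeastAtMost') (rule continuous_on_subset[OF cont], simp)
    have "(LINT t|lborel. k (t, x)) = indicator ref_int x / 2 * (LINT t:{- 1<..<1}|lborel. g (to_facet i t x))"
      unfolding kx set_lebesgue_integral_def by simp
    also have "(LINT t:{- 1<..<1}|lborel. g (to_facet i t x)) = (LINT t:{- 1..1}|lborel. g (to_facet i t x))"
      unfolding set_lebesgue_integral_def
    proof (rule integral_cong_AE)
      have "AE t in lborel. t \<notin> {- 1, 1 :: real}"
        by (intro AE_not_in finite_imp_null_set_lborel) simp
      then show "AE t in lborel. indicat_real {- 1<..<1} t *\<^sub>R g (to_facet i t x) =
          indicat_real {- 1..1} t *\<^sub>R g (to_facet i t x)"
        by eventually_elim (auto simp: indicator_def)
    qed (use borel_measurable_continuous_onI[OF cont] in measurable)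
    also have "\<dots> = integral {- 1..1} (\<lambda>t. g (to_facet i t x))"
      by (rule set_borel_integral_eq_integral(2)[OF int])
    finally show "(LINT t|lborel. k (t, x)) = indicator ref_int x * (integral {- 1..1} (\<lambda>t. g (to_facet i t x)) / 2)"
      by simp
  qed
  also have "\<dots> = (LINT x|lborel. indicator ref_int x * integral {- 1..1} (\<lambda>t. g (to_facet i t x))) / 2"
    by simp
  also have "\<dots> = (LINT x|lebesgue_on ref_elem. integral {- 1..1} (\<lambda>t. g (to_facet i t x))) / 2"
  proof (subst LINT_ref_elem)
    have eq: "integral {- 1..1} (\<lambda>t. g (to_facet i t x)) =
        (LINT t|lborel. indicator {- 1..1} t *\<^sub>R g (to_facet i t x))" for x
    proof -
      have "continuous_on UNIV (\<lambda>t. g (to_facet i t x))"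
        unfolding to_facet_eq by (intro continuous_on_compose2[OF g] continuous_intros) auto
      then show ?thesis
        by (subst set_borel_integral_eq_integral(2)[symmetric, unfolded set_lebesgue_integral_def])
          (auto intro!: borel_integrable_atLeastAtMost' intro: continuous_on_subset)
    qed
    have "(\<lambda>z. g (case z of (t, x) \<Rightarrow> to_facet i t x)) \<in> borel_measurable (lborel \<Otimes>\<^sub>M lborel)"
      by (rule measurable_compose[OF Tm gm])
    then have "(\<lambda>z. g (to_facet i (snd z) (fst z))) \<in> borel_measurable (borel \<Otimes>\<^sub>M lborel)"
      using measurable_compose[OF measurable_pair_swap', of _ borel lborel borel] 
      by (auto simp: case_prod_unfold cong: measurable_cong_sets sets_pair_measure_cong)
    then have [measurable]: "(\<lambda>(x, t). g (to_facet i t x)) \<in> borel_measurable (borel \<Otimes>\<^sub>M lborel)"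
      by (simp add: case_prod_unfold)
    show "(\<lambda>x. integral {- 1..1} (\<lambda>t. g (to_facet i t x))) \<in> borel_measurable borel"
      unfolding eq by measurable
  qed simp
  finally show ?thesis
    using LINT_ref_elem(1)[OF gm] by (simp add: h_def)
qed

text \<open>
  Fubini in coordinate \<open>i\<close> and the fundamental theorem of calculus on each coordinate line.
\<close>

lemma ref_elem_partial_integral:
  fixes u :: "real^'d::finite \<Rightarrow> real"
  assumes u: "\<And>x. u differentiable at x" and cont: "continuous_on UNIV (partial i u)"
  shows "(LINT x|lebesgue_on ref_elem. partial i u x) = facet_integral i 1 u - facet_integral i (- 1) u"
proof -
  have ftc: "integral {- 1..1} (\<lambda>t. partial i u (to_facet i t x)) = u (to_facet i 1 x) - u (to_facet i (- 1) x)" for x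
  proof (rule integral_unique, rule fundamental_theorem_of_calculus)
    fix t :: real
    have "((\<lambda>t. u (to_facet i t (to_facet i t x))) has_real_derivative partial i u (to_facet i t x)) (at t)"
      using partial_slice[OF u[of "to_facet i t x"], of i] by simp
    then show "((\<lambda>t. u (to_facet i t x)) has_vector_derivative partial i u (to_facet i t x)) (at t within {- 1..1})"
      by (simp add: has_real_derivative_iff_has_vector_derivative has_vector_derivative_at_within)
  qed simp
  have uc: "continuous_on UNIV u"
    using u by (simp add: continuous_on_eq_continuous_at differentiable_imp_continuous_within)
  have int: "integrable (lebesgue_on ref_elem) (\<lambda>x. u (to_facet i s x))" for s
    unfolding to_facet_eq
    by (intro integrable_ref_continuous continuous_on_compose2[OF uc] continuous_intros) auto
  show ?thesis
    unfolding ref_elem_fubini[OF cont, of i] ftc facet_integral_def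
    by (simp add: Bochner_Integration.integral_diff[OF int int] diff_divide_distrib)
qed

section \<open>Change of variables\<close>

text \<open>
  Conjugation by a bijection between index types maps transpositions to transpositions.
\<close>

lemma sign_conjugate:
  fixes p :: "'m::finite \<Rightarrow> 'd::finite"
  assumes p: "bij p" and \<pi>: "\<pi> permutes UNIV"
  shows "sign (p \<circ> \<pi> \<circ> inv p) = sign \<pi>"
proof -
  have inv: "p (inv p y) = y" "inv p (p x) = x" for x y
    using p by (auto simp: bij_is_surj surj_f_inv_f bij_is_inj inv_f_f)
  from \<pi> finite[of "UNIV :: 'm set"] show ?thesis
  proof (induction rule: permutes_induct)
    case id
    have "p \<circ> id \<circ> inv p = id" by (auto simp: fun_eq_iff inv)
    then show ?case by (simp only: sign_id)
  next
    case (swap a b \<pi>)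
    have perm: "permutation \<pi>" "permutation (p \<circ> \<pi> \<circ> inv p)"
    proof -
      show "permutation \<pi>" unfolding permutation_permutes using swap.hyps finite by blast
      have "bij (p \<circ> \<pi> \<circ> inv p)"
        using p permutes_bij[OF \<open>\<pi> permutes UNIV\<close>] by (intro bij_comp bij_imp_bij_inv)
      then have "p \<circ> \<pi> \<circ> inv p permutes UNIV" by (intro bij_imp_permutes) auto
      then show "permutation (p \<circ> \<pi> \<circ> inv p)" unfolding permutation_permutes using finite by blast
    qed
    have "p a \<noteq> p b" using swap.hyps p by (auto dest: bij_is_inj injD)
    moreover have "p \<circ> (Transposition.transpose a b \<circ> \<pi>) \<circ> inv p =
        Transposition.transpose (p a) (p b) \<circ> (p \<circ> \<pi> \<circ> inv p)"
      using bij_is_inj[OF p] by (auto simp: fun_eq_iff inv Transposition.transpose_def inj_eq)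
    ultimately show ?case
      using swap by (simp only: sign_compose permutation_swap_id perm sign_swap_id if_False)
  qed
qed

lemma det_reindex:
  fixes p :: "'m::finite \<Rightarrow> 'd::finite" and M :: "real^'d^'d"
  assumes p: "bij p"
  shows "det (\<chi> a b. M $ p a $ p b :: real^'m^'m) = det M"
proof -
  have inv: "p (inv p y) = y" "inv p (p x) = x" for x y
    using p by (auto simp: bij_is_surj surj_f_inv_f bij_is_inj inv_f_f)
  have conj: "p \<circ> \<pi> \<circ> inv p permutes UNIV" if "\<pi> permutes UNIV" for \<pi>
    using that p by (auto intro!: bij_imp_permutes bij_comp bij_imp_bij_inv permutes_bij)
  have conj': "inv p \<circ> \<pi> \<circ> p permutes UNIV" if "\<pi> permutes UNIV" for \<pi>
    using that p by (auto intro!: bij_imp_permutes bij_comp bij_imp_bij_inv permutes_bij)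
  show ?thesis
    unfolding det_def
  proof (rule sum.reindex_bij_witness[where i = "\<lambda>\<pi>. inv p \<circ> \<pi> \<circ> p" and j = "\<lambda>\<pi>. p \<circ> \<pi> \<circ> inv p"])
    fix \<pi> :: "'m \<Rightarrow> 'm" assume \<pi>: "\<pi> \<in> {\<pi>. \<pi> permutes UNIV}"
    have "(\<Prod>i\<in>UNIV. M $ i $ (p \<circ> \<pi> \<circ> inv p) i) = (\<Prod>a\<in>UNIV. M $ p a $ p (\<pi> a))"
      by (subst prod.reindex_bij_betw[OF p, symmetric]) (simp add: inv)
    then show "of_int (sign (p \<circ> \<pi> \<circ> inv p)) * (\<Prod>i\<in>UNIV. M $ i $ (p \<circ> \<pi> \<circ> inv p) i) =
        of_int (sign \<pi>) * (\<Prod>i\<in>UNIV. (\<chi> a b. M $ p a $ p b) $ i $ \<pi> i)"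
      using \<pi> by (simp add: sign_conjugate[OF p])
  qed (auto simp: conj conj' fun_eq_iff inv)
qed

text \<open>
  The functions \<open>f\<close> and \<open>D\<close> need to be related only on \<open>S\<close>.  Stating the pulled back integrand as a
  separate function \<open>D\<close> allows it to be continuous up to the boundary of the reference element later.
\<close>

lemma change_of_variables_wellorder:
  fixes g :: "real^'m::{finite,wellorder} \<Rightarrow> real^'m::_" and f D :: "real^'m::_ \<Rightarrow> real"
  assumes S[measurable]: "S \<in> sets borel" and gS[measurable]: "g ` S \<in> sets borel"
    and der: "\<And>x. x \<in> S \<Longrightarrow> (g has_derivative g' x) (at x)" and inj: "inj_on g S"
    and f[measurable]: "f \<in> borel_measurable borel" and Dm[measurable]: "D \<in> borel_measurable borel"
    and D: "\<And>x. x \<in> S \<Longrightarrow> D x = \<bar>det (matrix (g' x))\<bar> * f (g x)"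
  shows "integrable lborel (\<lambda>x. indicator S x * D x) \<longleftrightarrow> integrable lborel (\<lambda>y. indicator (g ` S) y * f y)"
    and "(LINT x|lborel. indicator S x * D x) = (LINT y|lborel. indicator (g ` S) y * f y)"
proof -
  have Sl: "S \<in> sets lebesgue" using S by simp
  have der': "(g has_derivative g' x) (at x within S)" if "x \<in> S" for x
    using der[OF that] by (rule has_derivative_at_withinI)
  define F :: "real^'m::_ \<Rightarrow> real^1" where "F y = vec (f y)" for y
  have cong: "integral S (\<lambda>x. \<bar>det (matrix (g' x))\<bar> * f (g x)) = integral S D"
    "(\<lambda>x. \<bar>det (matrix (g' x))\<bar> * f (g x)) absolutely_integrable_on S \<longleftrightarrow> D absolutely_integrable_on S"
     apply (rule Henstock_Kurzweil_Integration.integral_cong, simp add: D)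
    apply (rule set_integrable_cong; simp add: D)
    done
  have abs: "D absolutely_integrable_on S \<longleftrightarrow> f absolutely_integrable_on g ` S"
    using absolutely_integrable_change_of_variables[OF Sl der' inj, of F] cong(2)
    unfolding absolutely_integrable_on_1_iff F_def by simp
  have int: "integral S D = integral (g ` S) f" if "D absolutely_integrable_on S"
  proof -
    have "f absolutely_integrable_on g ` S" using abs that by simp
    then have "F absolutely_integrable_on g ` S"
      unfolding absolutely_integrable_on_1_iff F_def by simp
    then have "integral (g ` S) F = integral S (\<lambda>x. \<bar>det (matrix (g' x))\<bar> *\<^sub>R F (g x))"
      using integral_change_of_variables[OF Sl der' inj, of F] by blast
    then show ?thesis using cong(1) unfolding integral_on_1_eq F_def by simp
  qed
  have D_iff: "D absolutely_integrable_on S \<longleftrightarrow> integrable lborel (\<lambda>x. indicator S x * D x)"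
    unfolding set_integrable_def real_scaleR_def by (rule integrable_completion) measurable
  have f_iff: "f absolutely_integrable_on g ` S \<longleftrightarrow> integrable lborel (\<lambda>y. indicator (g ` S) y * f y)"
    unfolding set_integrable_def real_scaleR_def by (rule integrable_completion) measurable
  show iff: "integrable lborel (\<lambda>x. indicator S x * D x) \<longleftrightarrow> integrable lborel (\<lambda>y. indicator (g ` S) y * f y)"
    using abs D_iff f_iff by simp
  show "(LINT x|lborel. indicator S x * D x) = (LINT y|lborel. indicator (g ` S) y * f y)"
  proof (cases "D absolutely_integrable_on S")
    case True
    then have "f absolutely_integrable_on g ` S" using abs by simp
    have "(LINT x|lborel. indicator S x * D x) = (LINT x:S|lebesgue. D x)"
      unfolding set_lebesgue_integral_def real_scaleR_def by (rule integral_completion[symmetric]) measurable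
    also have "\<dots> = (LINT y:g ` S|lebesgue. f y)"
      using set_lebesgue_integral_eq_integral(2)[OF True]
        set_lebesgue_integral_eq_integral(2)[OF \<open>f absolutely_integrable_on g ` S\<close>] int[OF True] by simp
    also have "\<dots> = (LINT y|lborel. indicator (g ` S) y * f y)"
      unfolding set_lebesgue_integral_def real_scaleR_def by (rule integral_completion) measurable
    finally show ?thesis .
  next
    case False
    then show ?thesis using D_iff iff by (simp add: not_integrable_integral_eq)
  qed
qed

definition permute_coords :: "('d \<Rightarrow> 'm) \<Rightarrow> real^'m \<Rightarrow> real^'d" where
  "permute_coords q x = (\<chi> i. x $ q i)"

lemma lborel_permute_coords:
  fixes q :: "'d::finite \<Rightarrow> 'm::finite"
  assumes q: "bij q"
  shows "lborel = distr lborel borel (permute_coords q)"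
proof (rule lborel_eqI)
  have "continuous_on UNIV (permute_coords q)"
    unfolding permute_coords_def by (intro continuous_intros)
  then have [measurable]: "permute_coords q \<in> borel_measurable borel" by (rule borel_measurable_continuous_onI)
  fix l u :: "real^'d" assume lu: "\<And>b. b \<in> Basis \<Longrightarrow> l \<bullet> b \<le> u \<bullet> b"
  have le: "l $ j \<le> u $ j" for j using lu[of "axis j 1"] by (simp add: inner_axis)
  define l' u' where "l' = permute_coords (inv q) l" and "u' = permute_coords (inv q) u"
  have inv: "q (inv q y) = y" "inv q (q x) = x" for x y
    using q by (auto simp: bij_is_surj surj_f_inv_f bij_is_inj inv_f_f)
  have "permute_coords q -` box l u = box l' u'"
  proof safe
    fix x assume "permute_coords q x \<in> box l u"
    then have "l $ inv q j < x $ q (inv q j) \<and> x $ q (inv q j) < u $ inv q j" for j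
      by (simp add: permute_coords_def mem_box_cart)
    then show "x \<in> box l' u'" by (simp add: inv l'_def u'_def permute_coords_def mem_box_cart)
  next
    fix x assume "x \<in> box l' u'"
    then have "l $ inv q (q i) < x $ q i \<and> x $ q i < u $ inv q (q i)" for i
      by (simp add: l'_def u'_def permute_coords_def mem_box_cart)
    then show "x \<in> permute_coords q -` box l u" by (simp add: inv permute_coords_def mem_box_cart)
  qed
  then have "emeasure (distr lborel borel (permute_coords q)) (box l u) = emeasure lborel (box l' u')"
    by (simp add: emeasure_distr)
  also have "\<dots> = ennreal (\<Prod>j\<in>UNIV. u' $ j - l' $ j)"
    by (rule emeasure_box_cart) (simp add: l'_def u'_def permute_coords_def le)
  also have "(\<Prod>j\<in>UNIV. u' $ j - l' $ j) = (\<Prod>i\<in>UNIV. u $ i - l $ i)"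
    by (subst prod.reindex_bij_betw[OF q, symmetric]) (simp add: l'_def u'_def permute_coords_def inv)
  finally show "emeasure (distr lborel borel (permute_coords q)) (box l u) = (\<Prod>b\<in>Basis. (u - l) \<bullet> b)"
    by (simp add: prod_Basis_vec)
qed simp

text \<open>
  Renaming coordinates preserves Lebesgue measure and determinants, which carries the change of
  variables from a well-ordered index type to any index type of the same size.
\<close>

lemma change_of_variables_reindex:
  fixes g :: "real^'d::finite \<Rightarrow> real^'d" and f D :: "real^'d \<Rightarrow> real"
    and p :: "'m::{finite,wellorder} \<Rightarrow> 'd"
  assumes p: "bij p"
    and S[measurable]: "S \<in> sets borel" and gS[measurable]: "g ` S \<in> sets borel"
    and der: "\<And>x. x \<in> S \<Longrightarrow> (g has_derivative g' x) (at x)" and inj: "inj_on g S"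
    and f[measurable]: "f \<in> borel_measurable borel" and Dm[measurable]: "D \<in> borel_measurable borel"
    and D: "\<And>x. x \<in> S \<Longrightarrow> D x = \<bar>det (matrix (g' x))\<bar> * f (g x)"
  shows "integrable lborel (\<lambda>x. indicator S x * D x) \<longleftrightarrow> integrable lborel (\<lambda>y. indicator (g ` S) y * f y)"
    and "(LINT x|lborel. indicator S x * D x) = (LINT y|lborel. indicator (g ` S) y * f y)"
proof -
  have inv: "p (inv p y) = y" "inv p (p x) = x" for x y
    using p by (auto simp: bij_is_surj surj_f_inv_f bij_is_inj inv_f_f)
  define r :: "real^'m::_ \<Rightarrow> real^'d" where "r = permute_coords (inv p)"
  define r' :: "real^'d \<Rightarrow> real^'m::_" where "r' = permute_coords p"
  have rr: "r (r' x) = x" "r' (r y) = y" for x y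
    by (simp_all add: r_def r'_def permute_coords_def inv)
  have lin: "bounded_linear r" "bounded_linear r'"
    by (auto simp: linear_conv_bounded_linear[symmetric] r_def r'_def permute_coords_def vec_eq_iff intro!: linearI)
  have cont: "continuous_on UNIV r" "continuous_on UNIV r'"
    using lin by (auto intro: linear_continuous_on)
  have rm[measurable]: "r \<in> borel_measurable borel" "r' \<in> borel_measurable borel"
    using cont by (auto intro: borel_measurable_continuous_onI)
  have lb: "lborel = distr lborel borel r"
    unfolding r_def using lborel_permute_coords[OF bij_imp_bij_inv[OF p]] .
  define S' where "S' = r -` S"
  define G where "G = r' \<circ> g \<circ> r"
  define G' where "G' y = r' \<circ> g' (r y) \<circ> r" for y
  have GS: "G ` S' = r -` (g ` S)"
  proof safe
    fix y assume "y \<in> S'" then show "G y \<in> r -` (g ` S)" by (auto simp: G_def S'_def rr)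
  next
    fix z x assume "r z = g x" "x \<in> S"
    then have "z = G (r' x)" "r' x \<in> S'" using rr(2)[of z] by (auto simp: G_def S'_def rr)
    then show "z \<in> G ` S'" by blast
  qed
  have S'm: "S' \<in> sets borel" unfolding S'_def using measurable_sets[OF rm(1) S] by simp
  have GSm: "G ` S' \<in> sets borel" unfolding GS using measurable_sets[OF rm(1) gS] by simp
  have derG: "(G has_derivative G' y) (at y)" if "y \<in> S'" for y
  proof -
    have "(g has_derivative g' (r y)) (at (r y))" using der that by (simp add: S'_def)
    then show ?thesis
      unfolding G_def G'_def
      by (intro diff_chain_at bounded_linear_imp_has_derivative lin) auto
  qed
  have injG: "inj_on G S'"
  proof (rule inj_onI)
    fix y z assume yz: "y \<in> S'" "z \<in> S'" "G y = G z"
    then have "g (r y) = g (r z)" unfolding G_def by (metis comp_apply rr(1))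
    then have "r y = r z" using inj yz by (auto simp: S'_def dest: inj_onD)
    then show "y = z" by (metis rr(2))
  qed
  have det: "det (matrix (G' y)) = det (matrix (g' (r y)))" if "y \<in> S'" for y
  proof -
    have "matrix (G' y) = (\<chi> a b. matrix (g' (r y)) $ p a $ p b)"
    proof -
      have "r (axis b 1) = axis (p b) 1" for b :: 'm
        by (auto simp: r_def permute_coords_def vec_eq_iff axis_def inv)
      then show ?thesis
        by (intro vec_eq_iff[THEN iffD2] allI) (simp add: matrix_def G'_def r'_def permute_coords_def)
    qed
    then show ?thesis by (simp add: det_reindex[OF p])
  qed
  have D': "D (r y) = \<bar>det (matrix (G' y))\<bar> * f (r (G y))" if "y \<in> S'" for y
    using D[of "r y"] that det[OF that] by (simp add: S'_def G_def rr)
  have i1: "integrable lborel (\<lambda>x. indicator S x * D x) \<longleftrightarrow> integrable lborel (\<lambda>y. indicator S' y * D (r y))"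
    by (subst lb, subst integrable_distr_eq) (auto simp: S'_def indicator_def)
  have e1: "(LINT x|lborel. indicator S x * D x) = (LINT y|lborel. indicator S' y * D (r y))"
    by (subst lb, subst integral_distr) (auto simp: S'_def indicator_def)
  have i2: "integrable lborel (\<lambda>x. indicator (g ` S) x * f x) \<longleftrightarrow> integrable lborel (\<lambda>y. indicator (G ` S') y * f (r y))"
    unfolding GS by (subst lb, subst integrable_distr_eq) (auto simp: indicator_def)
  have e2: "(LINT x|lborel. indicator (g ` S) x * f x) = (LINT y|lborel. indicator (G ` S') y * f (r y))"
    unfolding GS by (subst lb, subst integral_distr) (auto simp: indicator_def)
  have "(\<lambda>y. f (r y)) \<in> borel_measurable borel" "(\<lambda>y. D (r y)) \<in> borel_measurable borel" by measurable
  note cov = change_of_variables_wellorder[OF S'm GSm derG injG this D']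
  show "integrable lborel (\<lambda>x. indicator S x * D x) \<longleftrightarrow> integrable lborel (\<lambda>y. indicator (g ` S) y * f y)"
    using i1 i2 cov(1) by simp
  show "(LINT x|lborel. indicator S x * D x) = (LINT y|lborel. indicator (g ` S) y * f y)"
    using e1 e2 cov(2) by simp
qed

text \<open>
  The numeral types \<open>2\<close> and \<open>3\<close> are the well-ordered index types used for the renaming.
\<close>

lemma change_of_variables_lborel:
  fixes g :: "real^'d::finite \<Rightarrow> real^'d" and f D :: "real^'d \<Rightarrow> real"
  assumes dim: "CARD('d) = 2 \<or> CARD('d) = 3"
    and S: "S \<in> sets borel" "g ` S \<in> sets borel"
    and der: "\<And>x. x \<in> S \<Longrightarrow> (g has_derivative g' x) (at x)" and inj: "inj_on g S"
    and f: "f \<in> borel_measurable borel" and Dm: "D \<in> borel_measurable borel"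
    and D: "\<And>x. x \<in> S \<Longrightarrow> D x = \<bar>det (matrix (g' x))\<bar> * f (g x)"
  shows "integrable lborel (\<lambda>x. indicator S x * D x) \<longleftrightarrow> integrable lborel (\<lambda>y. indicator (g ` S) y * f y)"
    and "(LINT x|lborel. indicator S x * D x) = (LINT y|lborel. indicator (g ` S) y * f y)"
proof -
  consider p where "bij (p :: 2 \<Rightarrow> 'd)" | p where "bij (p :: 3 \<Rightarrow> 'd)"
  proof (cases "CARD('d) = 2")
    case True
    then have "\<exists>p. bij_betw p (UNIV :: 2 set) (UNIV :: 'd set)" by (intro finite_same_card_bij) auto
    then show ?thesis using that by blast
  next
    case False
    then have "CARD('d) = 3" using dim by simp
    then have "\<exists>p. bij_betw p (UNIV :: 3 set) (UNIV :: 'd set)" by (intro finite_same_card_bij) auto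
    then show ?thesis using that by blast
  qed
  then have "(integrable lborel (\<lambda>x. indicator S x * D x) \<longleftrightarrow> integrable lborel (\<lambda>y. indicator (g ` S) y * f y)) \<and>
    (LINT x|lborel. indicator S x * D x) = (LINT y|lborel. indicator (g ` S) y * f y)"
  proof cases
    case 1
    show ?thesis using change_of_variables_reindex[OF 1 S der inj f Dm D] by blast
  next
    case 2
    show ?thesis using change_of_variables_reindex[OF 2 S der inj f Dm D] by blast
  qed
  then show "integrable lborel (\<lambda>x. indicator S x * D x) \<longleftrightarrow> integrable lborel (\<lambda>y. indicator (g ` S) y * f y)"
    and "(LINT x|lborel. indicator S x * D x) = (LINT y|lborel. indicator (g ` S) y * f y)"
    by blast+
qed

lemma LINT_ref_elem_orthogonal:
  fixes \<sigma> :: "real^'d::finite \<Rightarrow> real^'d" and f :: "real^'d \<Rightarrow> real"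
  assumes dim: "CARD('d) = 2 \<or> CARD('d) = 3"
    and \<sigma>: "orthogonal_transformation \<sigma>" "\<sigma> ` ref_int = ref_int"
    and f: "f \<in> borel_measurable borel"
  shows "(LINT x|lebesgue_on ref_elem. f (\<sigma> x)) = (LINT x|lebesgue_on ref_elem. f x)"
proof -
  have lin: "bounded_linear \<sigma>"
    using orthogonal_transformation_linear[OF \<sigma>(1)] by (simp add: linear_conv_bounded_linear)
  have [measurable]: "\<sigma> \<in> borel_measurable borel"
    using lin by (intro borel_measurable_continuous_onI linear_continuous_on)
  have "orthogonal_matrix (matrix \<sigma>)" using \<sigma>(1) by (simp add: orthogonal_transformation_matrix)
  then have "\<bar>det (matrix \<sigma>)\<bar> = 1" using det_orthogonal_matrix[of "matrix \<sigma>"] by auto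
  moreover have "inj \<sigma>" using orthogonal_transformation_inj[OF \<sigma>(1)] .
  moreover have "(\<lambda>x. f (\<sigma> x)) \<in> borel_measurable borel" using f by measurable
  moreover have "(ref_int :: (real^'d) set) \<in> sets borel" by (simp add: ref_int_def)
  ultimately have "(LINT x|lborel. indicator ref_int x * f (\<sigma> x)) = (LINT y|lborel. indicator (\<sigma> ` ref_int) y * f y)"
    using \<sigma>(2) f bounded_linear_imp_has_derivative[OF lin]
    by (intro change_of_variables_lborel(2)[OF dim, where g' = "\<lambda>_. \<sigma>"]) (auto intro: inj_on_subset)
  then show ?thesis
    using f \<open>(\<lambda>x. f (\<sigma> x)) \<in> borel_measurable borel\<close> by (simp add: LINT_ref_elem \<sigma>(2))
qed

section \<open>Smoothness of polynomials\<close>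

lemma partial_polynomial:
  assumes "f \<in> fun_space.span (range monomial)"
  shows "f differentiable at x" "partial j f \<in> fun_space.span (range monomial)"
proof -
  have "(\<forall>x. f differentiable at x) \<and> partial j f \<in> fun_space.span (range monomial)"
    using assms
  proof (induction rule: fun_space.span_induct_alt)
    case base
    have "partial j (\<lambda>x. 0) = (\<lambda>x. 0)" by auto
    then show ?case using fun_space.span_zero by (simp add: zero_fun_def)
  next
    case (step c g f)
    then obtain \<alpha> where g: "g = monomial \<alpha>" by blast
    have "partial j (fun_scale c g + f) = fun_scale (c * real (\<alpha> j)) (monomial (\<alpha>(j := \<alpha> j - 1))) + partial j f"
    proof
      fix x
      have "partial j (\<lambda>x. c * g x + f x) x = c * partial j g x + partial j f x"
        using step(2) differentiable_monomial[of \<alpha> x]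
        by (simp add: g partial_add partial_cmult differentiable_mult)
      then show "partial j (fun_scale c g + f) x = (fun_scale (c * real (\<alpha> j)) (monomial (\<alpha>(j := \<alpha> j - 1))) + partial j f) x"
        by (simp add: fun_scale_def plus_fun_def g partial_monomial)
    qed
    moreover have "(\<lambda>x. c * g x + f x) differentiable at x" for x
      using step(2) differentiable_monomial[of \<alpha> x] by (simp add: g differentiable_mult)
    moreover have "fun_scale (c * real (\<alpha> j)) (monomial (\<alpha>(j := \<alpha> j - 1))) + partial j f \<in> fun_space.span (range monomial)"
      using step(2) by (intro fun_space.span_add[OF fun_space.span_scale[OF fun_space.span_base]]) auto
    moreover have "fun_scale c g + f = (\<lambda>x. c * g x + f x)" by (simp add: fun_scale_def plus_fun_def)
    ultimately show ?case by metis
  qed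
  then show "f differentiable at x" "partial j f \<in> fun_space.span (range monomial)" by auto
qed

lemma smooth_polynomial:
  assumes "f \<in> fun_space.span (range monomial)"
  shows "smooth f"
proof -
  have "C_times n f" for n
    using assms
  proof (induction n arbitrary: f)
    case 0
    then show ?case
      using differentiable_imp_continuous_within[OF partial_polynomial(1)[OF 0]]
      by (simp add: continuous_on_eq_continuous_at)
  next
    case (Suc n)
    then show ?case by (auto intro: partial_polynomial)
  qed
  then show ?thesis by (simp add: smooth_def)
qed

lemma smooth_Qpoly: "f \<in> Qpoly m \<Longrightarrow> smooth f"
  unfolding Qpoly_def
  by (rule smooth_polynomial) (erule rev_subsetD, rule fun_space.span_mono, auto)

section \<open>Faces and symmetries of the reference element\<close>

text \<open>
  Choose \<open>x\<close> in the face with the least number of coordinates in \<open>{- 1, 1}\<close>.  Points of the face agree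
  with \<open>x\<close> in these coordinates, since otherwise the midpoint would have fewer of them; conversely, if \<open>y\<close>
  agrees with \<open>x\<close> there, the segment from \<open>y\<close> to \<open>x\<close> can be extended inside the cube, so \<open>y\<close> is in the
  face.  Thus the face freezes exactly these coordinates: one of them gives a facet, two or more put
  the face into an intersection of two facets.
\<close>

lemma face_of_ref_elem:
  fixes a :: "(real^'d::finite) set"
  assumes a: "a face_of ref_elem" "a \<noteq> {}" "a \<noteq> ref_elem"
  shows "(\<exists>i s. (s = - 1 \<or> s = 1) \<and> a = ref_facet i s) \<or>
    (\<exists>i j s t. i \<noteq> j \<and> a \<subseteq> ref_facet i s \<inter> ref_facet j t \<and> (s = - 1 \<or> s = 1) \<and> (t = - 1 \<or> t = 1))"
proof -
  define I where "I x = {i. x $ i = - 1 \<or> x $ i = 1}" for x :: "real^'d"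
  obtain x0 where "x0 \<in> a" using a by blast
  then obtain x where x: "x \<in> a" and min: "\<And>y. y \<in> a \<Longrightarrow> card (I x) \<le> card (I y)"
    using ex_has_least_nat[of "\<lambda>x. x \<in> a" x0 "\<lambda>x. card (I x)"] by blast
  have sub: "a \<subseteq> ref_elem" and conv: "convex a" using a by (auto simp: face_of_def)
  have agree: "y $ i = x $ i" if y: "y \<in> a" and i: "i \<in> I x" for y i
  proof (rule ccontr)
    assume neq: "y $ i \<noteq> x $ i"
    define m where "m = (1 / 2) *\<^sub>R x + (1 / 2) *\<^sub>R y"
    have "m \<in> a" unfolding m_def using conv x y by (intro convexD) auto
    have bnd: "- 1 \<le> x $ j" "x $ j \<le> 1" "- 1 \<le> y $ j" "y $ j \<le> 1" for j
      using sub x y by (auto simp: mem_ref_elem subset_iff)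
    have m: "m $ j = (x $ j + y $ j) / 2" for j by (simp add: m_def)
    have "I m \<subseteq> I x - {i}"
    proof
      fix j assume "j \<in> I m"
      then have "x $ j + y $ j = - 2 \<or> x $ j + y $ j = 2" by (auto simp: I_def m)
      then have "(x $ j = - 1 \<and> y $ j = - 1) \<or> (x $ j = 1 \<and> y $ j = 1)" using bnd[of j] by linarith
      then show "j \<in> I x - {i}" using neq by (auto simp: I_def)
    qed
    then have "card (I m) < card (I x)" using i by (intro psubset_card_mono) auto
    then show False using min[OF \<open>m \<in> a\<close>] by simp
  qed
  have conv_in: "y \<in> a" if y: "y \<in> ref_elem" and eq: "\<And>i. i \<in> I x \<Longrightarrow> y $ i = x $ i" for y
  proof (cases "y = x")
    case False
    have xb: "- 1 \<le> x $ j" "x $ j \<le> 1" and yb: "- 1 \<le> y $ j" "y $ j \<le> 1" for j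
      using sub x y by (auto simp: mem_ref_elem subset_iff)
    define e where "e = Min (insert 1 ((\<lambda>j. (1 - \<bar>x $ j\<bar>) / 2) ` (UNIV - I x)))"
    have "0 < (1 - \<bar>x $ j\<bar>) / 2" if "j \<notin> I x" for j
      using that xb[of j] by (auto simp: I_def)
    then have e: "0 < e" unfolding e_def by (subst Min_gr_iff) auto
    have ej: "e \<le> (1 - \<bar>x $ j\<bar>) / 2" if "j \<notin> I x" for j
      unfolding e_def using that by (intro Min_le) auto
    define z where "z = x + e *\<^sub>R (x - y)"
    have "z \<in> ref_elem"
      unfolding mem_ref_elem
    proof
      fix j
      show "- 1 \<le> z $ j \<and> z $ j \<le> 1"
      proof (cases "j \<in> I x")
        case True then show ?thesis using eq xb by (simp add: z_def)
      next
        case False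
        have "\<bar>e * (x $ j - y $ j)\<bar> \<le> e * 2"
          unfolding abs_mult using e xb[of j] yb[of j] by (intro mult_mono) auto
        then show ?thesis using ej[OF False] xb[of j] by (simp add: z_def abs_le_iff) linarith
      qed
    qed
    moreover have "x \<in> open_segment y z"
    proof -
      define c where "c = 1 / (1 + e)"
      have c: "1 - c = c * e" "c * (1 + e) = 1" using e by (auto simp: c_def field_simps)
      have "(1 - c) *\<^sub>R y + c *\<^sub>R z = (c * (1 + e)) *\<^sub>R x"
        unfolding c(1) z_def by (simp add: algebra_simps)
      then have "x = (1 - 1 / (1 + e)) *\<^sub>R y + (1 / (1 + e)) *\<^sub>R z"
        by (simp only: c(2) scaleR_one) (simp add: c_def)
      moreover have "y \<noteq> z"
      proof
        assume "y = z"
        then have "(1 + e) *\<^sub>R (y - x) = 0" by (simp add: z_def algebra_simps)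
        then show False using e False by simp
      qed
      ultimately show ?thesis using e unfolding in_segment by (auto intro!: exI[of _ "1 / (1 + e)"])
    qed
    ultimately show ?thesis using face_ofD[OF a(1) _ y _ x] by blast
  qed (use x in simp)
  have a_eq: "a = {y \<in> ref_elem. \<forall>i\<in>I x. y $ i = x $ i}"
    using agree conv_in sub by blast
  have "I x \<noteq> {}" using a_eq a(3) by auto
  then obtain i where i: "i \<in> I x" by blast
  show ?thesis
  proof (cases "I x = {i}")
    case True
    then have "a = ref_facet i (x $ i)" using a_eq by (auto simp: ref_facet_def)
    then show ?thesis using i by (auto simp: I_def)
  next
    case False
    then obtain j where j: "j \<in> I x" "i \<noteq> j" using i by blast
    have "a \<subseteq> ref_facet i (x $ i) \<inter> ref_facet j (x $ j)" using a_eq i j by (auto simp: ref_facet_def)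
    then have "i \<noteq> j \<and> a \<subseteq> ref_facet i (x $ i) \<inter> ref_facet j (x $ j) \<and>
        (x $ i = - 1 \<or> x $ i = 1) \<and> (x $ j = - 1 \<or> x $ j = 1)"
      using i j by (simp add: I_def)
    then show ?thesis by blast
  qed
qed

text \<open>
  \<open>axis i s\<close> is the only point of norm 1 on its facet.
\<close>

lemma orthogonal_facet_axis:
  fixes \<sigma> :: "real^'d::finite \<Rightarrow> real^'d"
  assumes \<sigma>: "orthogonal_transformation \<sigma>" and img: "\<sigma> ` ref_facet i s = ref_facet i' s'"
    and s: "s = - 1 \<or> s = 1" "s' = - 1 \<or> s' = 1"
  shows "\<sigma> (axis i s) = axis i' s'"
proof -
  have "axis i' s' \<in> ref_facet i' s'"
    using s by (auto simp: ref_facet_def mem_ref_elem axis_def)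
  then obtain x where x: "x \<in> ref_facet i s" "\<sigma> x = axis i' s'" using img by (metis imageE)
  have "norm x = norm (axis i' s' :: real^'d)"
    using orthogonal_transformation_norm[OF \<sigma>, of x] x(2) by simp
  then have "norm x = 1" using s by (auto simp: norm_eq_sqrt_inner inner_axis_axis)
  then have "(\<Sum>j\<in>UNIV. (x $ j)\<^sup>2) = 1"
    by (simp add: norm_vec_def L2_set_def)
  moreover have "(\<Sum>j\<in>UNIV. (x $ j)\<^sup>2) = (x $ i)\<^sup>2 + (\<Sum>j\<in>UNIV - {i}. (x $ j)\<^sup>2)"
    by (rule sum.remove) auto
  moreover have "(x $ i)\<^sup>2 = 1" using x(1) s by (auto simp: ref_facet_def)
  ultimately have "(\<Sum>j\<in>UNIV - {i}. (x $ j)\<^sup>2) = 0" by simp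
  then have "\<forall>j\<in>UNIV - {i}. (x $ j)\<^sup>2 = 0" by (subst (asm) sum_nonneg_eq_0_iff) auto
  then have "x = axis i s" using x(1) by (auto simp: vec_eq_iff axis_def ref_facet_def)
  then show ?thesis using x(2) by simp
qed

text \<open>
  The symmetry is only known to map one facet to another.  It respects the normal axis by
  \<open>orthogonal_facet_axis\<close>, and then by orthogonality also the normal coordinate up to sign.
\<close>

lemma orthogonal_to_facet:
  fixes \<sigma> :: "real^'d::finite \<Rightarrow> real^'d"
  assumes \<sigma>: "orthogonal_transformation \<sigma>" and img: "\<sigma> ` ref_facet i s = ref_facet i' s'"
    and s: "s = - 1 \<or> s = 1" "s' = - 1 \<or> s' = 1"
  shows "\<sigma> (to_facet i s x) = to_facet i' s' (\<sigma> x)" "\<bar>\<sigma> x $ i'\<bar> = \<bar>x $ i\<bar>"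
proof -
  have lin: "linear \<sigma>" using orthogonal_transformation_linear[OF \<sigma>] .
  have ax: "\<sigma> (axis i s) = axis i' s'" by (rule orthogonal_facet_axis[OF assms])
  have ss: "s * s = 1" "s' * s' = 1" using s by auto
  have scal: "axis i c = (c * s) *\<^sub>R (axis i s :: real^'d)" for c
    using ss by (auto simp: vec_eq_iff axis_def)
  have \<sigma>c: "\<sigma> (axis i c) = axis i' (c * s * s')" for c
    unfolding scal[of c] linear_cmul[OF lin] ax by (auto simp: vec_eq_iff axis_def)
  have comp: "\<sigma> x $ i' = s * s' * x $ i" for x
  proof -
    have "\<sigma> x \<bullet> \<sigma> (axis i s) = x \<bullet> axis i s" using \<sigma> by (simp add: orthogonal_transformation_def)
    then have "\<sigma> x $ i' * s' = x $ i * s" unfolding ax by (simp add: inner_axis)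
    then have "\<sigma> x $ i' * (s' * s') = x $ i * s * s'" by simp
    then show ?thesis using ss by (simp add: mult.commute mult.left_commute)
  qed
  show "\<bar>\<sigma> x $ i'\<bar> = \<bar>x $ i\<bar>" using s by (auto simp: comp)
  have "to_facet i s x = x + axis i (s - x $ i)" by (auto simp: vec_eq_iff axis_def)
  then have "\<sigma> (to_facet i s x) = \<sigma> x + axis i' ((s - x $ i) * s * s')"
    by (simp add: linear_add[OF lin] \<sigma>c)
  moreover have "(s - x $ i) * s * s' = s' - \<sigma> x $ i'"
    using ss by (simp add: comp algebra_simps)
  ultimately show "\<sigma> (to_facet i s x) = to_facet i' s' (\<sigma> x)" by (auto simp: vec_eq_iff axis_def)
qed

text \<open>
  A point lies in the cube if and only if its projection lies in the facet and its normal coordinate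
  has modulus at most 1.
\<close>

lemma orthogonal_facet_ref_int:
  fixes \<sigma> :: "real^'d::finite \<Rightarrow> real^'d"
  assumes \<sigma>: "orthogonal_transformation \<sigma>" and img: "\<sigma> ` ref_facet i s = ref_facet i' s'"
    and s: "s = - 1 \<or> s = 1" "s' = - 1 \<or> s' = 1"
  shows "\<sigma> ` ref_elem = ref_elem" "\<sigma> ` ref_int = ref_int"
proof -
  have facet: "x \<in> ref_elem \<longleftrightarrow> \<bar>x $ i\<bar> \<le> 1 \<and> to_facet i s x \<in> ref_facet i s" if "s = - 1 \<or> s = 1"
    for i s and x :: "real^'d"
    using that by (auto simp: mem_ref_elem ref_facet_def abs_le_iff)
  have inj: "inj \<sigma>" using orthogonal_transformation_inj[OF \<sigma>] .
  have iff: "\<sigma> x \<in> ref_elem \<longleftrightarrow> x \<in> ref_elem" for x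
  proof -
    have "to_facet i' s' (\<sigma> x) \<in> ref_facet i' s' \<longleftrightarrow> to_facet i s x \<in> ref_facet i s"
      unfolding orthogonal_to_facet(1)[OF assms, symmetric] img[symmetric] using inj by (simp add: inj_image_mem_iff)
    then show ?thesis
      using facet[OF s(1), of x i] facet[OF s(2), of "\<sigma> x" i'] orthogonal_to_facet(2)[OF assms, of x] by simp
  qed
  show elem: "\<sigma> ` ref_elem = ref_elem"
  proof
    show "\<sigma> ` ref_elem \<subseteq> ref_elem" using iff by blast
    show "ref_elem \<subseteq> \<sigma> ` ref_elem"
    proof
      fix y :: "real^'d" assume "y \<in> ref_elem"
      obtain x where "y = \<sigma> x" using orthogonal_transformation_surj[OF \<sigma>] by (metis surjD)
      then show "y \<in> \<sigma> ` ref_elem" using iff \<open>y \<in> ref_elem\<close> by blast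
    qed
  qed
  have "\<sigma> ` interior ref_elem = interior (\<sigma> ` ref_elem)"
    using interior_injective_linear_image[OF orthogonal_transformation_linear[OF \<sigma>] inj] by metis
  then show "\<sigma> ` ref_int = ref_int" unfolding elem by (simp add: ref_elem_def ref_int_def interior_cbox)
qed

section \<open>The chain rule and cones over faces\<close>

lemma smooth_map_has_derivative:
  fixes \<Phi> :: "real^'d::finite \<Rightarrow> real^'d"
  assumes "\<And>j. (\<lambda>x. \<Phi> x $ j) differentiable at x"
  shows "(\<Phi> has_derivative (\<lambda>h. DF \<Phi> x *v h)) (at x)"
    and "DF \<Phi> x $ j $ i = partial i (\<lambda>x. \<Phi> x $ j) x"
proof -
  have "\<Phi> differentiable at x"
    using assms by (subst differentiable_componentwise_within) (auto simp: Basis_vec_def inner_axis)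
  then have d: "(\<Phi> has_derivative frechet_derivative \<Phi> (at x)) (at x)"
    by (simp add: frechet_derivative_works)
  have lin: "linear (frechet_derivative \<Phi> (at x))"
    by (rule has_derivative_linear[OF d])
  have "(\<lambda>h. DF \<Phi> x *v h) = frechet_derivative \<Phi> (at x)"
    unfolding DF_def by (rule matrix_vector_mul(2)[OF lin])
  then show "(\<Phi> has_derivative (\<lambda>h. DF \<Phi> x *v h)) (at x)" using d by simp
  have "((\<lambda>x. \<Phi> x $ j) has_derivative (\<lambda>h. frechet_derivative \<Phi> (at x) h $ j)) (at x)"
    by (rule bounded_linear.has_derivative[OF bounded_linear_vec_nth d])
  then have "frechet_derivative (\<lambda>x. \<Phi> x $ j) (at x) = (\<lambda>h. frechet_derivative \<Phi> (at x) h $ j)"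
    by (rule frechet_derivative_at[symmetric])
  then show "DF \<Phi> x $ j $ i = partial i (\<lambda>x. \<Phi> x $ j) x"
    by (simp add: partial_def DF_def matrix_def)
qed

lemma partial_compose:
  fixes \<Phi> :: "real^'d::finite \<Rightarrow> real^'d"
  assumes \<Phi>: "\<And>j. (\<lambda>x. \<Phi> x $ j) differentiable at x" and \<phi>: "\<phi> differentiable at (\<Phi> x)"
  shows "(\<lambda>x. \<phi> (\<Phi> x)) differentiable at x"
    "partial i (\<lambda>x. \<phi> (\<Phi> x)) x = (\<Sum>j\<in>UNIV. partial j \<phi> (\<Phi> x) * DF \<Phi> x $ j $ i)"
proof -
  have d\<phi>: "(\<phi> has_derivative frechet_derivative \<phi> (at (\<Phi> x))) (at (\<Phi> x))"
    using \<phi> by (simp add: frechet_derivative_works)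
  have lin: "linear (frechet_derivative \<phi> (at (\<Phi> x)))"
    by (rule has_derivative_linear[OF d\<phi>])
  have d: "((\<lambda>x. \<phi> (\<Phi> x)) has_derivative (\<lambda>h. frechet_derivative \<phi> (at (\<Phi> x)) (DF \<Phi> x *v h))) (at x)"
    using diff_chain_at[OF smooth_map_has_derivative(1)[OF \<Phi>] d\<phi>] by (simp add: o_def)
  then show "(\<lambda>x. \<phi> (\<Phi> x)) differentiable at x" by (auto simp: differentiable_def)
  have "partial i (\<lambda>x. \<phi> (\<Phi> x)) x = frechet_derivative \<phi> (at (\<Phi> x)) (DF \<Phi> x *v axis i 1)"
    unfolding partial_def frechet_derivative_at[OF d, symmetric] ..
  also have "DF \<Phi> x *v axis i 1 = (\<Sum>j\<in>UNIV. DF \<Phi> x $ j $ i *\<^sub>R axis j 1)"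
    unfolding matrix_vector_mult_basis by (simp add: vec_eq_iff column_def axis_def if_distrib cong: if_cong)
  also have "frechet_derivative \<phi> (at (\<Phi> x)) \<dots> = (\<Sum>j\<in>UNIV. DF \<Phi> x $ j $ i *\<^sub>R frechet_derivative \<phi> (at (\<Phi> x)) (axis j 1))"
    by (simp add: linear_sum[OF lin] linear_cmul[OF lin])
  finally show "partial i (\<lambda>x. \<phi> (\<Phi> x)) x = (\<Sum>j\<in>UNIV. partial j \<phi> (\<Phi> x) * DF \<Phi> x $ j $ i)"
    by (simp add: partial_def mult.commute)
qed

lemma negligible_coordinate: "negligible {x :: real^'d::finite. x $ i = c}"
  using negligible_hyperplane[of "axis i 1 :: real^'d" c] by (simp add: inner_axis' axis_eq_0_iff)

text \<open>
  Two coordinates are frozen, and the cone adds one parameter \<open>t\<close>, so the cone is the differentiable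
  image of a hyperplane: coordinate \<open>i\<close> carries \<open>t\<close>, and coordinate \<open>j\<close> is set to zero.
\<close>

lemma negligible_cone:
  fixes \<Phi> :: "real^'d::finite \<Rightarrow> real^'d"
  assumes \<Phi>: "\<And>x. \<Phi> differentiable at x" and ij: "i \<noteq> j"
  shows "negligible {p + t *\<^sub>R (\<Phi> x - p) | t x. x $ i = s \<and> x $ j = r}"
proof -
  define G where "G y = p + (y $ i) *\<^sub>R (\<Phi> (to_facet i s (to_facet j r y)) - p)" for y :: "real^'d"
  have "G differentiable at y" for y
  proof -
    have tf: "to_facet i s differentiable at y" for i s and y :: "real^'d"
      unfolding to_facet_eq[abs_def] by (intro derivative_intros differentiable_vec_nth)
    have "(\<lambda>y. to_facet i s (to_facet j r y)) differentiable at y"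
      by (rule differentiable_compose[OF tf tf])
    then have "(\<lambda>y. \<Phi> (to_facet i s (to_facet j r y))) differentiable at y"
      by (rule differentiable_compose[of \<Phi>, OF \<Phi>])
    then show ?thesis
      unfolding G_def by (intro derivative_intros differentiable_vec_nth)
  qed
  then have "negligible (G ` {y. y $ j = 0})"
    by (intro negligible_differentiable_image_negligible negligible_coordinate)
      (auto simp: differentiable_on_def intro: differentiable_at_withinI)
  moreover have "{p + t *\<^sub>R (\<Phi> x - p) | t x. x $ i = s \<and> x $ j = r} \<subseteq> G ` {y. y $ j = 0}"
  proof safe
    fix t x assume x: "s = x $ i" "r = x $ j"
    have "to_facet i (x $ i) (to_facet j (x $ j) (to_facet i t (to_facet j 0 x))) = x"
      using ij by (simp add: vec_eq_iff)
    then have "p + t *\<^sub>R (\<Phi> x - p) = G (to_facet i t (to_facet j 0 x))"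
      using ij by (simp add: G_def x)
    moreover have "to_facet i t (to_facet j 0 x) $ j = 0" using ij by simp
    ultimately show "p + t *\<^sub>R (\<Phi> x - p) \<in> G ` {y. y $ j = 0}" by blast
  qed
  ultimately show ?thesis by (rule negligible_subset)
qed

text \<open>
  Continuity is required only on the closed cube, where the quotients by the Jacobian are continuous.
\<close>

lemma ref_integral_continuous:
  fixes D :: "real^'d::finite \<Rightarrow> real"
  assumes D: "continuous_on ref_elem D"
  shows "(\<lambda>x. indicator ref_int x * D x) \<in> borel_measurable borel"
    "integrable lborel (\<lambda>x. indicator ref_int x * D x)"
    "(LINT x|lebesgue_on ref_elem. D x) = (LINT x|lborel. indicator ref_int x * D x)"
    "integrable (lebesgue_on ref_elem) D"
proof -
  have sets: "(ref_elem :: (real^'d) set) \<in> sets borel" "(ref_int :: (real^'d) set) \<in> sets borel"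
    by (auto simp: ref_elem_def ref_int_def)
  have m: "(\<lambda>x. indicator ref_elem x * D x) \<in> borel_measurable borel"
    using borel_measurable_continuous_on_indicator[OF sets(1) D] by simp
  have eq: "indicator ref_int x * (indicator ref_elem x * D x) = indicator ref_int x * D x" for x
    using ref_int_subset by (auto simp: indicator_def)
  have "(\<lambda>x. indicator ref_int x * (indicator ref_elem x * D x)) \<in> borel_measurable borel"
    by (rule borel_measurable_times[OF borel_measurable_indicator[OF sets(2)] m])
  then show "(\<lambda>x. indicator ref_int x * D x) \<in> borel_measurable borel" by (simp only: eq)
  show int: "integrable (lebesgue_on ref_elem) D"
    unfolding ref_elem_def by (rule continuous_imp_integrable) (use D in \<open>simp add: ref_elem_def\<close>)
  have cong: "integrable (lebesgue_on ref_elem) (\<lambda>x. indicator ref_elem x * D x) \<longleftrightarrow> integrable (lebesgue_on ref_elem) D"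
    "(LINT x|lebesgue_on ref_elem. indicator ref_elem x * D x) = (LINT x|lebesgue_on ref_elem. D x)"
    by (auto intro!: Bochner_Integration.integrable_cong Bochner_Integration.integral_cong)
  show "integrable lborel (\<lambda>x. indicator ref_int x * D x)"
    using LINT_ref_elem(2)[OF m] cong(1) int by (simp only: eq)
  show "(LINT x|lebesgue_on ref_elem. D x) = (LINT x|lborel. indicator ref_int x * D x)"
    using LINT_ref_elem(1)[OF m] cong(2) by (simp only: eq)
qed

section \<open>Integration over the mesh\<close>

locale quad_mesh =
  fixes \<Omega> :: "(real^'d::finite) set" and \<T> :: "(real^'d) set set"
    and F :: "(real^'d) set \<Rightarrow> real^'d \<Rightarrow> real^'d"
  assumes dim: "CARD('d) = 2 \<or> CARD('d) = 3"
    and domain: "polytopal_domain \<Omega>"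
    and part: "fe_partition \<Omega> \<T> F"
begin

lemma \<Omega>: "open \<Omega>" "bounded \<Omega>" "connected \<Omega>" "\<Omega> \<noteq> {}" "interior (closure \<Omega>) = \<Omega>" "\<Omega> \<in> sets lebesgue"
  using domain by (auto simp: polytopal_domain_def)

lemma mesh: "finite \<T>" "\<Union>\<T> = closure \<Omega>"
  using part by (auto simp: fe_partition_def)

lemma smooth_F:
  assumes "E \<in> \<T>"
  shows "smooth (\<lambda>x. F E x $ i)"
proof -
  have "(\<lambda>x. F E x $ i) \<in> Qpoly 1"
    using part assms unfolding fe_partition_def element_map_def by blast
  then show ?thesis by (rule smooth_Qpoly)
qed

lemma F_bij: "E \<in> \<T> \<Longrightarrow> inj_on (F E) ref_elem" "E \<in> \<T> \<Longrightarrow> F E ` ref_elem = E"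
  using part by (auto simp: fe_partition_def element_map_def bij_betw_def)

lemma F_has_derivative:
  "E \<in> \<T> \<Longrightarrow> (F E has_derivative (\<lambda>h. DF (F E) x *v h)) (at x)"
  by (rule smooth_map_has_derivative(1)) (rule smooth_differentiable[OF smooth_F])

lemma F_differentiable: "E \<in> \<T> \<Longrightarrow> F E differentiable at x"
  using F_has_derivative by (auto simp: differentiable_def)

lemma F_continuous: "E \<in> \<T> \<Longrightarrow> continuous_on S (F E)"
  by (meson F_differentiable differentiable_imp_continuous_within continuous_at_imp_continuous_on)

lemma DF_continuous: "E \<in> \<T> \<Longrightarrow> continuous_on S (\<lambda>x. DF (F E) x $ j $ i)"
  using smooth_map_has_derivative(2)[OF smooth_differentiable[OF smooth_F]] smooth_continuous_partial[OF smooth_F]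
  by simp

lemma Jac_continuous: "E \<in> \<T> \<Longrightarrow> continuous_on S (Jac (F E))"
  unfolding Jac_def[abs_def] det_def by (intro continuous_intros DF_continuous)

lemma DF_invertible: "E \<in> \<T> \<Longrightarrow> x \<in> ref_elem \<Longrightarrow> invertible (DF (F E) x)"
  using part by (auto simp: fe_partition_def element_map_def)

lemma Jac_pos: "E \<in> \<T> \<Longrightarrow> x \<in> ref_elem \<Longrightarrow> Jac (F E) x > 0"
  using DF_invertible by (auto simp: Jac_def invertible_det_nz)

lemma element_compact: "E \<in> \<T> \<Longrightarrow> compact E"
  using F_bij(2) compact_continuous_image[OF F_continuous, of E ref_elem] by (simp add: ref_elem_def)

lemma element_subset: "E \<in> \<T> \<Longrightarrow> E \<subseteq> closure \<Omega>"
  using mesh by blast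

lemma element_interior_open: "E \<in> \<T> \<Longrightarrow> open (F E ` ref_int)"
  by (intro invariance_of_domain F_continuous inj_on_subset[OF F_bij(1) ref_int_subset])
    (simp_all add: ref_int_def open_box)

lemma element_interior_subset: "E \<in> \<T> \<Longrightarrow> F E ` ref_int \<subseteq> E"
  using F_bij(2) ref_int_subset by blast

text \<open>
  This uses that the domain is the interior of its closure: the image of the open cube is open by
  invariance of domain and contained in the closure of \<open>\<Omega>\<close>.
\<close>

lemma element_interior_subset_domain: "E \<in> \<T> \<Longrightarrow> F E ` ref_int \<subseteq> \<Omega>"
  using interior_maximal[OF order_trans[OF element_interior_subset element_subset] element_interior_open, of E]
  by (simp add: \<Omega>(5))

lemma element_interior_nonempty: "E \<in> \<T> \<Longrightarrow> F E ` ref_int \<noteq> {}"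
proof -
  have "(0 :: real^'d) \<in> ref_int" by (simp add: mem_ref_int)
  then show "F E ` ref_int \<noteq> {}" by blast
qed

lemma element_intersection:
  assumes "E \<in> \<T>" "E' \<in> \<T>" "E \<noteq> E'"
  obtains a a' \<sigma> where "a face_of ref_elem" "a \<noteq> ref_elem" "a' face_of ref_elem"
    "orthogonal_transformation \<sigma>" "\<sigma> ` a = a'" "\<And>x. x \<in> a \<Longrightarrow> F E x = F E' (\<sigma> x)" "E \<inter> E' = F E ` a"
  using part assms unfolding fe_partition_def by metis

lemma proper_face_disjoint_ref_int:
  fixes a :: "(real^'d) set"
  assumes "a face_of ref_elem" "a \<noteq> ref_elem"
  shows "a \<inter> ref_int = {}" "negligible a"
proof -
  have fac: "ref_facet i s \<inter> ref_int = {}" "negligible (ref_facet i s)" if "s = - 1 \<or> s = 1"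
    for i :: 'd and s
  proof -
    have False if "x \<in> ref_facet i s" "x \<in> ref_int" for x
    proof -
      have "x $ i = s" "- 1 < x $ i" "x $ i < 1" using that by (auto simp: ref_facet_def mem_ref_int)
      then show False using \<open>s = - 1 \<or> s = 1\<close> by auto
    qed
    then show "ref_facet i s \<inter> ref_int = {}" by blast
    show "negligible (ref_facet i s)"
      by (rule negligible_subset[OF negligible_coordinate[of i s]]) (auto simp: ref_facet_def)
  qed
  have "a = {} \<or> (\<exists>i s. (s = - 1 \<or> s = 1) \<and> a \<subseteq> ref_facet i s)"
    using face_of_ref_elem[OF assms(1) _ assms(2)] by (metis le_inf_iff order_refl)
  then consider "a = {}" | i s where "s = - 1 \<or> s = 1" "a \<subseteq> ref_facet i s" by blast
  then have "a \<inter> ref_int = {} \<and> negligible a"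
  proof cases
    case 2
    then show ?thesis using fac(1)[OF 2(1), of i] negligible_subset[OF fac(2)[OF 2(1)] 2(2)] by blast
  qed simp
  then show "a \<inter> ref_int = {}" "negligible a" by simp_all
qed

lemma element_interiors_disjoint:
  assumes "E \<in> \<T>" "E' \<in> \<T>" "E \<noteq> E'"
  shows "F E ` ref_int \<inter> F E' ` ref_int = {}"
proof -
  obtain a where a: "a face_of ref_elem" "a \<noteq> ref_elem" "E \<inter> E' = F E ` a"
    using element_intersection[OF assms] by metis
  have "a \<subseteq> ref_elem" using a by (auto simp: face_of_def)
  have "F E ` ref_int \<inter> F E ` a = {}"
  proof (rule ccontr)
    assume "F E ` ref_int \<inter> F E ` a \<noteq> {}"
    then obtain x y where "x \<in> ref_int" "y \<in> a" "F E x = F E y" by auto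
    moreover from this have "x = y"
      using F_bij(1)[OF assms(1)] ref_int_subset \<open>a \<subseteq> ref_elem\<close> by (auto dest: inj_onD)
    ultimately show False using proper_face_disjoint_ref_int(1)[OF a(1,2)] by blast
  qed
  then show ?thesis
    using a(3) element_interior_subset[OF assms(1)] element_interior_subset[OF assms(2)] by blast
qed

lemma negligible_image_F: "E \<in> \<T> \<Longrightarrow> negligible S \<Longrightarrow> negligible (F E ` S)"
  by (rule negligible_differentiable_image_negligible)
    (auto simp: differentiable_on_def intro: differentiable_at_withinI F_differentiable)

lemma mesh_AE: "AE x in lebesgue. x \<in> \<Omega> \<longleftrightarrow> x \<in> mesh_interior \<T> F"
proof -
  have neg: "negligible (ref_elem - ref_int :: (real^'d) set)"
    unfolding ref_elem_def ref_int_def using negligible_frontier_interval .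
  have "negligible (\<Union>E\<in>\<T>. F E ` (ref_elem - ref_int))"
    using mesh(1) by (intro negligible_Union) (auto intro: negligible_image_F neg)
  then have "AE x in lebesgue. x \<notin> (\<Union>E\<in>\<T>. F E ` (ref_elem - ref_int))"
    by (intro AE_not_in) (simp add: negligible_iff_null_sets)
  then show ?thesis
  proof eventually_elim
    fix x assume x: "x \<notin> (\<Union>E\<in>\<T>. F E ` (ref_elem - ref_int))"
    show "x \<in> \<Omega> \<longleftrightarrow> x \<in> mesh_interior \<T> F"
    proof
      assume "x \<in> \<Omega>"
      then obtain E where E: "E \<in> \<T>" "x \<in> E" using mesh(2) closure_subset by blast
      then obtain y where "y \<in> ref_elem" "x = F E y" using F_bij(2) by blast
      then show "x \<in> mesh_interior \<T> F" using E x unfolding mesh_interior_def by blast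
    next
      assume "x \<in> mesh_interior \<T> F"
      then show "x \<in> \<Omega>" unfolding mesh_interior_def using element_interior_subset_domain by blast
    qed
  qed
qed

text \<open>
  The function \<open>f\<close> is controlled only in the interior of the element; its pullback times the Jacobian
  extends continuously to the closed cube, which gives integrability.
\<close>

lemma element_integral:
  assumes E: "E \<in> \<T>" and D: "continuous_on ref_elem D"
    and f: "\<And>x. x \<in> ref_int \<Longrightarrow> D x = Jac (F E) x * f (F E x)"
  shows "(\<lambda>y. indicator (F E ` ref_int) y * f y) \<in> borel_measurable borel"
    "integrable lborel (\<lambda>y. indicator (F E ` ref_int) y * f y)"
    "(LINT y|lborel. indicator (F E ` ref_int) y * f y) = (LINT x|lebesgue_on ref_elem. D x)"
proof -
  define B where "B = F E ` ref_int"
  define g where "g = inv_into ref_elem (F E)"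
  have B: "B \<in> sets borel" using element_interior_open[OF E] by (simp add: B_def)
  have gF: "g (F E x) = x" if "x \<in> ref_elem" for x
    unfolding g_def using F_bij(1)[OF E] that by (rule inv_into_f_f)
  have "continuous_on (F E ` ref_elem) g"
    using F_continuous[OF E] gF by (intro continuous_on_inv) (auto simp: ref_elem_def)
  then have gc: "continuous_on B g"
    by (rule continuous_on_subset) (use ref_int_subset in \<open>auto simp: B_def\<close>)
  have "continuous_on B (\<lambda>y. D (g y) / Jac (F E) (g y))"
  proof -
    have "g ` B \<subseteq> ref_elem" using gF ref_int_subset by (auto simp: B_def)
    moreover have "Jac (F E) (g y) \<noteq> 0" if "y \<in> B" for y
      using that Jac_pos[OF E] \<open>g ` B \<subseteq> ref_elem\<close> by (metis imageI less_irrefl subset_iff)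
    ultimately show ?thesis
      by (intro continuous_on_divide continuous_on_compose2[OF D gc] continuous_on_compose2[OF Jac_continuous[OF E, of UNIV] gc]) auto
  qed
  moreover have "D (g y) / Jac (F E) (g y) = f y" if yB: "y \<in> B" for y
  proof -
    obtain x where x: "x \<in> ref_int" "y = F E x" using yB by (auto simp: B_def)
    have "x \<in> ref_elem" using x ref_int_subset by blast
    then show ?thesis using f[OF x(1)] Jac_pos[OF E, of x] gF x(2) by simp
  qed
  ultimately have "continuous_on B f" by (rule continuous_on_eq)
  then have fm: "(\<lambda>y. indicator B y * f y) \<in> borel_measurable borel"
    using borel_measurable_continuous_on_indicator[OF B, of f] by simp
  then show "(\<lambda>y. indicator (F E ` ref_int) y * f y) \<in> borel_measurable borel" by (simp add: B_def)
  have ri: "(ref_int :: (real^'d) set) \<in> sets borel" by (simp add: ref_int_def)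
  note cov = change_of_variables_lborel[OF dim ri B[unfolded B_def] F_has_derivative[OF E]
      inj_on_subset[OF F_bij(1)[OF E] ref_int_subset] fm ref_integral_continuous(1)[OF D]]
  have D': "indicator ref_int x * D x = \<bar>det (matrix (\<lambda>h. DF (F E) x *v h))\<bar> * (indicator B (F E x) * f (F E x))"
    if "x \<in> ref_int" for x
    using f[OF that] that by (simp add: B_def Jac_def)
  have eq: "indicator ref_int x * (indicator ref_int x * D x) = indicator ref_int x * D x"
    "indicator B y * (indicator B y * f y) = indicator B y * f y" for x y
    by (auto simp: indicator_def)
  show "integrable lborel (\<lambda>y. indicator (F E ` ref_int) y * f y)"
    using cov(1)[OF D'] ref_integral_continuous(2)[OF D] unfolding B_def[symmetric] eq by simp
  show "(LINT y|lborel. indicator (F E ` ref_int) y * f y) = (LINT x|lebesgue_on ref_elem. D x)"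
    using cov(2)[OF D'] ref_integral_continuous(3)[OF D] unfolding B_def[symmetric] eq by simp
qed

lemma mesh_integral:
  assumes D: "\<And>E. E \<in> \<T> \<Longrightarrow> continuous_on ref_elem (D E)"
    and f: "\<And>E x. E \<in> \<T> \<Longrightarrow> x \<in> ref_int \<Longrightarrow> D E x = Jac (F E) x * f (F E x)"
  shows "integrable (lebesgue_on \<Omega>) f"
    "(LINT x|lebesgue_on \<Omega>. f x) = (\<Sum>E\<in>\<T>. LINT x|lebesgue_on ref_elem. D E x)"
proof -
  define g where "g y = (\<Sum>E\<in>\<T>. indicator (F E ` ref_int) y * f y)" for y
  note el = element_integral[OF _ D f]
  have gi: "integrable lborel g" unfolding g_def by (intro Bochner_Integration.integrable_sum el(2))
  have gl: "integrable lebesgue g" using gi by (subst integrable_completion) auto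
  have "AE y in lebesgue. g y = indicator \<Omega> y *\<^sub>R f y"
    using mesh_AE
  proof eventually_elim
    fix y assume y: "y \<in> \<Omega> \<longleftrightarrow> y \<in> mesh_interior \<T> F"
    show "g y = indicator \<Omega> y *\<^sub>R f y"
    proof (cases "y \<in> mesh_interior \<T> F")
      case True
      then obtain E where E: "E \<in> \<T>" "y \<in> F E ` ref_int" by (auto simp: mesh_interior_def)
      have "g y = indicator (F E ` ref_int) y * f y + (\<Sum>E\<in>\<T> - {E}. indicator (F E ` ref_int) y * f y)"
        unfolding g_def using mesh(1) E(1) by (rule sum.remove)
      also have "(\<Sum>E\<in>\<T> - {E}. indicator (F E ` ref_int) y * f y) = 0"
        using element_interiors_disjoint[OF E(1)] E(2) by (intro sum.neutral) (auto simp: indicator_def)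
      finally show ?thesis using E y True by simp
    next
      case False
      then have "g y = 0" unfolding g_def mesh_interior_def by (intro sum.neutral) (auto simp: indicator_def)
      then show ?thesis using y False by simp
    qed
  qed
  moreover from this have "(\<lambda>y. indicator \<Omega> y *\<^sub>R f y) \<in> borel_measurable lebesgue"
    by (rule borel_measurable_AE[rotated]) (use gl in auto)
  ultimately have *: "integrable lebesgue (\<lambda>y. indicator \<Omega> y *\<^sub>R f y)"
    "(LINT y|lebesgue. indicator \<Omega> y *\<^sub>R f y) = (LINT y|lebesgue. g y)"
    using gl by (auto intro: integrable_cong_AE_imp[of lebesgue g] integral_cong_AE simp: eq_commute)
  show "integrable (lebesgue_on \<Omega>) f"
    using * \<Omega>(6) by (subst integrable_restrict_space) auto
  have "(LINT x|lebesgue_on \<Omega>. f x) = (LINT y|lebesgue. g y)"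
    using * \<Omega>(6) by (subst integral_restrict_space) auto
  also have "\<dots> = (LINT y|lborel. g y)" using gi by (intro integral_completion) auto
  also have "\<dots> = (\<Sum>E\<in>\<T>. LINT x|lebesgue_on ref_elem. D E x)"
    unfolding g_def by (subst Bochner_Integration.integral_sum) (auto simp: el)
  finally show "(LINT x|lebesgue_on \<Omega>. f x) = (\<Sum>E\<in>\<T>. LINT x|lebesgue_on ref_elem. D E x)" .
qed

section \<open>Connectivity of the mesh through facets\<close>

definition shared_facet :: "(real^'d) set \<Rightarrow> (real^'d) set \<Rightarrow> 'd \<Rightarrow> real \<Rightarrow> 'd \<Rightarrow> real \<Rightarrow> (real^'d \<Rightarrow> real^'d) \<Rightarrow> bool" where
  "shared_facet E E' i s i' s' \<sigma> \<longleftrightarrow>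
     (s = - 1 \<or> s = 1) \<and> (s' = - 1 \<or> s' = 1) \<and> orthogonal_transformation \<sigma> \<and>
     \<sigma> ` ref_facet i s = ref_facet i' s' \<and> (\<forall>x\<in>ref_facet i s. F E x = F E' (\<sigma> x))"

definition ridge_indices :: "((real^'d) set \<times> 'd \<times> 'd \<times> real \<times> real) set" where
  "ridge_indices = {(E, i, j, s, t). E \<in> \<T> \<and> i \<noteq> j \<and> (s = - 1 \<or> s = 1) \<and> (t = - 1 \<or> t = 1)}"

text \<open>
  All images of faces of codimension two.
\<close>

definition ridges :: "(real^'d) set" where
  "ridges = \<Union> ((\<lambda>(E, i, j, s, t). F E ` (ref_facet i s \<inter> ref_facet j t)) ` ridge_indices)"

lemma finite_ridge_indices: "finite ridge_indices"
proof (rule finite_subset)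
  show "ridge_indices \<subseteq> \<T> \<times> UNIV \<times> UNIV \<times> {- 1, 1} \<times> {- 1, 1}" by (auto simp: ridge_indices_def)
  show "finite (\<T> \<times> (UNIV :: 'd set) \<times> (UNIV :: 'd set) \<times> {- 1, 1 :: real} \<times> {- 1, 1 :: real})"
    using mesh(1) by simp
qed

lemma compact_ref_facet: "compact (ref_facet i s)"
proof -
  have "ref_facet i s = ref_elem \<inter> {x. x $ i = s}" by (auto simp: ref_facet_def)
  moreover have "closed {x :: real^'a::finite. x $ i = s}" for i
    by (intro closed_Collect_eq continuous_intros)
  ultimately show ?thesis by (simp add: ref_elem_def compact_Int_closed)
qed

lemma negligible_ridges: "negligible ridges"
  unfolding ridges_def
proof (rule negligible_Union)
  show "finite ((\<lambda>(E, i, j, s, t). F E ` (ref_facet i s \<inter> ref_facet j t)) ` ridge_indices)"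
    using finite_ridge_indices by simp
  have "negligible (F E ` (ref_facet i s \<inter> ref_facet j t))" if "E \<in> \<T>" for E i s j t
    by (rule negligible_image_F[OF that], rule negligible_subset[OF negligible_coordinate[of i s]])
      (auto simp: ref_facet_def)
  then show "negligible S" if "S \<in> (\<lambda>(E, i, j, s, t). F E ` (ref_facet i s \<inter> ref_facet j t)) ` ridge_indices" for S
    using that by (auto simp: ridge_indices_def)
qed

text \<open>
  If \<open>p\<close> lies on no ridge, almost every point is therefore joined to \<open>p\<close> by a segment that avoids
  all ridges.
\<close>

lemma negligible_cone_ridges: "negligible {p + t *\<^sub>R (y - p) | t y. y \<in> ridges}"
proof -
  define C where "C = (\<lambda>(E, i, j, s, r). {p + t *\<^sub>R (F E x - p) | t x. x $ i = s \<and> x $ j = r})"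
  have "negligible (\<Union> (C ` ridge_indices))"
  proof (rule negligible_Union)
    show "finite (C ` ridge_indices)" using finite_ridge_indices by simp
    show "negligible S" if "S \<in> C ` ridge_indices" for S
    proof -
      obtain E i j s r where "E \<in> \<T>" "i \<noteq> j" "S = C (E, i, j, s, r)"
        using \<open>S \<in> C ` ridge_indices\<close> by (auto simp: ridge_indices_def)
      then show ?thesis unfolding C_def by (simp add: negligible_cone[OF F_differentiable])
    qed
  qed
  moreover have "{p + t *\<^sub>R (y - p) | t y. y \<in> ridges} \<subseteq> \<Union> (C ` ridge_indices)"
  proof safe
    fix t y assume "y \<in> ridges"
    then obtain E i j s r x where *: "(E, i, j, s, r) \<in> ridge_indices"
      "x \<in> ref_facet i s" "x \<in> ref_facet j r" "y = F E x"
      unfolding ridges_def by blast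
    then have "p + t *\<^sub>R (y - p) \<in> C (E, i, j, s, r)" by (auto simp: C_def ref_facet_def)
    then show "p + t *\<^sub>R (y - p) \<in> \<Union> (C ` ridge_indices)"
      using *(1) by blast
  qed
  ultimately show ?thesis by (rule negligible_subset)
qed

text \<open>
  A face that is not a facet is contained in two facets, so the intersection lies in the ridges unless
  both identified faces are facets.
\<close>

lemma intersection_cases:
  assumes "E \<in> \<T>" "E' \<in> \<T>" "E \<noteq> E'"
  shows "(\<exists>i s i' s' \<sigma>. shared_facet E E' i s i' s' \<sigma>) \<or> E \<inter> E' \<subseteq> ridges"
proof -
  obtain a a' \<sigma> where a: "a face_of ref_elem" "a \<noteq> ref_elem" and a': "a' face_of ref_elem"
    and \<sigma>: "orthogonal_transformation \<sigma>" "\<sigma> ` a = a'" "\<And>x. x \<in> a \<Longrightarrow> F E x = F E' (\<sigma> x)"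
    and EE: "E \<inter> E' = F E ` a"
    using element_intersection[OF assms] by metis
  have EE': "E \<inter> E' = F E' ` a'" using \<sigma> EE by (auto simp: image_iff) 
  show ?thesis
  proof (cases "a = {}")
    case False
    have "a' \<noteq> {}" using False \<sigma>(2) by blast
    have "a' \<noteq> ref_elem"
    proof
      assume "a' = ref_elem"
      then have "negligible (ref_elem :: (real^'d) set)"
        using negligible_differentiable_image_negligible[OF order_refl proper_face_disjoint_ref_int(2)[OF a]
            linear_imp_differentiable_on[OF orthogonal_transformation_linear[OF \<sigma>(1)]]] \<sigma>(2)
        by simp
      then have "negligible (ref_int :: (real^'d) set)" using ref_int_subset by (rule negligible_subset)
      moreover have "(0 :: real^'d) \<in> ref_int" by (simp add: mem_ref_int)
      ultimately show False using open_not_negligible[of "ref_int :: (real^'d) set"]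
        by (auto simp: ref_int_def open_box)
    qed
    have ridge: "F D ` b \<subseteq> ridges" if D: "D \<in> \<T>" and b: "\<exists>i j s t. i \<noteq> j \<and> b \<subseteq> ref_facet i s \<inter> ref_facet j t \<and> (s = - 1 \<or> s = 1) \<and> (t = - 1 \<or> t = 1)" for D b
    proof -
      obtain i j s t where *: "b \<subseteq> ref_facet i s \<inter> ref_facet j t" "(D, i, j, s, t) \<in> ridge_indices"
        using D b unfolding ridge_indices_def by auto
      then have "F D ` b \<subseteq> F D ` (ref_facet i s \<inter> ref_facet j t)" by blast
      also have "\<dots> \<subseteq> ridges" unfolding ridges_def using *(2) by blast
      finally show ?thesis .
    qed
    let ?ridge = "\<lambda>b. \<exists>i j s t. i \<noteq> j \<and> b \<subseteq> ref_facet i s \<inter> ref_facet j t \<and> (s = - 1 \<or> s = 1) \<and> (t = - 1 \<or> t = 1)"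
    note cases = face_of_ref_elem[OF a(1) False a(2)] face_of_ref_elem[OF a' \<open>a' \<noteq> {}\<close> \<open>a' \<noteq> ref_elem\<close>]
    show ?thesis
    proof (cases "?ridge a \<or> ?ridge a'")
      case True
      then show ?thesis using ridge[OF assms(1), of a] ridge[OF assms(2), of a'] EE EE' by argo
    next
      case nridge: False
      then have "\<exists>i s. (s = - 1 \<or> s = 1) \<and> a = ref_facet i s" "\<exists>i s. (s = - 1 \<or> s = 1) \<and> a' = ref_facet i s"
        using cases by argo+
      then obtain i s i' s' where "s = - 1 \<or> s = 1" "a = ref_facet i s" "s' = - 1 \<or> s' = 1" "a' = ref_facet i' s'"
        by blast
      then have "shared_facet E E' i s i' s' \<sigma>" using \<sigma> unfolding shared_facet_def by blast
      then show ?thesis by blast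
    qed
  qed (use EE in simp)
qed

text \<open>
  Otherwise the elements of \<open>R\<close> and the remaining elements form two closed sets \<open>A\<close> and \<open>B\<close> that cover
  \<open>\<Omega>\<close> and meet only in ridges.  Inside a ball in \<open>\<Omega>\<close>, any two points off the ridges are joined by two
  segments that avoid the ridges, because the cones over the ridges with apex at these points are null
  sets.  So the ball lies in \<open>A\<close> or in \<open>B\<close>, and \<open>\<Omega>\<close> would be the disjoint union of two nonempty open
  sets.
\<close>

lemma facet_connected:
  assumes R: "R \<subseteq> \<T>" "R \<noteq> {}"
    and closed: "\<And>E E' i s i' s' \<sigma>. E \<in> R \<Longrightarrow> E' \<in> \<T> \<Longrightarrow> E \<noteq> E' \<Longrightarrow> shared_facet E E' i s i' s' \<sigma> \<Longrightarrow> E' \<in> R"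
  shows "R = \<T>"
proof (rule ccontr)
  assume "R \<noteq> \<T>"
  define A B where "A = \<Union>R" and "B = \<Union>(\<T> - R)"
  have cl: "closed A" "closed B"
    using R(1) finite_subset[OF R(1) mesh(1)] mesh(1) compact_imp_closed[OF element_compact] unfolding A_def B_def
    by (intro closed_Union; blast)+
  have AB: "A \<union> B = closure \<Omega>" using R unfolding A_def B_def mesh(2)[symmetric] by blast
  have inter: "A \<inter> B \<subseteq> ridges"
  proof
    fix x assume "x \<in> A \<inter> B"
    then obtain E E' where E: "E \<in> R" "E' \<in> \<T>" "E' \<notin> R" "x \<in> E \<inter> E'" by (auto simp: A_def B_def)
    then have "E \<noteq> E'" by blast
    then show "x \<in> ridges" using intersection_cases[of E E'] closed[OF E(1,2)] E R by blast
  qed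
  have local: "ball x r \<subseteq> A \<or> ball x r \<subseteq> B" if ball: "ball x r \<subseteq> \<Omega>" "r > 0" for x r
  proof -
    have connect: "q \<in> C" if pq: "p \<in> ball x r - ridges" "q \<in> ball x r - ridges" and pC: "p \<in> C"
      and C: "closed C" "closed C'" "C \<union> C' = closure \<Omega>" "C \<inter> C' \<subseteq> ridges" for p q C C'
    proof -
      \<comment> \<open>Go from \<open>p\<close> to \<open>q\<close> through a point \<open>m\<close> outside the cones with apex \<open>p\<close> and \<open>q\<close>.\<close>
      define N where "N p = {p + t *\<^sub>R (y - p) | t y. y \<in> ridges}" for p
      have "negligible (N p \<union> N q)" unfolding N_def by (intro negligible_Un negligible_cone_ridges)
      then have "\<not> ball x r \<subseteq> N p \<union> N q"
        using open_not_negligible[of "ball x r"] ball(2) negligible_subset by (metis centre_in_ball empty_iff open_ball)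
      then obtain m where m: "m \<in> ball x r" "m \<notin> N p" "m \<notin> N q" by blast
      have seg: "closed_segment z m \<inter> ridges = {}" if z: "z \<notin> ridges" "m \<notin> N z" for z
      proof (rule ccontr)
        assume "closed_segment z m \<inter> ridges \<noteq> {}"
        then obtain y where "y \<in> ridges" "y \<in> closed_segment z m" by blast
        then obtain u where y: "y \<in> ridges" "y = (1 - u) *\<^sub>R z + u *\<^sub>R m" unfolding in_segment by blast
        have "u \<noteq> 0" using y z by auto
        have "y - z = u *\<^sub>R (m - z)" using y(2) by (simp add: algebra_simps)
        then have "m = z + (1 / u) *\<^sub>R (y - z)" using \<open>u \<noteq> 0\<close> by simp
        then show False using z(2) y(1) unfolding N_def by blast
      qed
      have side: "z' \<in> C" if "z \<in> C" "closed_segment z z' \<inter> ridges = {}" "z \<in> ball x r" "z' \<in> ball x r" for z z'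
      \<comment> \<open>The segment is connected and \<open>C\<close>, \<open>C'\<close> cut it into two disjoint closed pieces.\<close>
      proof (rule ccontr)
        assume "z' \<notin> C"
        have sub: "closed_segment z z' \<subseteq> ball x r" using that(3,4) by (intro closed_segment_subset convex_ball)
        then have "closed_segment z z' \<subseteq> C \<union> C'" using ball(1) closure_subset[of \<Omega>] C(3) by blast
        moreover have "C \<inter> C' \<inter> closed_segment z z' = {}" using C(4) that(2) by blast
        moreover have "z' \<in> C' \<inter> closed_segment z z'" using calculation(1) \<open>z' \<notin> C\<close> by auto
        moreover have "z \<in> C \<inter> closed_segment z z'" using that(1) by auto
        ultimately show False using connected_segment[of z z'] C(1,2) unfolding connected_closed by blast
      qed
      have "m \<in> C" using side[OF pC seg] pq m by blast
      moreover have "closed_segment m q \<inter> ridges = {}" using seg[of q] pq m by (simp add: closed_segment_commute)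
      ultimately show "q \<in> C" using side[of m q] pq m by blast
    qed
    have "ball x r - ridges \<noteq> {}"
      using open_not_negligible[of "ball x r"] ball(2) negligible_subset[OF negligible_ridges, of "ball x r"]
      by (metis Diff_eq_empty_iff centre_in_ball empty_iff open_ball)
    then obtain p where p: "p \<in> ball x r - ridges" by blast
    have whole: "ball x r \<subseteq> C" if sub: "ball x r - ridges \<subseteq> C" and "closed C" for C
    proof (rule ccontr)
      assume "\<not> ball x r \<subseteq> C"
      then have "ball x r \<inter> - C \<noteq> {}" by blast
      moreover have "open (ball x r \<inter> - C)" using \<open>closed C\<close> by (intro open_Int) auto
      moreover have "negligible (ball x r \<inter> - C)" by (rule negligible_subset[OF negligible_ridges]) (use sub in blast)
      ultimately show False using open_not_negligible by blast
    qed
    have "p \<in> A \<or> p \<in> B" using p ball(1) closure_subset[of \<Omega>] AB by blast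
    then show ?thesis
    proof
      assume "p \<in> A"
      then have "ball x r - ridges \<subseteq> A" using connect[OF p _ _ cl(1,2) AB inter] by blast
      then show ?thesis using whole cl by blast
    next
      assume "p \<in> B"
      have "B \<union> A = closure \<Omega>" "B \<inter> A \<subseteq> ridges" using AB inter by auto
      then have "ball x r - ridges \<subseteq> B" using connect[OF p _ \<open>p \<in> B\<close> cl(2,1)] by blast
      then show ?thesis using whole cl by blast
    qed
  qed
  have cover: "\<Omega> \<subseteq> interior A \<union> interior B"
  proof
    fix x assume "x \<in> \<Omega>"
    then obtain r where "r > 0" "ball x r \<subseteq> \<Omega>" using \<Omega>(1) open_contains_ball by blast
    then show "x \<in> interior A \<union> interior B" using local by (metis UnI1 UnI2 mem_interior)
  qed
  have disj: "interior A \<inter> interior B = {}"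
  proof (rule ccontr)
    assume "interior A \<inter> interior B \<noteq> {}"
    moreover have "negligible (interior A \<inter> interior B)"
      by (rule negligible_subset[OF negligible_ridges]) (use inter interior_subset in blast)
    ultimately show False using open_not_negligible[of "interior A \<inter> interior B"] by auto
  qed
  have meets: "interior (\<Union>Q) \<inter> \<Omega> \<noteq> {}" if Q: "Q \<subseteq> \<T>" "Q \<noteq> {}" for Q
  proof -
    obtain E where E: "E \<in> Q" using Q by blast
    then have "F E ` ref_int \<subseteq> interior (\<Union>Q)"
      using Q element_interior_subset element_interior_open by (intro interior_maximal) blast+
    then show ?thesis using element_interior_nonempty[of E] element_interior_subset_domain[of E] E Q by blast
  qed
  have "interior A \<inter> \<Omega> \<noteq> {}" "interior B \<inter> \<Omega> \<noteq> {}"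
    unfolding A_def B_def using meets R \<open>R \<noteq> \<T>\<close> by blast+
  then show False
    using connectedD[OF \<Omega>(3) open_interior open_interior, of A B] cover disj by blast
qed

section \<open>Piecewise fields and Green's formula on the mesh\<close>

text \<open>
  The function on the mesh with given pullbacks to the reference element; it vanishes outside the
  interiors of the elements, as the members of the discrete spaces do.
\<close>

definition glue :: "((real^'d) set \<Rightarrow> real^'d \<Rightarrow> 'b::real_vector) \<Rightarrow> real^'d \<Rightarrow> 'b" where
  "glue h y = (\<Sum>E\<in>\<T>. if y \<in> F E ` ref_int then h E (inv_into ref_elem (F E) y) else 0)"

lemma glue_at:
  assumes E: "E \<in> \<T>" and x: "x \<in> ref_int"
  shows "glue h (F E x) = h E x"
proof -
  have "glue h (F E x) = h E (inv_into ref_elem (F E) (F E x)) +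
      (\<Sum>E'\<in>\<T> - {E}. if F E x \<in> F E' ` ref_int then h E' (inv_into ref_elem (F E') (F E x)) else 0)"
    unfolding glue_def using mesh(1) E x by (subst sum.remove[of _ E]) auto
  also have "(\<Sum>E'\<in>\<T> - {E}. if F E x \<in> F E' ` ref_int then h E' (inv_into ref_elem (F E') (F E x)) else 0) = 0"
    using element_interiors_disjoint[OF E] x by (intro sum.neutral) auto
  finally show ?thesis using inv_into_f_f[OF F_bij(1)[OF E]] x ref_int_subset by auto
qed

lemma glue_outside: "y \<notin> mesh_interior \<T> F \<Longrightarrow> glue h y = 0"
  unfolding glue_def mesh_interior_def by (intro sum.neutral) auto

lemma square_integrable_glue:
  assumes h: "\<And>E. E \<in> \<T> \<Longrightarrow> continuous_on ref_elem (h E)"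
  shows "square_integrable (lebesgue_on \<Omega>) (glue h :: _ \<Rightarrow> 'b::euclidean_space)"
  unfolding square_integrable_def
proof
  have "(\<lambda>x. glue h x \<bullet> b) \<in> borel_measurable (lebesgue_on \<Omega>)" for b
  proof (rule borel_measurable_integrable, rule mesh_integral(1))
    show "continuous_on ref_elem (\<lambda>x. Jac (F E) x * (h E x \<bullet> b))" if "E \<in> \<T>" for E
      using that by (intro continuous_intros Jac_continuous h)
  qed (simp add: glue_at)
  then show "glue h \<in> borel_measurable (lebesgue_on \<Omega>)" by (subst borel_measurable_euclidean_space) simp
  show "integrable (lebesgue_on \<Omega>) (\<lambda>x. (norm (glue h x))\<^sup>2)"
  proof (rule mesh_integral(1))
    show "continuous_on ref_elem (\<lambda>x. Jac (F E) x * (norm (h E x))\<^sup>2)" if "E \<in> \<T>" for E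
      using that by (intro continuous_intros Jac_continuous h)
  qed (simp add: glue_at)
qed

end

lemma C_times_sum: "(\<And>i. i \<in> I \<Longrightarrow> C_times n (f i)) \<Longrightarrow> C_times n (\<lambda>x. \<Sum>i\<in>I. f i x)"
  by (induction I rule: infinite_finite_induct) (auto intro: C_times_add C_times_const)

lemma smooth_mult: "smooth f \<Longrightarrow> smooth g \<Longrightarrow> smooth (\<lambda>x. f x * g x)"
  by (simp add: smooth_def C_times_mult del: C_times.simps)

lemma smooth_partial: "smooth f \<Longrightarrow> smooth (partial i f)"
  unfolding smooth_def using C_times.simps(2) by blast

lemma smooth_compose:
  fixes \<Phi> :: "real^'d::finite \<Rightarrow> real^'d"
  assumes \<Phi>: "\<And>j. smooth (\<lambda>x. \<Phi> x $ j)" and \<phi>: "smooth \<phi>"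
  shows "smooth (\<lambda>x. \<phi> (\<Phi> x))"
proof -
  have d: "(\<lambda>x. \<Phi> x $ j) differentiable at x" for j x by (rule smooth_differentiable[OF \<Phi>])
  have cont: "continuous_on UNIV \<Phi>"
  proof -
    have "continuous_on UNIV (\<lambda>x. \<chi> j. \<Phi> x $ j)" by (intro continuous_on_vec_lambda smooth_continuous[OF \<Phi>])
    then show ?thesis by simp
  qed
  have "C_times n (\<lambda>x. \<phi> (\<Phi> x))" for n
    using \<phi>
  proof (induction n arbitrary: \<phi>)
    case 0
    then show ?case using continuous_on_compose2[OF smooth_continuous[of \<phi> UNIV] cont] by simp
  next
    case (Suc n)
    have part: "partial i (\<lambda>x. \<phi> (\<Phi> x)) = (\<lambda>x. \<Sum>j\<in>UNIV. partial j \<phi> (\<Phi> x) * partial i (\<lambda>x. \<Phi> x $ j) x)" for i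
      using partial_compose(2)[OF d smooth_differentiable[OF Suc.prems]]
      by (simp add: fun_eq_iff smooth_map_has_derivative(2)[OF d])
    have "C_times n (\<lambda>x. \<Sum>j\<in>UNIV. partial j \<phi> (\<Phi> x) * partial i (\<lambda>x. \<Phi> x $ j) x)" for i
      using smooth_partial[OF \<Phi>] smooth_partial[OF Suc.prems]
      by (intro C_times_sum C_times_mult Suc.IH) (auto simp: smooth_def simp del: C_times.simps)
    then show ?case
      using part partial_compose(1)[OF d smooth_differentiable[OF Suc.prems]] by simp
  qed
  then show ?thesis by (simp add: smooth_def)
qed

context quad_mesh begin

lemma continuous_piola:
  assumes E: "E \<in> \<T>" and r: "\<And>i. smooth (\<lambda>x. r x $ i)"
  shows "continuous_on ref_elem (piola (F E) r)"
  unfolding piola_def[abs_def] matrix_vector_mult_def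
  using Jac_pos[OF E] by (intro continuous_intros Jac_continuous[OF E] DF_continuous[OF E] smooth_continuous[OF r]) force

definition div_field :: "(real^'d \<Rightarrow> real^'d) \<Rightarrow> real^'d \<Rightarrow> real" where
  "div_field r x = (\<Sum>i\<in>UNIV. partial i (\<lambda>x. r x $ i) x)"

lemma continuous_div_field: "(\<And>i. smooth (\<lambda>x. r x $ i)) \<Longrightarrow> continuous_on S (div_field r)"
  unfolding div_field_def[abs_def] by (intro continuous_intros smooth_continuous_partial)

text \<open>
  The total flux of \<open>\<phi> * r\<close> out of all elements, pulled back to the reference facets, where the
  Piola transformation preserves fluxes.
\<close>

definition boundary_flux :: "((real^'d) set \<Rightarrow> real^'d \<Rightarrow> real^'d) \<Rightarrow> (real^'d \<Rightarrow> real) \<Rightarrow> real" where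
  "boundary_flux r \<phi> = (\<Sum>E\<in>\<T>. \<Sum>i\<in>UNIV.
     facet_integral i 1 (\<lambda>x. \<phi> (F E x) * r E x $ i) - facet_integral i (- 1) (\<lambda>x. \<phi> (F E x) * r E x $ i))"

abbreviation glue_field :: "((real^'d) set \<Rightarrow> real^'d \<Rightarrow> real^'d) \<Rightarrow> real^'d \<Rightarrow> real^'d" where
  "glue_field r \<equiv> glue (\<lambda>E. piola (F E) (r E))"

abbreviation glue_div :: "((real^'d) set \<Rightarrow> real^'d \<Rightarrow> real^'d) \<Rightarrow> real^'d \<Rightarrow> real" where
  "glue_div r \<equiv> glue (\<lambda>E x. div_field (r E) x / Jac (F E) x)"

lemma square_integrable_glue_field:
  assumes r: "\<And>E i. E \<in> \<T> \<Longrightarrow> smooth (\<lambda>x. r E x $ i)"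
  shows "square_integrable (lebesgue_on \<Omega>) (glue_field r)" "square_integrable (lebesgue_on \<Omega>) (glue_div r)"
proof -
  show "square_integrable (lebesgue_on \<Omega>) (glue_field r)"
    by (intro square_integrable_glue continuous_piola r)
  have "continuous_on ref_elem (\<lambda>x. div_field (r E) x / Jac (F E) x)" if "E \<in> \<T>" for E
    using Jac_pos[OF that] by (intro continuous_intros continuous_div_field r that Jac_continuous) force
  then show "square_integrable (lebesgue_on \<Omega>) (glue_div r)" by (intro square_integrable_glue)
qed

text \<open>
  Under the Piola transformation, \<open>v \<bullet> grad \<phi> + div v * \<phi>\<close> times the Jacobian is the divergence of
  \<open>\<phi> \<circ> F E\<close> times the reference field, so the Jacobian drops out and the reference element can be
  integrated by parts.
\<close>

lemma green:
  assumes r: "\<And>E i. E \<in> \<T> \<Longrightarrow> smooth (\<lambda>x. r E x $ i)" and \<phi>: "smooth \<phi>"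
  shows "(LINT x|lebesgue_on \<Omega>. glue_field r x \<bullet> grad \<phi> x + glue_div r x * \<phi> x) = boundary_flux r \<phi>"
proof -
  define u where "u E i x = \<phi> (F E x) * r E x $ i" for E i x
  have u: "smooth (u E i)" if "E \<in> \<T>" for E i
    unfolding u_def by (rule smooth_mult[OF smooth_compose[OF smooth_F[OF that] \<phi>] r[OF that]])
  have "(LINT x|lebesgue_on \<Omega>. glue_field r x \<bullet> grad \<phi> x + glue_div r x * \<phi> x) =
      (\<Sum>E\<in>\<T>. LINT x|lebesgue_on ref_elem. (\<Sum>i\<in>UNIV. partial i (u E i) x))"
  proof (rule mesh_integral(2))
    show "continuous_on ref_elem (\<lambda>x. \<Sum>i\<in>UNIV. partial i (u E i) x)" if "E \<in> \<T>" for E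
      by (intro continuous_intros smooth_continuous_partial u that)
    fix E x assume E: "E \<in> \<T>" and x: "x \<in> (ref_int :: (real^'d) set)"
    have J: "Jac (F E) x \<noteq> 0" using Jac_pos[OF E, of x] x ref_int_subset by auto
    have dF: "(\<lambda>x. F E x $ j) differentiable at x" for j x by (rule smooth_differentiable[OF smooth_F[OF E]])
    have "partial i (u E i) x = (\<Sum>j\<in>UNIV. partial j \<phi> (F E x) * DF (F E) x $ j $ i) * r E x $ i +
        \<phi> (F E x) * partial i (\<lambda>x. r E x $ i) x" for i
      unfolding u_def
      using partial_mult[OF partial_compose(1)[OF dF smooth_differentiable[OF \<phi>]] smooth_differentiable[OF r[OF E]]]
        partial_compose(2)[OF dF smooth_differentiable[OF \<phi>]] by simp
    then have "(\<Sum>i\<in>UNIV. partial i (u E i) x) =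
        (\<Sum>i\<in>UNIV. \<Sum>j\<in>UNIV. partial j \<phi> (F E x) * DF (F E) x $ j $ i * r E x $ i) + \<phi> (F E x) * div_field (r E) x"
      by (simp add: sum.distrib sum_distrib_left sum_distrib_right div_field_def)
    also have "(\<Sum>i\<in>UNIV. \<Sum>j\<in>UNIV. partial j \<phi> (F E x) * DF (F E) x $ j $ i * r E x $ i) =
        (DF (F E) x *v r E x) \<bullet> grad \<phi> (F E x)"
    proof -
      have "(DF (F E) x *v r E x) \<bullet> grad \<phi> (F E x) =
          (\<Sum>j\<in>UNIV. (\<Sum>i\<in>UNIV. DF (F E) x $ j $ i * r E x $ i) * partial j \<phi> (F E x))"
        by (simp add: inner_vec_def matrix_vector_mult_def grad_def)
      also have "\<dots> = (\<Sum>j\<in>UNIV. \<Sum>i\<in>UNIV. partial j \<phi> (F E x) * DF (F E) x $ j $ i * r E x $ i)"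
        unfolding sum_distrib_right
        by (rule sum.cong[OF refl], rule sum.cong[OF refl]) (simp add: mult.commute mult.left_commute)
      also have "\<dots> = (\<Sum>i\<in>UNIV. \<Sum>j\<in>UNIV. partial j \<phi> (F E x) * DF (F E) x $ j $ i * r E x $ i)"
        by (rule sum.swap)
      finally show ?thesis by (rule sym)
    qed
    also have "\<dots> = Jac (F E) x * (piola (F E) (r E) x \<bullet> grad \<phi> (F E x))"
      using J by (simp add: piola_def)
    finally show "(\<Sum>i\<in>UNIV. partial i (u E i) x) =
        Jac (F E) x * (glue_field r (F E x) \<bullet> grad \<phi> (F E x) + glue_div r (F E x) * \<phi> (F E x))"
      using J by (simp add: glue_at[OF E x] distrib_left)
  qed
  also have "\<dots> = boundary_flux r \<phi>"
    unfolding boundary_flux_def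
  proof (rule sum.cong[OF refl])
    fix E assume E: "E \<in> \<T>"
    have "(LINT x|lebesgue_on ref_elem. (\<Sum>i\<in>UNIV. partial i (u E i) x)) =
        (\<Sum>i\<in>UNIV. LINT x|lebesgue_on ref_elem. partial i (u E i) x)"
      by (intro Bochner_Integration.integral_sum integrable_ref_continuous smooth_continuous_partial u E)
    also have "\<dots> = (\<Sum>i\<in>UNIV. facet_integral i 1 (u E i) - facet_integral i (- 1) (u E i))"
      by (intro sum.cong[OF refl] ref_elem_partial_integral smooth_differentiable smooth_continuous_partial u E)
    finally show "(LINT x|lebesgue_on ref_elem. (\<Sum>i\<in>UNIV. partial i (u E i) x)) =
        (\<Sum>i\<in>UNIV. facet_integral i 1 (\<lambda>x. \<phi> (F E x) * r E x $ i) - facet_integral i (- 1) (\<lambda>x. \<phi> (F E x) * r E x $ i))"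
      by (simp add: u_def[abs_def])
  qed
  finally show ?thesis .
qed

lemma glue_field_weak_div:
  assumes r: "\<And>E i. E \<in> \<T> \<Longrightarrow> smooth (\<lambda>x. r E x $ i)"
    and flux: "\<And>\<phi>. smooth \<phi> \<Longrightarrow> fun_support \<phi> \<subseteq> \<Omega> \<Longrightarrow> boundary_flux r \<phi> = 0"
  shows "has_weak_div \<Omega> (glue_field r) (glue_div r)"
  unfolding has_weak_div_def
proof (intro conjI allI impI)
  show "square_integrable (lebesgue_on \<Omega>) (glue_div r)" by (rule square_integrable_glue_field(2)[OF r])
  fix \<phi> :: "real^'d \<Rightarrow> real"
  assume \<phi>: "smooth \<phi> \<and> compact (fun_support \<phi>) \<and> fun_support \<phi> \<subseteq> \<Omega>"
  have "integrable (lebesgue_on \<Omega>) (\<lambda>x. glue_field r x \<bullet> grad \<phi> x)"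
    "integrable (lebesgue_on \<Omega>) (\<lambda>x. glue_div r x * \<phi> x)"
    using \<phi> square_integrable_glue_field[OF r] \<Omega> by (auto intro: integrable_inner_smooth_grad integrable_mult_smooth)
  then have "(LINT x|lebesgue_on \<Omega>. glue_field r x \<bullet> grad \<phi> x) + (LINT x|lebesgue_on \<Omega>. glue_div r x * \<phi> x) = 0"
    using green[of r \<phi>, OF r] flux[of \<phi>] \<phi> by simp
  then show "(LINT x|lebesgue_on \<Omega>. glue_field r x \<bullet> grad \<phi> x) = - (LINT x|lebesgue_on \<Omega>. glue_div r x * \<phi> x)"
    by simp
qed

text \<open>
  Test functions supported in \<open>\<Omega>\<close> determine the weak divergence, and those that vanish near \<open>\<Gamma>\<close> encode
  the vanishing normal trace on the rest of the boundary; both reduce to the total flux.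
\<close>

lemma glue_field_V_space:
  assumes r: "\<And>E i. E \<in> \<T> \<Longrightarrow> smooth (\<lambda>x. r E x $ i)"
    and flux: "\<And>\<phi>. smooth \<phi> \<Longrightarrow> fun_support \<phi> \<subseteq> \<Omega> \<or> fun_support \<phi> \<inter> closure \<Gamma> = {} \<Longrightarrow> boundary_flux r \<phi> = 0"
  shows "glue_field r \<in> V_space \<Omega> \<Gamma>" "AE x in lebesgue_on \<Omega>. weak_div \<Omega> (glue_field r) x = glue_div r x"
proof -
  have wd: "has_weak_div \<Omega> (glue_field r) (glue_div r)"
    by (rule glue_field_weak_div[OF r]) (use flux in auto)
  note w = weak_div_AE_eq[OF \<Omega>(1,2) wd]
  show AE: "AE x in lebesgue_on \<Omega>. weak_div \<Omega> (glue_field r) x = glue_div r x" by (rule w(2))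
  show "glue_field r \<in> V_space \<Omega> \<Gamma>"
    unfolding V_space_def H_div_def
  proof (intro CollectI conjI allI impI)
    show "square_integrable (lebesgue_on \<Omega>) (glue_field r)" by (rule square_integrable_glue_field(1)[OF r])
    show "\<exists>w. has_weak_div \<Omega> (glue_field r) w" using wd by blast
    fix \<phi> :: "real^'d \<Rightarrow> real"
    assume \<phi>: "smooth \<phi> \<and> fun_support \<phi> \<inter> closure \<Gamma> = {}"
    have i: "integrable (lebesgue_on \<Omega>) (\<lambda>x. glue_field r x \<bullet> grad \<phi> x)"
      "integrable (lebesgue_on \<Omega>) (\<lambda>x. glue_div r x * \<phi> x)"
      "integrable (lebesgue_on \<Omega>) (\<lambda>x. weak_div \<Omega> (glue_field r) x * \<phi> x)"
      using \<phi> square_integrable_glue_field[OF r] \<Omega> has_weak_div_square_integrable[OF w(1)]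
      by (auto intro: integrable_inner_smooth_grad integrable_mult_smooth)
    have "(LINT x|lebesgue_on \<Omega>. glue_field r x \<bullet> grad \<phi> x + weak_div \<Omega> (glue_field r) x * \<phi> x) =
        (LINT x|lebesgue_on \<Omega>. glue_field r x \<bullet> grad \<phi> x + glue_div r x * \<phi> x)"
    proof (rule integral_cong_AE)
      show "AE x in lebesgue_on \<Omega>. glue_field r x \<bullet> grad \<phi> x + weak_div \<Omega> (glue_field r) x * \<phi> x =
          glue_field r x \<bullet> grad \<phi> x + glue_div r x * \<phi> x"
        using AE by eventually_elim simp
    qed (use i in \<open>auto intro!: borel_measurable_add\<close>)
    also have "\<dots> = 0" using green[of r \<phi>, OF r] flux[of \<phi>] \<phi> by simp
    finally show "(LINT x|lebesgue_on \<Omega>. glue_field r x \<bullet> grad \<phi> x + weak_div \<Omega> (glue_field r) x * \<phi> x) = 0" .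
  qed
qed

end

section \<open>Test fields\<close>

lemma RT_space_subset_V_ref:
  fixes \<iota> :: "nat \<Rightarrow> 'd::finite"
  shows "RT_space (k - 1) \<subseteq> V_ref \<iota> k"
proof
  fix r :: "real^'d \<Rightarrow> real^'d" assume r: "r \<in> RT_space (k - 1)"
  have "(\<lambda>x. \<Sum>i\<in>(UNIV :: 'd set). curl_x_cross \<iota> (0 :: real^'d \<Rightarrow> real^'d) x) \<in> B_tilde \<iota> k"
    unfolding B_tilde_def B_space_def using fun_space.span_zero
    by (intro CollectI exI[of _ "\<lambda>_. 0"]) auto
  then have "(\<lambda>x. 0) \<in> B_tilde \<iota> k" by (simp add: curl_x_cross_zero)
  then show "r \<in> V_ref \<iota> k"
    unfolding V_ref_def using r by (intro CollectI exI[of _ r] exI[of _ "\<lambda>x. 0"]) simp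
qed

text \<open>
  Multiplication by \<open>x i\<close> restores the degree that the derivative has lost.
\<close>

lemma Qpoly_partial:
  assumes "f \<in> Qpoly m"
  shows "partial i f \<in> Qpoly m" "(\<lambda>x. x $ i * partial i f x) \<in> Qpoly m"
proof -
  have "(\<forall>x. f differentiable at x) \<and> partial i f \<in> Qpoly m \<and> (\<lambda>x. x $ i * partial i f x) \<in> Qpoly m"
    using assms unfolding Qpoly_def
  proof (induction rule: fun_space.span_induct_alt)
    case base
    have "partial i (\<lambda>x. 0) = (\<lambda>x. 0)" by auto
    then show ?case using fun_space.span_zero by (simp add: zero_fun_def)
  next
    case (step c g f)
    then obtain \<alpha> where g: "g = monomial \<alpha>" and \<alpha>: "\<And>j. \<alpha> j \<le> m" by blast
    let ?S = "{monomial \<alpha> | \<alpha>. \<forall>i. \<alpha> i \<le> m}"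
    have d: "(fun_scale c g + f) = (\<lambda>x. c * g x + f x)" by (simp add: fun_scale_def plus_fun_def)
    have diff: "(\<lambda>x. c * g x + f x) differentiable at x" for x
      using step(2) differentiable_monomial[of \<alpha> x] by (simp add: g differentiable_mult)
    have part: "partial i (\<lambda>x. c * g x + f x) = (\<lambda>x. c * partial i g x + partial i f x)"
      using step(2) differentiable_monomial[of \<alpha>]
      by (simp add: fun_eq_iff g partial_add partial_cmult differentiable_mult)
    have m1: "monomial (\<alpha>(i := \<alpha> i - 1)) \<in> fun_space.span ?S"
    proof (rule fun_space.span_base)
      have "\<forall>j. (\<alpha>(i := \<alpha> i - 1)) j \<le> m" using \<alpha> by (auto intro: le_trans[OF diff_le_self])
      then show "monomial (\<alpha>(i := \<alpha> i - 1)) \<in> ?S" by blast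
    qed
    have m2: "monomial \<alpha> \<in> fun_space.span ?S" using \<alpha> by (intro fun_space.span_base) blast
    have e1: "(\<lambda>x. c * partial i g x + partial i f x) =
        fun_scale (c * real (\<alpha> i)) (monomial (\<alpha>(i := \<alpha> i - 1))) + partial i f"
      by (simp add: g partial_monomial fun_scale_def plus_fun_def mult.assoc)
    have m3: "x $ i * (real (\<alpha> i) * monomial (\<alpha>(i := \<alpha> i - 1)) x) = real (\<alpha> i) * monomial \<alpha> x" for x
      using monomial_Suc[of "\<alpha>(i := \<alpha> i - 1)" i x] by (cases "\<alpha> i = 0") (auto simp: fun_upd_idem)
    have "x $ i * (c * partial i g x + partial i f x) = c * real (\<alpha> i) * monomial \<alpha> x + x $ i * partial i f x" for x
      unfolding g partial_monomial distrib_left mult.left_commute[of "x $ i" c] m3 by simp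
    then have e2: "(\<lambda>x. x $ i * (c * partial i g x + partial i f x)) =
        fun_scale (c * real (\<alpha> i)) (monomial \<alpha>) + (\<lambda>x. x $ i * partial i f x)"
      by (simp add: fun_scale_def plus_fun_def)
    have "(\<lambda>x. c * partial i g x + partial i f x) \<in> fun_space.span ?S"
      unfolding e1 using step(2) m1 by (intro fun_space.span_add fun_space.span_scale) auto
    moreover have "(\<lambda>x. x $ i * (c * partial i g x + partial i f x)) \<in> fun_space.span ?S"
      unfolding e2 using step(2) m2 by (intro fun_space.span_add fun_space.span_scale) auto
    ultimately show ?case unfolding d part using diff by blast
  qed
  then show "partial i f \<in> Qpoly m" "(\<lambda>x. x $ i * partial i f x) \<in> Qpoly m" by auto
qed

lemma Qpoly_cmult: "f \<in> Qpoly m \<Longrightarrow> (\<lambda>x. c * f x) \<in> Qpoly m"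
  using fun_space.span_scale[of f _ c] by (simp add: Qpoly_def fun_scale_def)

lemma Qpoly_const: "(\<lambda>x. c) \<in> Qpoly m"
proof -
  have "monomial (\<lambda>_. 0) \<in> (Qpoly m :: (real^'d::finite \<Rightarrow> real) set)"
    unfolding Qpoly_def by (rule fun_space.span_base) blast
  then have "(\<lambda>x. c * monomial (\<lambda>_. 0) x) \<in> (Qpoly m :: (real^'d \<Rightarrow> real) set)" by (rule Qpoly_cmult)
  then show ?thesis by (simp add: monomial_def)
qed

text \<open>
  The weight \<open>1 - (x i)^2\<close> removes the normal component on the facets, and since \<open>x i * partial i f\<close> has
  the same degree as \<open>f\<close>, the field is still a Raviart-Thomas field.
\<close>

definition grad_bubble :: "(real^'d::finite \<Rightarrow> real) \<Rightarrow> real^'d \<Rightarrow> real^'d" where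
  "grad_bubble f x = (\<chi> i. (1 - (x $ i)\<^sup>2) * partial i f x)"

lemma grad_bubble_RT: "f \<in> Qpoly m \<Longrightarrow> grad_bubble f \<in> RT_space m"
  unfolding RT_space_def
proof (intro CollectI exI conjI allI)
  assume f: "f \<in> Qpoly m"
  show "grad_bubble f = (\<lambda>x. \<chi> i. partial i f x + x $ i * (- 1 * (x $ i * partial i f x)))"
    by (simp add: grad_bubble_def fun_eq_iff power2_eq_square algebra_simps)
  show "partial i f \<in> Qpoly m" "(\<lambda>x. - 1 * (x $ i * partial i f x)) \<in> Qpoly m" for i
    by (rule Qpoly_partial[OF f], rule Qpoly_cmult[OF Qpoly_partial(2)[OF f]])
qed

text \<open>
  The lowest-order Raviart-Thomas field whose outward normal component is \<open>c\<close> on the facet \<open>x i = s\<close> and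
  zero on all other facets.
\<close>

definition facet_field :: "real \<Rightarrow> 'd::finite \<Rightarrow> real \<Rightarrow> real^'d \<Rightarrow> real^'d" where
  "facet_field c i s x = axis i (c * (s + x $ i) / 2)"

lemma facet_field_nth: "facet_field c i s x $ j = (if j = i then c * (s + x $ i) / 2 else 0)"
  by (simp add: facet_field_def axis_def)

lemma facet_field_RT: "facet_field c i s \<in> RT_space m"
  unfolding RT_space_def
proof (intro CollectI exI conjI allI)
  show "facet_field c i s = (\<lambda>x. \<chi> j. (if j = i then c * s / 2 else 0) + x $ j * (if j = i then c / 2 else 0))"
    by (auto simp: fun_eq_iff vec_eq_iff facet_field_nth field_simps)
qed (rule Qpoly_const)+

lemma zero_RT: "(\<lambda>x. 0) \<in> (RT_space m :: (real^'d::finite \<Rightarrow> real^'d) set)"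
proof -
  have "facet_field 0 i s = (\<lambda>x. 0)" for i :: 'd and s by (simp add: fun_eq_iff vec_eq_iff facet_field_nth)
  then show ?thesis using facet_field_RT[of 0 "undefined :: 'd" 0 m] by simp
qed

lemma smooth_coordinate: "smooth (\<lambda>x::real^'d::finite. x $ i)"
proof -
  have "(\<lambda>x::real^'d. x $ i) = monomial ((\<lambda>_. 0)(i := Suc 0))"
    using monomial_Suc[of "\<lambda>_. 0" i] by (auto simp: fun_eq_iff monomial_def[of "\<lambda>_. 0"])
  then show ?thesis using smooth_polynomial[OF fun_space.span_base[OF rangeI]] by metis
qed

lemma smooth_const: "smooth (\<lambda>x. c)"
  by (simp add: smooth_def C_times_const del: C_times.simps)

lemma smooth_add: "smooth f \<Longrightarrow> smooth g \<Longrightarrow> smooth (\<lambda>x. f x + g x)"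
  by (simp add: smooth_def C_times_add del: C_times.simps)

lemma smooth_grad_bubble: "smooth f \<Longrightarrow> smooth (\<lambda>x. grad_bubble f x $ i)"
  using smooth_mult[OF smooth_add[OF smooth_const[of 1] smooth_mult[OF smooth_const[of "- 1"] smooth_mult[OF smooth_coordinate smooth_coordinate]]] smooth_partial, of f i i i]
  by (simp add: grad_bubble_def power2_eq_square)

lemma smooth_facet_field: "smooth (\<lambda>x. facet_field c i s x $ j)"
  using smooth_mult[OF smooth_const[of "c / 2"] smooth_add[OF smooth_const[of s] smooth_coordinate[of i]]] smooth_const[of 0]
  by (cases "j = i") (simp_all add: facet_field_nth)

lemma has_derivative_grad:
  fixes f :: "real^'d::finite \<Rightarrow> real"
  assumes "f differentiable at x"
  shows "(f has_derivative (\<lambda>h. grad f x \<bullet> h)) (at x)"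
proof -
  have d: "(f has_derivative frechet_derivative f (at x)) (at x)" using assms by (simp add: frechet_derivative_works)
  have lin: "linear (frechet_derivative f (at x))" by (rule has_derivative_linear[OF d])
  have "frechet_derivative f (at x) h = grad f x \<bullet> h" for h
  proof -
    have "h = (\<Sum>i\<in>UNIV. h $ i *\<^sub>R axis i 1)"
      by (simp add: vec_eq_iff axis_def if_distrib cong: if_cong)
    then have "frechet_derivative f (at x) h = frechet_derivative f (at x) (\<Sum>i\<in>UNIV. h $ i *\<^sub>R axis i 1)"
      by (rule arg_cong)
    also have "\<dots> = (\<Sum>i\<in>UNIV. h $ i * partial i f x)"
      unfolding linear_sum[OF lin] by (simp add: linear_cmul[OF lin] partial_def)
    finally show ?thesis by (simp add: inner_vec_def grad_def mult.commute)
  qed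
  then have "frechet_derivative f (at x) = (\<lambda>h. grad f x \<bullet> h)" by (rule ext)
  then show ?thesis using d by simp
qed

lemma measure_ref_int_pos: "measure lborel (ref_int :: (real^'d::finite) set) > 0"
proof -
  have "emeasure lborel (ref_int :: (real^'d) set) = ennreal (\<Prod>i\<in>(UNIV :: 'd set). 2)"
    unfolding ref_int_def by (subst emeasure_box_cart) auto
  then show ?thesis by (simp add: measure_def)
qed

lemma ref_integral_zero_imp_zero:
  fixes g :: "real^'d::finite \<Rightarrow> real"
  assumes g: "continuous_on UNIV g" and nonneg: "\<And>x. x \<in> ref_elem \<Longrightarrow> g x \<ge> 0"
    and zero: "(LINT x|lebesgue_on ref_elem. g x) = 0" and x: "x \<in> ref_int"
  shows "g x = 0"
proof (rule ccontr)
  assume "g x \<noteq> 0"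
  have gr: "continuous_on ref_elem g" using g by (rule continuous_on_subset) simp
  have nn: "AE x in lborel. 0 \<le> indicator ref_int x * g x"
    using nonneg ref_int_subset by (intro AE_I2) (auto simp: indicator_def)
  have "(LINT x|lborel. indicator ref_int x * g x) = 0" using ref_integral_continuous(3)[OF gr] zero by simp
  then have AE: "AE x in lborel. indicator ref_int x * g x = 0"
    using integral_nonneg_eq_0_iff_AE[OF ref_integral_continuous(2)[OF gr] nn] by simp
  define N where "N = ref_int \<inter> {x. g x \<noteq> 0}"
  have "open N" unfolding N_def using g by (intro open_Int open_Collect_neq continuous_intros) (simp_all add: ref_int_def open_box)
  moreover have "negligible N"
  proof -
    have "AE x in lborel. x \<notin> N" using AE by eventually_elim (auto simp: N_def)
    then have "N \<in> null_sets lborel" using \<open>open N\<close> by (subst AE_iff_null_sets) auto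
    then show ?thesis by (simp add: negligible_iff_null_sets null_sets_completionI)
  qed
  moreover have "x \<in> N" using x \<open>g x \<noteq> 0\<close> by (simp add: N_def)
  ultimately show False using open_not_negligible by blast
qed

lemma ref_integral_zero:
  fixes f :: "real^'d::finite \<Rightarrow> real"
  assumes "\<And>x. x \<in> ref_int \<Longrightarrow> f x = 0"
  shows "(LINT x|lebesgue_on ref_elem. f x) = 0"
proof (rule integral_eq_zero_AE)
  have "AE x in lebesgue. x \<in> ref_elem \<longleftrightarrow> x \<in> (ref_int :: (real^'d) set)"
    by (rule AE_completion[OF ref_boundary_null])
  then have "AE x in lebesgue. x \<in> ref_elem \<longrightarrow> f x = 0"
    by eventually_elim (simp add: assms)
  then show "AE x in lebesgue_on ref_elem. f x = 0"
    by (subst AE_restrict_space_iff) (auto simp: ref_elem_def)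
qed

lemma facet_field_flux:
  assumes s: "s = - 1 \<or> s = 1"
  shows "(\<Sum>j\<in>UNIV. facet_integral j 1 (\<lambda>x. \<psi> x * facet_field c i s x $ j) -
      facet_integral j (- 1) (\<lambda>x. \<psi> x * facet_field c i s x $ j)) = c * facet_integral i s \<psi>"
proof -
  have fi: "facet_integral j t (\<lambda>x. \<psi> x * facet_field c i s x $ j) =
      (if j = i then c * (s + t) / 2 * facet_integral i t \<psi> else 0)" for j t
    by (auto simp: facet_integral_def facet_field_nth mult.commute[of "\<psi> _"])
  have "(\<Sum>j\<in>UNIV. facet_integral j 1 (\<lambda>x. \<psi> x * facet_field c i s x $ j) -
      facet_integral j (- 1) (\<lambda>x. \<psi> x * facet_field c i s x $ j)) =
      (\<Sum>j\<in>UNIV. if j = i then c * (s + 1) / 2 * facet_integral i 1 \<psi> - c * (s - 1) / 2 * facet_integral i (- 1) \<psi> else 0)"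
    by (rule sum.cong) (auto simp: fi)
  also have "\<dots> = c * facet_integral i s \<psi>" using s by auto
  finally show ?thesis .
qed

lemma convex_ref_facet: "convex (ref_facet i s)"
  unfolding ref_facet_def convex_def mem_ref_elem
proof (clarsimp, safe)
  fix x y :: "real^'a::finite" and u v :: real
  assume *: "\<forall>j. - 1 \<le> x $ j \<and> x $ j \<le> 1" "\<forall>j. - 1 \<le> y $ j \<and> y $ j \<le> 1" "0 \<le> u" "0 \<le> v" "u + v = 1"
  fix j
  show "- 1 \<le> u * x $ j + v * y $ j" "u * x $ j + v * y $ j \<le> 1"
    using * convex_bound_le[of "x $ j" 1 "y $ j" u v] convex_bound_le[of "- x $ j" 1 "- y $ j" u v]
    by (auto simp: minus_le_iff)
next
  fix x y :: "real^'a::finite" and u v :: real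
  assume "u + v = 1" "y $ i = x $ i"
  then show "u * x $ i + v * x $ i = x $ i" by (simp add: distrib_right[symmetric])
qed

lemma to_facet_rel_interior:
  assumes x: "x \<in> ref_int" and s: "s = - 1 \<or> s = 1"
  shows "to_facet i s x \<in> rel_interior (ref_facet i s)"
proof -
  define T where "T = {y :: real^'a::finite. \<forall>j\<in>UNIV - {i}. - 1 < y $ j \<and> y $ j < 1}"
  have "T = (\<Inter>j\<in>UNIV - {i}. {y. - 1 < y $ j \<and> y $ j < 1})" by (auto simp: T_def)
  also have "open \<dots>"
    by (intro open_INT ballI open_Collect_conj open_Collect_less continuous_intros) simp
  finally have "open T" .
  have "affine hull (ref_facet i s) \<subseteq> {y :: real^'a. axis i 1 \<bullet> y = s}"
  proof (rule hull_minimal)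
    show "affine {y :: real^'a. axis i 1 \<bullet> y = s}" by (rule affine_hyperplane)
  qed (auto simp: ref_facet_def inner_axis')
  then have hull: "y $ i = s" if "y \<in> affine hull (ref_facet i s)" for y :: "real^'a"
    using that by (auto simp: inner_axis')
  have "T \<inter> affine hull (ref_facet i s) \<subseteq> ref_facet i s"
  proof
    fix y assume y: "y \<in> T \<inter> affine hull (ref_facet i s)"
    have "- 1 \<le> y $ j \<and> y $ j \<le> 1" for j
      using y hull[of y] s by (cases "j = i") (auto simp: T_def less_imp_le)
    then show "y \<in> ref_facet i s" using y hull[of y] by (auto simp: ref_facet_def mem_ref_elem)
  qed
  moreover have "to_facet i s x \<in> T \<inter> ref_facet i s"
    using x s by (auto simp: T_def mem_ref_int ref_facet_def mem_ref_elem less_imp_le)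
  ultimately show ?thesis using \<open>open T\<close> unfolding mem_rel_interior by blast
qed

context quad_mesh begin

section \<open>Injectivity of the discrete gradient\<close>

text \<open>
  The Jacobian in the divergence of a Piola transform cancels the one from the change of variables,
  so orthogonality becomes a statement about the reference fields only.
\<close>

lemma glue_field_test:
  assumes k: "w \<in> W_h k \<Omega> \<T> F"
    and WH: "\<forall>E\<in>\<T>. wh E \<in> Qpoly (k - 1) \<and> corresponds_W (F E) w (wh E)"
    and orth: "\<forall>v\<in>V_h \<iota> k \<Omega> \<Gamma> \<T> F. L2_inner \<Omega> (weak_div \<Omega> v) w = 0"
    and r: "\<And>E i. E \<in> \<T> \<Longrightarrow> smooth (\<lambda>x. r E x $ i)" "\<And>E. E \<in> \<T> \<Longrightarrow> r E \<in> RT_space (k - 1)"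
    and flux: "\<And>\<phi>. smooth \<phi> \<Longrightarrow> fun_support \<phi> \<subseteq> \<Omega> \<or> fun_support \<phi> \<inter> closure \<Gamma> = {} \<Longrightarrow> boundary_flux r \<phi> = 0"
  shows "(\<Sum>E\<in>\<T>. LINT x|lebesgue_on ref_elem. div_field (r E) x * wh E x) = 0"
proof -
  have wh: "E \<in> \<T> \<Longrightarrow> wh E \<in> Qpoly (k - 1)" "E \<in> \<T> \<Longrightarrow> corresponds_W (F E) w (wh E)" for E
    using WH by blast+
  note V = glue_field_V_space[of r \<Gamma>, OF r(1) flux]
  have "glue_field r \<in> V_h \<iota> k \<Omega> \<Gamma> \<T> F"
    unfolding V_h_def
  proof (intro CollectI conjI ballI allI impI)
    show "glue_field r \<in> V_space \<Omega> \<Gamma>" by (rule V(1))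
    show "\<exists>v'\<in>V_ref \<iota> k. corresponds_V (F E) (glue_field r) v'" if "E \<in> \<T>" for E
      using r(2)[OF that] RT_space_subset_V_ref by (intro bexI[of _ "r E"]) (auto simp: corresponds_V_def glue_at[OF that])
  qed (rule glue_outside)
  then have "0 = L2_inner \<Omega> (weak_div \<Omega> (glue_field r)) w" using orth by simp
  also have "\<dots> = L2_inner \<Omega> (glue_div r) w"
  proof (rule L2_inner_AE_cong[OF _ square_integrable_glue_field(2)[of r, OF r(1)] _ V(2)])
    have "glue_field r \<in> H_div \<Omega>" using V(1) by (simp add: V_space_def)
    then show "square_integrable (lebesgue_on \<Omega>) (weak_div \<Omega> (glue_field r))"
      using weak_div_AE_eq(1)[OF \<Omega>(1,2)] has_weak_div_square_integrable unfolding H_div_def by blast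
    show "square_integrable (lebesgue_on \<Omega>) w" using k by (simp add: W_h_def)
  qed
  also have "\<dots> = (\<Sum>E\<in>\<T>. LINT x|lebesgue_on ref_elem. div_field (r E) x * wh E x)"
    unfolding L2_inner_def
  proof (rule mesh_integral(2))
    show "continuous_on ref_elem (\<lambda>x. div_field (r E) x * wh E x)" if "E \<in> \<T>" for E
      by (intro continuous_intros continuous_div_field r(1) that smooth_continuous smooth_Qpoly[OF wh(1)])
    fix E x assume E: "E \<in> \<T>" and x: "x \<in> (ref_int :: (real^'d) set)"
    have J: "Jac (F E) x \<noteq> 0" using Jac_pos[OF E, of x] x ref_int_subset by auto
    show "div_field (r E) x * wh E x = Jac (F E) x * (glue_div r (F E x) * w (F E x))"
      using wh(2)[OF E] x J by (simp add: glue_at[OF E x] corresponds_W_def)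
  qed
  finally show ?thesis by simp
qed

lemma div_field_zero [simp]: "div_field (\<lambda>x. 0) = (\<lambda>x. 0)"
  by (auto simp: div_field_def)

lemma div_facet_field: "div_field (facet_field c i s) = (\<lambda>x. c / 2)"
proof
  fix x :: "real^'d"
  have "partial i (\<lambda>x. c * (s + x $ i) / 2) x = c / 2"
    using smooth_facet_field[of c i s i]
    by (intro partial_eqI smooth_differentiable) (auto intro!: derivative_eq_intros simp: facet_field_nth)
  then have "partial j (\<lambda>x. facet_field c i s x $ j) x = (if j = i then c / 2 else 0)" for j
    by (auto simp: facet_field_nth)
  then show "div_field (facet_field c i s) x = c / 2" by (simp add: div_field_def)
qed

lemma boundary_flux_single:
  assumes "E \<in> \<T>"
  shows "boundary_flux (\<lambda>D. if D = E then u else (\<lambda>x. 0)) \<phi> = (\<Sum>i\<in>UNIV.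
     facet_integral i 1 (\<lambda>x. \<phi> (F E x) * u x $ i) - facet_integral i (- 1) (\<lambda>x. \<phi> (F E x) * u x $ i))"
proof -
  have "boundary_flux (\<lambda>D. if D = E then u else (\<lambda>x. 0)) \<phi> = (\<Sum>D\<in>\<T>. if D = E then (\<Sum>i\<in>UNIV.
     facet_integral i 1 (\<lambda>x. \<phi> (F E x) * u x $ i) - facet_integral i (- 1) (\<lambda>x. \<phi> (F E x) * u x $ i)) else 0)"
    unfolding boundary_flux_def by (rule sum.cong) (auto simp: facet_integral_def)
  then show ?thesis using mesh(1) assms by simp
qed

context
  fixes \<iota> :: "nat \<Rightarrow> 'd" and k :: nat and \<Gamma> w wh
  assumes w: "w \<in> W_h k \<Omega> \<T> F"
    and WH: "\<forall>E\<in>\<T>. wh E \<in> Qpoly (k - 1) \<and> corresponds_W (F E) w (wh E)"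
    and orth: "\<forall>v\<in>V_h \<iota> k \<Omega> \<Gamma> \<T> F. L2_inner \<Omega> (weak_div \<Omega> v) w = 0"
begin

lemma wh: "E \<in> \<T> \<Longrightarrow> wh E \<in> Qpoly (k - 1)"
  using WH by blast

text \<open>
  For \<open>b = grad_bubble p\<close>, integration by parts has no boundary terms, and
  \<open>0 = \<integral>div b * p = - \<integral>(\<Sum>i. (1 - (x i)^2) * (partial i p)^2)\<close>.
\<close>

lemma constant_on_element:
  assumes E: "E \<in> \<T>"
  shows "\<exists>c. \<forall>x\<in>ref_int. wh E x = c"
proof -
  let ?f = "wh E"
  have f: "smooth ?f" by (rule smooth_Qpoly[OF wh[OF E]])
  let ?b = "grad_bubble ?f"
  define r where "r D = (if D = E then ?b else (\<lambda>x. 0))" for D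
  have b0: "facet_integral i s (\<lambda>x. \<psi> x * ?b x $ i) = 0" if "s = 1 \<or> s = - 1" for i s \<psi>
    using that by (auto simp: facet_integral_def grad_bubble_def)
  have bs: "smooth (\<lambda>x. ?b x $ i)" for i by (rule smooth_grad_bubble[OF f])
  have "(\<Sum>D\<in>\<T>. LINT x|lebesgue_on ref_elem. div_field (r D) x * wh D x) = 0"
  proof (rule glue_field_test[OF w WH orth])
    show "smooth (\<lambda>x. r D x $ i)" for D i by (simp add: r_def bs smooth_const)
    show "r D \<in> RT_space (k - 1)" for D by (simp add: r_def zero_RT grad_bubble_RT[OF wh[OF E], unfolded One_nat_def])
    show "boundary_flux r \<phi> = 0" for \<phi> unfolding r_def boundary_flux_single[OF E] by (simp add: b0)
  qed
  also have "(\<Sum>D\<in>\<T>. LINT x|lebesgue_on ref_elem. div_field (r D) x * wh D x) =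
      (\<Sum>D\<in>\<T>. if D = E then LINT x|lebesgue_on ref_elem. div_field ?b x * ?f x else 0)"
    by (rule sum.cong) (auto simp: r_def)
  finally have zero: "(LINT x|lebesgue_on ref_elem. div_field ?b x * ?f x) = 0" using mesh(1) E by simp
  define g where "g x = (\<Sum>i\<in>UNIV. ?b x $ i * partial i ?f x)" for x
  have gc: "continuous_on UNIV g"
    unfolding g_def by (intro continuous_intros smooth_continuous bs smooth_partial f)
  have dc: "continuous_on UNIV (\<lambda>x. div_field ?b x * ?f x)"
    by (intro continuous_intros continuous_div_field bs smooth_continuous f)
  have us: "smooth (\<lambda>x. ?f x * ?b x $ i)" for i by (rule smooth_mult[OF f bs])
  have "(LINT x|lebesgue_on ref_elem. div_field ?b x * ?f x + g x) =
      (LINT x|lebesgue_on ref_elem. (\<Sum>i\<in>UNIV. partial i (\<lambda>x. ?f x * ?b x $ i) x))"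
    by (simp add: partial_mult smooth_differentiable f bs div_field_def g_def sum.distrib sum_distrib_left sum_distrib_right mult.commute add.commute)
  also have "\<dots> = (\<Sum>i\<in>UNIV. LINT x|lebesgue_on ref_elem. partial i (\<lambda>x. ?f x * ?b x $ i) x)"
    by (intro Bochner_Integration.integral_sum integrable_ref_continuous smooth_continuous_partial us)
  also have "\<dots> = 0"
    by (intro sum.neutral ballI) (simp add: ref_elem_partial_integral smooth_differentiable smooth_continuous_partial us b0)
  finally have "(LINT x|lebesgue_on ref_elem. g x) = 0"
    using zero Bochner_Integration.integral_add[OF integrable_ref_continuous[OF dc] integrable_ref_continuous[OF gc]] by simp
  have pos: "(1 - (x $ i)\<^sup>2) * (partial i ?f x)\<^sup>2 \<ge> 0" if "x \<in> ref_elem" for x i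
  proof -
    have "\<bar>x $ i\<bar> \<le> 1" using that by (auto simp: mem_ref_elem abs_le_iff minus_le_iff)
    then have "(x $ i)\<^sup>2 \<le> 1" by (simp add: abs_square_le_1)
    then show ?thesis by simp
  qed
  have g_eq: "g x = (\<Sum>i\<in>UNIV. (1 - (x $ i)\<^sup>2) * (partial i ?f x)\<^sup>2)" for x
    by (simp add: g_def grad_bubble_def power2_eq_square mult.assoc)
  have part0: "partial i ?f x = 0" if x: "x \<in> ref_int" for x i
  proof -
    have "g x = 0"
      by (rule ref_integral_zero_imp_zero[OF gc _ \<open>(LINT x|lebesgue_on ref_elem. g x) = 0\<close> x])
        (simp add: g_eq sum_nonneg pos)
    then have "(1 - (x $ i)\<^sup>2) * (partial i ?f x)\<^sup>2 = 0"
      unfolding g_eq using pos x ref_int_subset by (subst (asm) sum_nonneg_eq_0_iff) auto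
    moreover have "(x $ i)\<^sup>2 \<noteq> 1" using x by (auto simp: mem_ref_int power2_eq_1_iff) (metis less_irrefl)+
    ultimately show ?thesis by simp
  qed
  show ?thesis
  proof (rule has_derivative_zero_constant)
    show "convex (ref_int :: (real^'d) set)" by (simp add: ref_int_def)
    show "(?f has_derivative (\<lambda>h. 0)) (at x within ref_int)" if "x \<in> ref_int" for x
    proof -
      have "grad ?f x = 0" using part0[OF that] by (simp add: grad_def vec_eq_iff)
      then show ?thesis
        using has_derivative_at_withinI[OF has_derivative_grad[OF smooth_differentiable[OF f]], of x ref_int] by simp
    qed
  qed
qed

lemma integral_const_on_element:
  assumes E: "E \<in> \<T>" and c: "\<And>x. x \<in> ref_int \<Longrightarrow> wh E x = c"
  shows "(LINT x|lebesgue_on ref_elem. b * wh E x) = b * c * measure lborel (ref_int :: (real^'d) set)"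
proof -
  have "continuous_on ref_elem (\<lambda>x. b * wh E x)"
    by (intro continuous_intros smooth_continuous smooth_Qpoly[OF wh[OF E]])
  then have "(LINT x|lebesgue_on ref_elem. b * wh E x) = (LINT x|lborel. indicator ref_int x * (b * wh E x))"
    by (rule ref_integral_continuous(3))
  also have "\<dots> = (LINT x|lborel. (b * c) * indicator (ref_int :: (real^'d) set) x)"
    by (rule Bochner_Integration.integral_cong) (auto simp: indicator_def c)
  also have "\<dots> = b * c * measure lborel (ref_int :: (real^'d) set)"
    by (simp add: ref_int_def open_box)
  finally show ?thesis .
qed

text \<open>
  A unit flux out of one element enters the other.  The two facet integrals cancel because the
  parametrizations of the shared facet differ by a symmetry \<open>\<sigma>\<close> of the reference element.
\<close>

lemma equal_across_shared_facet:
  assumes E: "E \<in> \<T>" "E' \<in> \<T>" "E \<noteq> E'" and sh: "shared_facet E E' i s i' s' \<sigma>"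
    and c: "\<And>x. x \<in> ref_int \<Longrightarrow> wh E x = c" and c': "\<And>x. x \<in> ref_int \<Longrightarrow> wh E' x = c'"
  shows "c = c'"
proof -
  have s: "s = - 1 \<or> s = 1" "s' = - 1 \<or> s' = 1" and \<sigma>: "orthogonal_transformation \<sigma>" "\<sigma> ` ref_facet i s = ref_facet i' s'"
    and FF: "\<And>x. x \<in> ref_facet i s \<Longrightarrow> F E x = F E' (\<sigma> x)"
    using sh unfolding shared_facet_def by blast+
  define r where "r D = (if D = E then facet_field 1 i s else if D = E' then facet_field (- 1) i' s' else (\<lambda>x. 0))" for D
  have split: "(\<Sum>D\<in>\<T>. if D = E then a else if D = E' then b else 0) = a + b" for a b :: real
  proof -
    have "(\<Sum>D\<in>\<T>. if D = E then a else if D = E' then b else 0) =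
        (\<Sum>D\<in>\<T>. (if D = E then a else 0) + (if D = E' then b else 0))"
      using E(3) by (intro sum.cong) auto
    then show ?thesis using mesh(1) E by (simp add: sum.distrib)
  qed
  have flux: "boundary_flux r \<phi> = 0" if "smooth \<phi>" for \<phi>
  proof -
    have "boundary_flux r \<phi> = (\<Sum>D\<in>\<T>. if D = E then facet_integral i s (\<lambda>x. \<phi> (F E x))
        else if D = E' then - facet_integral i' s' (\<lambda>x. \<phi> (F E' x)) else 0)"
      unfolding boundary_flux_def r_def
      using facet_field_flux[OF s(1), of "\<lambda>x. \<phi> (F E x)" 1 i] facet_field_flux[OF s(2), of "\<lambda>x. \<phi> (F E' x)" "- 1" i']
      by (intro sum.cong) (auto simp: facet_integral_def)
    also have "\<dots> = facet_integral i s (\<lambda>x. \<phi> (F E x)) - facet_integral i' s' (\<lambda>x. \<phi> (F E' x))"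
      unfolding split by simp
    also have "facet_integral i s (\<lambda>x. \<phi> (F E x)) = facet_integral i' s' (\<lambda>x. \<phi> (F E' x))"
    proof -
      have "(LINT x|lebesgue_on ref_elem. \<phi> (F E (to_facet i s x))) =
          (LINT x|lebesgue_on ref_elem. \<phi> (F E' (to_facet i' s' (\<sigma> x))))"
      proof (rule Bochner_Integration.integral_cong[OF refl])
        fix x :: "real^'d" assume "x \<in> space (lebesgue_on ref_elem)"
        then have "to_facet i s x \<in> ref_facet i s" using s by (auto simp: ref_facet_def mem_ref_elem)
        then show "\<phi> (F E (to_facet i s x)) = \<phi> (F E' (to_facet i' s' (\<sigma> x)))"
          using FF orthogonal_to_facet(1)[OF \<sigma> s, of x] by simp
      qed
      also have "\<dots> = (LINT x|lebesgue_on ref_elem. \<phi> (F E' (to_facet i' s' x)))"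
      proof (rule LINT_ref_elem_orthogonal[OF dim \<sigma>(1) orthogonal_facet_ref_int(2)[OF \<sigma> s], where f = "\<lambda>x. \<phi> (F E' (to_facet i' s' x))"])
        show "(\<lambda>x. \<phi> (F E' (to_facet i' s' x))) \<in> borel_measurable borel"
          unfolding to_facet_eq
          by (intro borel_measurable_continuous_onI continuous_on_compose2[OF smooth_continuous[OF that, of UNIV]]
              continuous_on_compose2[OF F_continuous[OF E(2), of UNIV]] continuous_intros) auto
      qed
      finally show ?thesis by (simp add: facet_integral_def)
    qed
    finally show ?thesis by simp
  qed
  have "(\<Sum>D\<in>\<T>. LINT x|lebesgue_on ref_elem. div_field (r D) x * wh D x) = 0"
  proof (rule glue_field_test[OF w WH orth])
    show "smooth (\<lambda>x. r D x $ j)" for D j by (simp add: r_def smooth_facet_field smooth_const)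
    show "r D \<in> RT_space (k - 1)" for D by (simp add: r_def facet_field_RT zero_RT)
  qed (use flux in blast)
  also have "(\<Sum>D\<in>\<T>. LINT x|lebesgue_on ref_elem. div_field (r D) x * wh D x) =
      (\<Sum>D\<in>\<T>. if D = E then LINT x|lebesgue_on ref_elem. (1 / 2) * wh E x
        else if D = E' then LINT x|lebesgue_on ref_elem. (- 1 / 2) * wh E' x else 0)"
    by (rule sum.cong) (auto simp: r_def div_facet_field)
  also have "\<dots> = 1 / 2 * c * measure lborel (ref_int :: (real^'d) set) + (- 1 / 2) * c' * measure lborel (ref_int :: (real^'d) set)"
    unfolding split using integral_const_on_element[of E c "1 / 2"] integral_const_on_element[of E' c' "- 1 / 2"] E c c'
    by simp
  finally have "(c - c') * measure lborel (ref_int :: (real^'d) set) = 0" by (simp add: algebra_simps)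
  then show ?thesis using measure_ref_int_pos[where 'd = 'd] by simp
qed

text \<open>
  The normal trace is unconstrained on a Dirichlet facet: all admissible test functions vanish there.
\<close>

lemma zero_at_Dirichlet_facet:
  assumes facet: "(E, i, s) \<in> facets_in \<Gamma> \<Omega> \<T> F"
    and c: "\<And>x. x \<in> ref_int \<Longrightarrow> wh E x = c"
  shows "c = 0"
proof -
  have E: "E \<in> \<T>" and s: "s = - 1 \<or> s = 1" and fr: "F E ` ref_facet i s \<subseteq> frontier \<Omega>"
    and \<Gamma>: "F E ` rel_interior (ref_facet i s) \<subseteq> \<Gamma>"
    using facet by (auto simp: facets_in_def boundary_facets_def)
  have "closure (rel_interior (ref_facet i s)) = closure (ref_facet i s)"
    by (rule convex_closure_rel_interior[OF convex_ref_facet])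
  also have "\<dots> = ref_facet i s" by (rule closure_closed[OF compact_imp_closed[OF compact_ref_facet]])
  finally have fac: "ref_facet i s = closure (rel_interior (ref_facet i s))" by (rule sym)
  then have "F E ` ref_facet i s \<subseteq> closure (F E ` rel_interior (ref_facet i s))"
    by (subst fac) (intro image_closure_subset F_continuous[OF E] closed_closure closure_subset)
  then have cl: "F E ` ref_facet i s \<subseteq> closure \<Gamma>" using closure_mono[OF \<Gamma>] by blast
  define r where "r D = (if D = E then facet_field 1 i s else (\<lambda>x. 0))" for D
  have flux: "boundary_flux r \<phi> = 0" if "fun_support \<phi> \<subseteq> \<Omega> \<or> fun_support \<phi> \<inter> closure \<Gamma> = {}" for \<phi>
  proof -
    have zero: "\<phi> (F E (to_facet i s x)) = 0" if "x \<in> ref_elem" for x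
    proof (rule ccontr)
      assume "\<phi> (F E (to_facet i s x)) \<noteq> 0"
      then have "F E (to_facet i s x) \<in> fun_support \<phi>"
        unfolding fun_support_def using closure_subset[of "{x. \<phi> x \<noteq> 0}"] by blast
      moreover have "to_facet i s x \<in> ref_facet i s" using that s by (auto simp: ref_facet_def mem_ref_elem)
      moreover have "frontier \<Omega> \<inter> \<Omega> = {}" using \<Omega>(1) by (simp add: frontier_disjoint_eq)
      ultimately show False
        using \<open>fun_support \<phi> \<subseteq> \<Omega> \<or> fun_support \<phi> \<inter> closure \<Gamma> = {}\<close> cl fr by blast
    qed
    have "boundary_flux r \<phi> = facet_integral i s (\<lambda>x. \<phi> (F E x))"
      unfolding r_def boundary_flux_single[OF E] facet_field_flux[OF s] by simp
    also have "\<dots> = 0"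
    proof -
      have "(LINT x|lebesgue_on ref_elem. \<phi> (F E (to_facet i s x))) = (LINT x|lebesgue_on (ref_elem :: (real^'d) set). 0)"
        by (rule Bochner_Integration.integral_cong) (simp_all add: zero)
      then show ?thesis by (simp add: facet_integral_def)
    qed
    finally show ?thesis .
  qed
  have "(\<Sum>D\<in>\<T>. LINT x|lebesgue_on ref_elem. div_field (r D) x * wh D x) = 0"
  proof (rule glue_field_test[OF w WH orth])
    show "smooth (\<lambda>x. r D x $ j)" for D j by (simp add: r_def smooth_facet_field smooth_const)
    show "r D \<in> RT_space (k - 1)" for D by (simp add: r_def facet_field_RT zero_RT)
  qed (use flux in blast)
  also have "(\<Sum>D\<in>\<T>. LINT x|lebesgue_on ref_elem. div_field (r D) x * wh D x) =
      (\<Sum>D\<in>\<T>. if D = E then LINT x|lebesgue_on ref_elem. (1 / 2) * wh E x else 0)"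
    by (rule sum.cong) (auto simp: r_def div_facet_field)
  also have "\<dots> = 1 / 2 * c * measure lborel (ref_int :: (real^'d) set)"
    using mesh(1) E integral_const_on_element[OF E c, of "1 / 2"] by simp
  finally show ?thesis using measure_ref_int_pos[where 'd = 'd] by simp
qed

end

text \<open>
  Without Dirichlet facets the interiors of all boundary facets lie in \<open>\<Gamma>\<^sub>N\<close>, and the relative boundaries
  of the facets have measure zero.
\<close>

lemma Dirichlet_facet_exists:
  assumes "boundary_partition \<Omega> \<Gamma>\<^sub>D \<Gamma>\<^sub>N \<T> F"
  shows "facets_in \<Gamma>\<^sub>D \<Omega> \<T> F \<noteq> {}"
proof
  assume empty: "facets_in \<Gamma>\<^sub>D \<Omega> \<T> F = {}"
  have "surface_measure \<Omega> \<T> F \<Gamma>\<^sub>D = 0"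
    unfolding surface_measure_def
  proof (rule sum.neutral, clarify)
    fix E i s assume "(E, i, s) \<in> boundary_facets \<Omega> \<T> F"
    then have "(E, i, s) \<in> facets_in \<Gamma>\<^sub>N \<Omega> \<T> F" and s: "s = - 1 \<or> s = 1"
      using assms empty by (auto simp: boundary_partition_def boundary_facets_def)
    then have N: "F E ` rel_interior (ref_facet i s) \<subseteq> \<Gamma>\<^sub>N" by (auto simp: facets_in_def)
    have "indicator \<Gamma>\<^sub>D (F E (to_facet i s x)) * surface_element (F E) i s (to_facet i s x) = 0"
      if "x \<in> ref_int" for x
      using to_facet_rel_interior[OF that s] N assms unfolding boundary_partition_def by (auto simp: indicator_def)
    then show "facet_integral i s (\<lambda>x. indicator \<Gamma>\<^sub>D (F E x) * surface_element (F E) i s x) = 0"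
      unfolding facet_integral_def by (simp add: ref_integral_zero)
  qed
  then show False using assms by (simp add: boundary_partition_def)
qed

theorem divergence_separates_pressures:
  assumes bp: "boundary_partition \<Omega> \<Gamma>\<^sub>D \<Gamma>\<^sub>N \<T> F" and w: "w \<in> W_h k \<Omega> \<T> F"
    and orth: "\<forall>v\<in>V_h \<iota> k \<Omega> \<Gamma>\<^sub>D \<T> F. L2_inner \<Omega> (weak_div \<Omega> v) w = 0"
  shows "w = 0"
proof -
  have "\<forall>E\<in>\<T>. \<exists>w'. w' \<in> Qpoly (k - 1) \<and> corresponds_W (F E) w w'" using w by (auto simp: W_h_def)
  then obtain wh where WH: "\<forall>E\<in>\<T>. wh E \<in> Qpoly (k - 1) \<and> corresponds_W (F E) w (wh E)"
    by metis
  note const = constant_on_element[OF w WH orth]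
  define R where "R = {E \<in> \<T>. \<forall>x\<in>ref_int. wh E x = 0}"
  have "R = \<T>"
  proof (rule facet_connected)
    show "R \<subseteq> \<T>" by (auto simp: R_def)
    obtain E i s where f: "(E, i, s) \<in> facets_in \<Gamma>\<^sub>D \<Omega> \<T> F" using Dirichlet_facet_exists[OF bp] by auto
    then have E: "E \<in> \<T>" by (auto simp: facets_in_def boundary_facets_def)
    obtain c where c: "\<And>x. x \<in> ref_int \<Longrightarrow> wh E x = c" using const[OF E] by blast
    then have "c = 0" by (rule zero_at_Dirichlet_facet[OF w WH orth f])
    then show "R \<noteq> {}" using E c by (auto simp: R_def)
  next
    fix E E' i s i' s' \<sigma>
    assume E: "E \<in> R" "E' \<in> \<T>" "E \<noteq> E'" and sh: "shared_facet E E' i s i' s' \<sigma>"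
    have ET: "E \<in> \<T>" and c0: "\<And>x. x \<in> ref_int \<Longrightarrow> wh E x = 0" using E(1) by (auto simp: R_def)
    obtain c where c: "\<And>x. x \<in> ref_int \<Longrightarrow> wh E' x = c" using const[OF E(2)] by blast
    have "0 = c" by (rule equal_across_shared_facet[OF w WH orth ET E(2,3) sh c0 c])
    then show "E' \<in> R" using E(2) c by (auto simp: R_def)
  qed
  have "w y = 0" for y
  proof (cases "y \<in> mesh_interior \<T> F")
    case True
    then obtain E x where E: "E \<in> \<T>" "x \<in> ref_int" "y = F E x" by (auto simp: mesh_interior_def)
    then have "E \<in> R" using \<open>R = \<T>\<close> by simp
    then show ?thesis using WH E by (auto simp: corresponds_W_def R_def)
  next
    case False
    then show ?thesis using w by (simp add: W_h_def)
  qed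
  then show ?thesis by (simp add: fun_eq_iff)
qed

end

section \<open>Symmetric positive definite matrices\<close>

lemma spd_invertible:
  fixes A :: "real^'n^'n"
  assumes "symmetric_positive_definite A"
  shows "invertible A"
proof -
  have "A *v x = 0 \<Longrightarrow> x = 0" for x
    using assms unfolding symmetric_positive_definite_def by (metis inner_zero_right less_irrefl)
  then show ?thesis unfolding invertible_left_inverse matrix_left_invertible_ker by blast
qed

lemma matrix_inv_mult:
  fixes A :: "real^'n^'n"
  assumes "invertible A"
  shows "A ** matrix_inv A = mat 1" "matrix_inv A ** A = mat 1"
proof -
  have "A ** matrix_inv A = mat 1 \<and> matrix_inv A ** A = mat 1"
    unfolding matrix_inv_def using assms unfolding invertible_def by (rule someI_ex)
  then show "A ** matrix_inv A = mat 1" "matrix_inv A ** A = mat 1" by auto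
qed

lemma matrix_inv_vector:
  fixes A :: "real^'n^'n"
  assumes "invertible A"
  shows "A *v (matrix_inv A *v x) = x" "matrix_inv A *v (A *v x) = x"
  using matrix_inv_mult(1)[OF assms] matrix_inv_mult(2)[OF assms] by (simp_all add: matrix_vector_mul_assoc)

lemma inner_matrix_transpose: "(A *v x) \<bullet> y = x \<bullet> (transpose A *v (y :: real^'n))"
  by (metis dot_lmul_matrix inner_commute transpose_matrix_vector transpose_transpose)

lemma spd_matrix_inv:
  fixes A :: "real^'n^'n"
  assumes A: "symmetric_positive_definite A"
  shows "symmetric_positive_definite (matrix_inv A)"
  unfolding symmetric_positive_definite_def
proof (intro conjI allI impI)
  have inv: "invertible A" by (rule spd_invertible[OF A])
  have sym: "transpose A = A" using A by (simp add: symmetric_positive_definite_def)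
  have "transpose (matrix_inv A) ** A = mat 1"
    using matrix_inv_mult(1)[OF inv] matrix_transpose_mul[of A "matrix_inv A"] sym by (simp add: transpose_mat)
  then have "transpose (matrix_inv A) ** A ** matrix_inv A = matrix_inv A" by (simp add: matrix_mul_lid)
  then show "transpose (matrix_inv A) = matrix_inv A"
    using matrix_inv_mult(1)[OF inv] by (simp add: matrix_mul_assoc[symmetric] matrix_mul_rid)
  fix x :: "real^'n" assume "x \<noteq> 0"
  define y where "y = matrix_inv A *v x"
  have x: "x = A *v y" by (simp add: y_def matrix_inv_vector[OF inv])
  then have "y \<noteq> 0" using \<open>x \<noteq> 0\<close> by auto
  then have "y \<bullet> (A *v y) > 0" using A by (simp add: symmetric_positive_definite_def)
  then show "x \<bullet> (matrix_inv A *v x) > 0" unfolding y_def[symmetric] by (simp add: x inner_commute)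
qed

lemma spd_congruence:
  fixes A :: "real^'n^'n" and M :: "real^'m^'n"
  assumes A: "symmetric_positive_definite A" and M: "\<And>x. M *v x = 0 \<Longrightarrow> x = 0"
  shows "symmetric_positive_definite (transpose M ** A ** M)"
  unfolding symmetric_positive_definite_def
proof (intro conjI allI impI)
  show "transpose (transpose M ** A ** M) = transpose M ** A ** M"
    using A by (simp add: symmetric_positive_definite_def matrix_transpose_mul matrix_mul_assoc)
  fix x :: "real^'m" assume "x \<noteq> 0"
  then have "(M *v x) \<bullet> (A *v (M *v x)) > 0"
    using A M by (auto simp: symmetric_positive_definite_def)
  then show "x \<bullet> ((transpose M ** A ** M) *v x) > 0"
    by (simp add: inner_matrix_transpose matrix_vector_mul_assoc matrix_mul_assoc)
qed

lemma spd_scaleR: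
  fixes A :: "real^'n^'n"
  assumes "symmetric_positive_definite A" "c > 0"
  shows "symmetric_positive_definite (c *\<^sub>R A)"
  using assms
  by (simp add: symmetric_positive_definite_def transpose_scalar[of c A, unfolded scalar_matrix_assoc] scaleR_matrix_vector_assoc[symmetric] vec_eq_iff transpose_def)

section \<open>Linearity of the reference velocity space\<close>

lemma Qpoly_add: "f \<in> Qpoly m \<Longrightarrow> g \<in> Qpoly m \<Longrightarrow> (\<lambda>x. f x + g x) \<in> Qpoly m"
  using fun_space.span_add[of f _ g] by (simp add: Qpoly_def plus_fun_def)

lemma RT_space_linear:
  assumes "v \<in> RT_space m" "w \<in> RT_space m"
  shows "(\<lambda>x. c *\<^sub>R v x + w x) \<in> RT_space m"
proof -
  obtain a b where v: "v = (\<lambda>x. \<chi> i. a i x + x $ i * b i x)" "\<And>i. a i \<in> Qpoly m" "\<And>i. b i \<in> Qpoly m"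
    using assms(1) unfolding RT_space_def by blast
  obtain a' b' where w: "w = (\<lambda>x. \<chi> i. a' i x + x $ i * b' i x)" "\<And>i. a' i \<in> Qpoly m" "\<And>i. b' i \<in> Qpoly m"
    using assms(2) unfolding RT_space_def by blast
  show ?thesis
    unfolding RT_space_def
  proof (intro CollectI exI conjI allI)
    show "(\<lambda>x. c *\<^sub>R v x + w x) = (\<lambda>x. \<chi> i. (c * a i x + a' i x) + x $ i * (c * b i x + b' i x))"
      by (simp add: fun_eq_iff vec_eq_iff v(1) w(1) algebra_simps)
  qed (intro Qpoly_add Qpoly_cmult v w)+
qed

lemma B_tilde_linear:
  fixes \<iota> :: "nat \<Rightarrow> 'd::finite"
  assumes dim: "CARD('d) = 2 \<or> CARD('d) = 3" and \<iota>: "bij_betw \<iota> {1..CARD('d)} UNIV"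
    and "v \<in> B_tilde \<iota> k" "w \<in> B_tilde \<iota> k"
  shows "(\<lambda>x. c *\<^sub>R v x + w x) \<in> B_tilde \<iota> k"
proof -
  obtain p where v: "v = (\<lambda>x. \<Sum>i\<in>UNIV. curl_x_cross \<iota> (p i) x)" "\<And>i. p i \<in> B_space k i"
    using assms(3) unfolding B_tilde_def by blast
  obtain q where w: "w = (\<lambda>x. \<Sum>i\<in>UNIV. curl_x_cross \<iota> (q i) x)" "\<And>i. q i \<in> B_space k i"
    using assms(4) unfolding B_tilde_def by blast
  have lin: "curl_x_cross \<iota> (fun_scale c (p i) + q i) = fun_scale c (curl_x_cross \<iota> (p i)) + curl_x_cross \<iota> (q i)" for i
    by (rule curl_x_cross_linear[OF B_space_curl(1)[OF dim \<iota> v(2)] B_space_curl(1)[OF dim \<iota> w(2)]])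
  show ?thesis
    unfolding B_tilde_def
  proof (intro CollectI exI conjI allI)
    show "(\<lambda>x. c *\<^sub>R v x + w x) = (\<lambda>x. \<Sum>i\<in>UNIV. curl_x_cross \<iota> (fun_scale c (p i) + q i) x)"
      unfolding lin by (simp add: v(1) w(1) fun_scale_def sum.distrib scaleR_sum_right)
    show "fun_scale c (p i) + q i \<in> B_space k i" for i
      using v(2)[of i] w(2)[of i] unfolding B_space_def by (intro fun_space.span_add fun_space.span_scale)
  qed
qed

lemma V_ref_linear:
  fixes \<iota> :: "nat \<Rightarrow> 'd::finite"
  assumes dim: "CARD('d) = 2 \<or> CARD('d) = 3" and \<iota>: "bij_betw \<iota> {1..CARD('d)} UNIV"
    and "v \<in> V_ref \<iota> k" "w \<in> V_ref \<iota> k"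
  shows "(\<lambda>x. c *\<^sub>R v x + w x) \<in> V_ref \<iota> k"
proof -
  obtain r b where v: "v = (\<lambda>x. r x + b x)" "r \<in> RT_space (k - 1)" "b \<in> B_tilde \<iota> k"
    using assms(3) unfolding V_ref_def by blast
  obtain r' b' where w: "w = (\<lambda>x. r' x + b' x)" "r' \<in> RT_space (k - 1)" "b' \<in> B_tilde \<iota> k"
    using assms(4) unfolding V_ref_def by blast
  have "(\<lambda>x. c *\<^sub>R v x + w x) = (\<lambda>x. (c *\<^sub>R r x + r' x) + (c *\<^sub>R b x + b' x))"
    by (simp add: v(1) w(1) fun_eq_iff algebra_simps)
  then show ?thesis
    unfolding V_ref_def using RT_space_linear[OF v(2) w(2), of c] B_tilde_linear[OF dim \<iota> v(3) w(3), of c]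
    by (intro CollectI exI[of _ "\<lambda>x. c *\<^sub>R r x + r' x"] exI[of _ "\<lambda>x. c *\<^sub>R b x + b' x"]) simp
qed

lemma V_ref_sum:
  fixes \<iota> :: "nat \<Rightarrow> 'd::finite"
  assumes dim: "CARD('d) = 2 \<or> CARD('d) = 3" and \<iota>: "bij_betw \<iota> {1..CARD('d)} UNIV"
    and "\<And>i. i \<in> I \<Longrightarrow> v i \<in> V_ref \<iota> k"
  shows "(\<lambda>x. \<Sum>i\<in>I. c i *\<^sub>R v i x) \<in> V_ref \<iota> k"
  using assms(3)
proof (induction I rule: infinite_finite_induct)
  case (insert i I)
  then show ?case using V_ref_linear[OF dim \<iota>, of "v i" k "\<lambda>x. \<Sum>i\<in>I. c i *\<^sub>R v i x" "c i"] by simp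
qed (use subsetD[OF RT_space_subset_V_ref zero_RT] in auto)

lemma finite_multi_indices: "finite {i :: 'd::finite \<Rightarrow> nat. \<forall>j. i j \<le> k}"
proof -
  have "{i :: 'd \<Rightarrow> nat. \<forall>j. i j \<le> k} = PiE UNIV (\<lambda>_. {..k})" by (auto simp: PiE_iff)
  then show ?thesis by (simp add: finite_PiE)
qed

section \<open>The quadrature form\<close>

locale mfmfe = quad_mesh \<Omega> \<T> F
  for \<Omega> :: "(real^'d::finite) set" and \<T> F +
  fixes \<iota> :: "nat \<Rightarrow> 'd" and k :: nat and \<xi> l :: "nat \<Rightarrow> real" and K :: "real^'d \<Rightarrow> real^'d^'d"
    and k0 k1 :: real and \<Gamma> :: "(real^'d) set"
  assumes coordinates: "bij_betw \<iota> {1..CARD('d)} UNIV" and degree: "k \<ge> 1"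
    and tensor: "admissible_tensor \<Omega> k0 k1 K" and quadrature: "gauss_lobatto k \<xi> l"
begin

abbreviation Vh where "Vh \<equiv> V_h \<iota> k \<Omega> \<Gamma> \<T> F"

text \<open>
  A polynomial field is determined by its values in the open cube, and the Piola transformation is
  invertible at each of its points.
\<close>

lemma hat_unique:
  assumes E: "E \<in> \<T>" and v': "v' \<in> V_ref \<iota> k" "corresponds_V (F E) v v'"
  shows "hat \<iota> k (F E) v = v'"
  unfolding hat_def
proof (rule the_equality)
  show "v' \<in> V_ref \<iota> k \<and> corresponds_V (F E) v v'" using v' by simp
  fix w assume w: "w \<in> V_ref \<iota> k \<and> corresponds_V (F E) v w"
  define d where "d x = - 1 *\<^sub>R w x + v' x" for x
  have "d \<in> V_ref \<iota> k" unfolding d_def[abs_def] using V_ref_linear[OF dim coordinates] w v' by blast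
  then have field: "enhanced_field k d" by (rule V_ref_enhanced_field[OF dim coordinates degree])
  have "d x = 0" if x: "x \<in> ref_int" for x
  proof -
    have J: "Jac (F E) x \<noteq> 0" and inv: "invertible (DF (F E) x)"
      using Jac_pos[OF E, of x] DF_invertible[OF E, of x] x ref_int_subset by auto
    have "piola (F E) w x = piola (F E) v' x" using v'(2) w x unfolding corresponds_V_def by metis
    then have "DF (F E) x *v w x = DF (F E) x *v v' x" using J by (simp add: piola_def)
    then have "w x = v' x" by (metis matrix_inv_vector(2)[OF inv])
    then show ?thesis by (simp add: d_def)
  qed
  then have "d x = 0" for x using enhanced_field_determined_on_ref_int[OF field] by blast
  then show "w = v'" by (simp add: d_def fun_eq_iff)
qed

lemma hat_V_h:
  assumes "E \<in> \<T>" "v \<in> Vh"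
  shows "hat \<iota> k (F E) v \<in> V_ref \<iota> k" "corresponds_V (F E) v (hat \<iota> k (F E) v)"
proof -
  obtain v' where v': "v' \<in> V_ref \<iota> k" "corresponds_V (F E) v v'" using assms unfolding V_h_def by blast
  then show "hat \<iota> k (F E) v \<in> V_ref \<iota> k" "corresponds_V (F E) v (hat \<iota> k (F E) v)"
    using hat_unique[OF assms(1) v'] by simp_all
qed

lemma hat_sum:
  assumes E: "E \<in> \<T>" and v: "\<And>i. i \<in> I \<Longrightarrow> v i \<in> Vh"
  shows "hat \<iota> k (F E) (\<lambda>x. \<Sum>i\<in>I. c i *\<^sub>R v i x) = (\<lambda>x. \<Sum>i\<in>I. c i *\<^sub>R hat \<iota> k (F E) (v i) x)"
proof (rule hat_unique[OF E])
  show "(\<lambda>x. \<Sum>i\<in>I. c i *\<^sub>R hat \<iota> k (F E) (v i) x) \<in> V_ref \<iota> k"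
    by (rule V_ref_sum[OF dim coordinates hat_V_h(1)[OF E v]])
  show "corresponds_V (F E) (\<lambda>x. \<Sum>i\<in>I. c i *\<^sub>R v i x) (\<lambda>x. \<Sum>i\<in>I. c i *\<^sub>R hat \<iota> k (F E) (v i) x)"
    unfolding corresponds_V_def
  proof
    fix x :: "real^'d" assume x: "x \<in> ref_int"
    have "(\<Sum>i\<in>I. c i *\<^sub>R v i (F E x)) = (\<Sum>i\<in>I. c i *\<^sub>R piola (F E) (hat \<iota> k (F E) (v i)) x)"
      using hat_V_h(2)[OF E v] x by (intro sum.cong) (auto simp: corresponds_V_def)
    also have "\<dots> = piola (F E) (\<lambda>x. \<Sum>i\<in>I. c i *\<^sub>R hat \<iota> k (F E) (v i) x) x"
    proof -
      have lin: "linear (\<lambda>z. DF (F E) x *v z)" by (rule matrix_vector_mul_linear)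
      show ?thesis
        unfolding piola_def
        by (simp add: linear_sum[OF lin] linear_cmul[OF lin] scaleR_sum_right mult.commute)
    qed
    finally show "(\<Sum>i\<in>I. c i *\<^sub>R v i (F E x)) = piola (F E) (\<lambda>x. \<Sum>i\<in>I. c i *\<^sub>R hat \<iota> k (F E) (v i) x) x" .
  qed
qed

lemma K_inv_pullback_spd:
  assumes E: "E \<in> \<T>" and p: "p \<in> ref_elem"
  shows "symmetric_positive_definite (K_inv_pullback K (F E) p)"
proof -
  have "F E p \<in> closure \<Omega>" using F_bij(2)[OF E] element_subset[OF E] p by blast
  then have t: "transpose (K (F E p)) = K (F E p)" "\<And>z. k0 * (z \<bullet> z) \<le> z \<bullet> (K (F E p) *v z)" and k0: "k0 > 0"
    using tensor by (auto simp: admissible_tensor_def)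
  have "symmetric_positive_definite (K (F E p))"
    unfolding symmetric_positive_definite_def
  proof (intro conjI allI impI)
    fix z :: "real^'d" assume "z \<noteq> 0"
    then have "0 < k0 * (z \<bullet> z)" using k0 by simp
    then show "0 < z \<bullet> (K (F E p) *v z)" using t(2)[of z] by linarith
  qed (rule t(1))
  then have "symmetric_positive_definite (transpose (DF (F E) p) ** matrix_inv (K (F E p)) ** DF (F E) p)"
  proof (rule spd_congruence[OF spd_matrix_inv])
    show "x = 0" if "DF (F E) p *v x = 0" for x
      using matrix_inv_vector(2)[OF DF_invertible[OF E p], of x] that by simp
  qed
  then show ?thesis
    unfolding K_inv_pullback_def using Jac_pos[OF E p] by (intro spd_scaleR) auto
qed

lemma node_in_ref_elem:
  assumes "\<forall>j. i j \<le> k"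
  shows "(\<chi> j. \<xi> (i j)) \<in> (ref_elem :: (real^'d) set)"
  using gauss_lobatto_nodes(2,3)[OF quadrature degree] assms by (simp add: mem_ref_elem)

lemma quad_form_commute: "quad_form \<iota> k \<xi> l \<T> F K u v = quad_form \<iota> k \<xi> l \<T> F K v u"
  unfolding quad_form_def Let_def
proof (intro sum.cong refl)
  fix E i assume E: "E \<in> \<T>" and i: "i \<in> {i :: 'd \<Rightarrow> nat. \<forall>j. i j \<le> k}"
  let ?p = "\<chi> j. \<xi> (i j)"
  have "?p \<in> ref_elem" using node_in_ref_elem i by simp
  from K_inv_pullback_spd[OF E this]
  have sym: "transpose (K_inv_pullback K (F E) ?p) = K_inv_pullback K (F E) ?p"
    by (simp add: symmetric_positive_definite_def)
  have "(K_inv_pullback K (F E) ?p *v a) \<bullet> b = (K_inv_pullback K (F E) ?p *v b) \<bullet> a" for a b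
    using inner_matrix_transpose[of "K_inv_pullback K (F E) ?p" a b] sym by (simp add: inner_commute)
  then show "(\<Prod>j\<in>UNIV. l (i j)) * ((K_inv_pullback K (F E) ?p *v hat \<iota> k (F E) u ?p) \<bullet> hat \<iota> k (F E) v ?p) =
      (\<Prod>j\<in>UNIV. l (i j)) * ((K_inv_pullback K (F E) ?p *v hat \<iota> k (F E) v ?p) \<bullet> hat \<iota> k (F E) u ?p)"
    by simp
qed

lemma quad_form_sum_right:
  assumes v: "\<And>i. i \<in> I \<Longrightarrow> v i \<in> Vh"
  shows "quad_form \<iota> k \<xi> l \<T> F K u (\<lambda>x. \<Sum>i\<in>I. c i *\<^sub>R v i x) = (\<Sum>i\<in>I. c i * quad_form \<iota> k \<xi> l \<T> F K u (v i))"
proof -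
  have "quad_form \<iota> k \<xi> l \<T> F K u (\<lambda>x. \<Sum>i\<in>I. c i *\<^sub>R v i x) =
      (\<Sum>E\<in>\<T>. \<Sum>j\<in>{i :: 'd \<Rightarrow> nat. \<forall>j. i j \<le> k}. \<Sum>i\<in>I. c i * ((\<Prod>m\<in>UNIV. l (j m)) *
        ((K_inv_pullback K (F E) (\<chi> m. \<xi> (j m)) *v hat \<iota> k (F E) u (\<chi> m. \<xi> (j m))) \<bullet> hat \<iota> k (F E) (v i) (\<chi> m. \<xi> (j m)))))"
    unfolding quad_form_def Let_def
    by (intro sum.cong refl) (simp add: hat_sum[OF _ v] inner_sum_right sum_distrib_left mult.left_commute)
  also have "\<dots> = (\<Sum>i\<in>I. \<Sum>E\<in>\<T>. \<Sum>j\<in>{i :: 'd \<Rightarrow> nat. \<forall>j. i j \<le> k}. c i * ((\<Prod>m\<in>UNIV. l (j m)) *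
        ((K_inv_pullback K (F E) (\<chi> m. \<xi> (j m)) *v hat \<iota> k (F E) u (\<chi> m. \<xi> (j m))) \<bullet> hat \<iota> k (F E) (v i) (\<chi> m. \<xi> (j m)))))"
    by (simp add: sum.swap[where B = I])
  finally show ?thesis unfolding quad_form_def Let_def by (simp add: sum_distrib_left)
qed

text \<open>
  All summands are nonnegative, and they cannot all vanish: the reference fields would vanish at all
  nodes, hence everywhere by unisolvence.
\<close>

lemma quad_form_pos:
  assumes v: "v \<in> Vh" "v \<noteq> 0"
  shows "quad_form \<iota> k \<xi> l \<T> F K v v > 0"
proof -
  define t where "t E i = (\<Prod>j\<in>UNIV. l (i j)) * ((K_inv_pullback K (F E) (\<chi> j. \<xi> (i j)) *v
      hat \<iota> k (F E) v (\<chi> j. \<xi> (i j))) \<bullet> hat \<iota> k (F E) v (\<chi> j. \<xi> (i j)))" for E and i :: "'d \<Rightarrow> nat"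
  define I where "I = {i :: 'd \<Rightarrow> nat. \<forall>j. i j \<le> k}"
  have qf: "quad_form \<iota> k \<xi> l \<T> F K v v = (\<Sum>E\<in>\<T>. \<Sum>i\<in>I. t E i)"
    by (simp add: quad_form_def Let_def t_def I_def)
  have w: "(\<Prod>j\<in>UNIV. l (i j)) > 0" if "i \<in> I" for i
    using that gauss_lobatto_weight_pos[OF quadrature degree] by (intro prod_pos) (simp add: I_def)
  have tpos: "t E i > 0" if "E \<in> \<T>" "i \<in> I" "hat \<iota> k (F E) v (\<chi> j. \<xi> (i j)) \<noteq> 0" for E i
  proof -
    have "(\<chi> j. \<xi> (i j)) \<in> (ref_elem :: (real^'d) set)" using node_in_ref_elem that(2) by (simp add: I_def)
    from K_inv_pullback_spd[OF that(1) this] that(3) w[OF that(2)] show ?thesis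
      unfolding t_def symmetric_positive_definite_def by (simp add: inner_commute)
  qed
  have tnn: "t E i \<ge> 0" if "E \<in> \<T>" "i \<in> I" for E i
    using tpos[OF that] by (cases "hat \<iota> k (F E) v (\<chi> j. \<xi> (i j)) = 0") (auto simp: t_def less_imp_le)
  have fin: "finite I" using finite_multi_indices by (simp add: I_def)
  have "\<exists>E\<in>\<T>. \<exists>i\<in>I. hat \<iota> k (F E) v (\<chi> j. \<xi> (i j)) \<noteq> 0"
  proof (rule ccontr)
    assume neg: "\<not> (\<exists>E\<in>\<T>. \<exists>i\<in>I. hat \<iota> k (F E) v (\<chi> j. \<xi> (i j)) \<noteq> 0)"
    have hat0: "hat \<iota> k (F E) v x = 0" if E: "E \<in> \<T>" for E x
    proof (rule enhanced_field_unisolvent[OF dim, where v = "hat \<iota> k (F E) v"])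
      show "enhanced_field k (hat \<iota> k (F E) v)"
        by (rule V_ref_enhanced_field[OF dim coordinates degree hat_V_h(1)[OF E v(1)]])
      show "finite (\<xi> ` {0..k})" "card (\<xi> ` {0..k}) = Suc k"
        using gauss_lobatto_nodes(1)[OF quadrature degree] by (simp_all add: card_image)
      fix y :: "real^'d" assume y: "\<And>j. y $ j \<in> \<xi> ` {0..k}"
      have "\<exists>n. n \<le> k \<and> y $ j = \<xi> n" for j using y[of j] by auto
      then obtain i where i: "\<And>j. i j \<le> k" "\<And>j. y $ j = \<xi> (i j)" by metis
      then have "y = (\<chi> j. \<xi> (i j))" by (simp add: vec_eq_iff)
      then show "hat \<iota> k (F E) v y = 0" using neg E i(1) by (auto simp: I_def)
    qed
    have "v y = 0" for y
    proof (cases "y \<in> mesh_interior \<T> F")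
      case True
      then obtain E x where E: "E \<in> \<T>" "x \<in> ref_int" "y = F E x" by (auto simp: mesh_interior_def)
      then have "v y = piola (F E) (hat \<iota> k (F E) v) x"
        using hat_V_h(2)[OF E(1) v(1)] by (simp add: corresponds_V_def)
      then show ?thesis by (simp add: piola_def hat0[OF E(1)])
    next
      case False
      then show ?thesis using v(1) by (simp add: V_h_def)
    qed
    then show False using v(2) by (simp add: fun_eq_iff)
  qed
  then obtain E i where E: "E \<in> \<T>" "i \<in> I" "t E i > 0" using tpos by blast
  have "0 < (\<Sum>i\<in>I. t E i)" using E fin tnn by (intro sum_pos2[of I i]) auto
  then show ?thesis
    unfolding qf using E mesh(1) tnn by (intro sum_pos2[of \<T> E]) (auto intro: sum_nonneg)
qed

end

section \<open>The projection on a facet\<close>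

text \<open>
  Gram-Schmidt orthogonalization, one generator at a time.  The form is only semidefinite, since
  different polynomials may agree on a facet; the functional \<open>L\<close> must therefore annihilate the null
  vectors of \<open>b\<close>.  The hypotheses refer to the full span, so that in the induction step the functional
  \<open>b a\<close> of a further generator \<open>a\<close> can be represented as well.
\<close>

lemma semidefinite_representation:
  fixes scale :: "real \<Rightarrow> 'a::ab_group_add \<Rightarrow> 'a" and b :: "'a \<Rightarrow> 'a \<Rightarrow> real" and L :: "'a \<Rightarrow> real"
  assumes vs: "vector_space scale"
    and S0: "finite S0"
    and b_lin: "\<And>u v w c. u \<in> module.span scale S0 \<Longrightarrow> v \<in> module.span scale S0 \<Longrightarrow> w \<in> module.span scale S0 \<Longrightarrow>
      b (scale c u + v) w = c * b u w + b v w"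
    and b_sym: "\<And>u v. b u v = b v u"
    and L_lin: "\<And>u v c. u \<in> module.span scale S0 \<Longrightarrow> v \<in> module.span scale S0 \<Longrightarrow> L (scale c u + v) = c * L u + L v"
    and null: "\<And>u. u \<in> module.span scale S0 \<Longrightarrow> b u u = 0 \<Longrightarrow> L u = 0 \<and> (\<forall>v\<in>module.span scale S0. b u v = 0)"
  shows "\<exists>q\<in>module.span scale S0. \<forall>r\<in>module.span scale S0. b q r = L r"
proof -
  interpret vector_space scale by (rule vs)
  have sp: "span S \<subseteq> span S0" if "S \<subseteq> S0" for S using that by (rule span_mono)
  have b0: "b 0 w = 0" if "w \<in> span S0" for w using b_lin[of 0 0 w 1] span_zero that by simp
  have general: "\<exists>q\<in>span S. \<forall>r\<in>span S. b q r = L r"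
    if S: "finite S" "S \<subseteq> S0"
    and L_lin: "\<And>u v c. u \<in> span S0 \<Longrightarrow> v \<in> span S0 \<Longrightarrow> L (scale c u + v) = c * L u + L v"
    and null: "\<And>u. u \<in> span S0 \<Longrightarrow> b u u = 0 \<Longrightarrow> L u = 0" for S L
    using S L_lin null
  proof (induction S arbitrary: L rule: finite_induct)
    case empty
    have "L 0 = 0" using empty(2)[of 0 0 1] span_zero by simp
    then show ?case using b0[OF span_zero] by auto
  next
    case (insert a S)
    have aS: "a \<in> span S0" "S \<subseteq> S0" using insert.prems(1) by (auto intro: span_base)
    obtain q where q: "q \<in> span S" "\<And>r. r \<in> span S \<Longrightarrow> b q r = L r"
      using insert.IH[of L] aS insert.prems(2,3) by blast
    have "\<exists>p\<in>span S. \<forall>r\<in>span S. b p r = b a r"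
    proof (rule insert.IH[OF aS(2)])
      show "b a (scale c u + v) = c * b a u + b a v" if "u \<in> span S0" "v \<in> span S0" for u v c
        using b_lin[OF that aS(1)] by (simp add: b_sym)
      show "b a u = 0" if "u \<in> span S0" "b u u = 0" for u
        using assms(6)[OF that] aS(1) by (simp add: b_sym)
    qed
    then obtain p where p: "p \<in> span S" "\<And>r. r \<in> span S \<Longrightarrow> b p r = b a r" by blast
    \<comment> \<open>\<open>e\<close> is the component of the new generator orthogonal to the previous ones.  If \<open>b e e = 0\<close>, then
      \<open>L e = 0\<close> and no correction is needed.\<close>
    define e where "e = scale (- 1) p + a"
    have S0: "q \<in> span S0" "p \<in> span S0" using q p sp[OF aS(2)] by auto
    have eS0: "e \<in> span S0" unfolding e_def by (intro span_add span_scale S0 aS)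
    have e_orth: "b e r = 0" if "r \<in> span S" for r
      using b_lin[OF S0(2) aS(1), of r "- 1"] p(2)[OF that] sp[OF aS(2)] that by (auto simp: e_def)
    have q_e: "b q e = 0" using e_orth[OF q(1)] b_sym by metis
    define d where "d = (if b e e = 0 then 0 else L e / b e e)"
    have d: "d * b e e = L e" using insert.prems(3)[OF eS0] by (simp add: d_def)
    define q' where "q' = scale d e + q"
    have mono: "span S \<subseteq> span (insert a S)" by (intro span_mono) auto
    have "e \<in> span (insert a S)" unfolding e_def using p(1) mono by (intro span_add span_scale) (auto intro: span_base)
    then have "q' \<in> span (insert a S)" unfolding q'_def using q(1) mono by (intro span_add span_scale) auto
    moreover have "b q' r = L r" if rS: "r \<in> span (insert a S)" for r
    proof -
      obtain c where "r - scale c a \<in> span S" using rS by (auto simp: span_insert)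
      then have s: "(r - scale c a) + scale c p \<in> span S" using p(1) by (intro span_add span_scale)
      define s where "s = (r - scale c a) + scale c p"
      have r: "r = scale c e + s" by (simp add: s_def e_def scale_right_distrib scale_right_diff_distrib)
      have sS: "s \<in> span S" "s \<in> span S0" using s sp[OF aS(2)] by (auto simp: s_def)
      have "b q' r = d * b e r + b q r"
        unfolding q'_def by (rule b_lin) (use eS0 S0 sS r in \<open>auto intro: span_add span_scale\<close>)
      also have "b e r = c * b e e + b s e"
        unfolding b_sym[of e r] by (subst r) (rule b_lin[OF eS0 sS(2) eS0])
      also have "b s e = 0" using e_orth[OF sS(1)] b_sym by metis
      also have "b q r = c * b e q + b s q"
        unfolding b_sym[of q r] by (subst r) (rule b_lin[OF eS0 sS(2) S0(1)])
      also have "b e q = 0" using q_e b_sym by metis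
      also have "b s q = L s" using q(2)[OF sS(1)] b_sym by metis
      finally have "b q' r = c * (d * b e e) + L s" by simp
      also have "\<dots> = L r" unfolding d r using insert.prems(2)[OF eS0 sS(2), of c] by simp
      finally show ?thesis .
    qed
    ultimately show ?case by blast
  qed
  show ?thesis using general[OF S0 order_refl L_lin] null by blast
qed

lemma finite_Qpoly_monomials: "finite {monomial \<alpha> :: real^'d::finite \<Rightarrow> real | \<alpha>. \<forall>i. \<alpha> i \<le> m}"
proof -
  have "{monomial \<alpha> :: real^'d \<Rightarrow> real | \<alpha>. \<forall>i. \<alpha> i \<le> m} = monomial ` {\<alpha>. \<forall>i. \<alpha> i \<le> m}" by auto
  then show ?thesis by (simp only: finite_imageI[OF finite_multi_indices])
qed

lemma smooth_on_facet_continuous: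
  assumes "smooth q"
  shows "continuous_on S (\<lambda>x. q (to_facet i s x))"
  unfolding to_facet_eq
  by (intro continuous_on_compose2[OF smooth_continuous[OF assms, of UNIV]] continuous_intros) auto

lemma facet_integral_sum:
  assumes "\<And>j. j \<in> J \<Longrightarrow> smooth (f j)"
  shows "facet_integral i s (\<lambda>x. \<Sum>j\<in>J. c j * f j x) = (\<Sum>j\<in>J. c j * facet_integral i s (f j))"
proof -
  have "integrable (lebesgue_on ref_elem) (\<lambda>x. c j * f j (to_facet i s x))" if "j \<in> J" for j
    by (intro integrable_ref_continuous continuous_intros smooth_on_facet_continuous assms that)
  then show ?thesis
    by (simp add: facet_integral_def Bochner_Integration.integral_sum sum_divide_distrib)
qed

lemma square_integrable_ref_continuous:
  fixes f :: "real^'d::finite \<Rightarrow> real"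
  assumes f: "continuous_on ref_elem f"
  shows "square_integrable (lebesgue_on ref_elem) f"
  unfolding square_integrable_def
proof
  show "f \<in> borel_measurable (lebesgue_on ref_elem)"
    using ref_integral_continuous(4)[OF f] by (rule borel_measurable_integrable)
  have "continuous_on ref_elem (\<lambda>x. (norm (f x))\<^sup>2)" by (intro continuous_intros f)
  then show "integrable (lebesgue_on ref_elem) (\<lambda>x. (norm (f x))\<^sup>2)" by (rule ref_integral_continuous(4))
qed

text \<open>
  A polynomial of zero \<open>L\<^sup>2\<close> norm on the facet vanishes there, so it is orthogonal to every function on
  the facet.
\<close>

lemma facet_projection_exists:
  fixes \<phi> :: "real^'d::finite \<Rightarrow> real"
  assumes s: "s = - 1 \<or> s = 1"
    and \<phi>: "\<And>r. smooth r \<Longrightarrow> integrable (lebesgue_on ref_elem) (\<lambda>x. \<phi> (to_facet i s x) * r (to_facet i s x))"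
  shows "\<exists>q. q \<in> Qpoly m \<and> (\<forall>r\<in>Qpoly m. facet_integral i s (\<lambda>x. (\<phi> x - q x) * r x) = 0)"
proof -
  define b where "b q r = facet_integral i s (\<lambda>x. q x * r x)" for q r
  define L where "L r = facet_integral i s (\<lambda>x. \<phi> x * r x)" for r
  let ?S = "{monomial \<alpha> :: real^'d \<Rightarrow> real | \<alpha>. \<forall>i. \<alpha> i \<le> m}"
  have sp: "fun_space.span ?S = Qpoly m" by (simp add: Qpoly_def)
  have int: "integrable (lebesgue_on ref_elem) (\<lambda>x. q (to_facet i s x) * r (to_facet i s x))"
    if "smooth q" "smooth r" for q r
    using smooth_on_facet_continuous[OF smooth_mult[OF that]] by (rule integrable_ref_continuous)
  have zero_on_facet: "u (to_facet i s x) = 0" if u: "smooth u" "b u u = 0" and x: "x \<in> ref_int" for u x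
  proof -
    have "u (to_facet i s x) * u (to_facet i s x) = 0"
      by (rule ref_integral_zero_imp_zero[OF smooth_on_facet_continuous[OF smooth_mult[OF u(1) u(1)]] _ _ x])
        (use u(2) in \<open>simp_all add: b_def facet_integral_def\<close>)
    then show ?thesis by simp
  qed
  have "\<exists>q\<in>fun_space.span ?S. \<forall>r\<in>fun_space.span ?S. b q r = L r"
  proof (rule semidefinite_representation[OF fun_space.vector_space_axioms finite_Qpoly_monomials])
    show "b (fun_scale c u + v) w = c * b u w + b v w"
      if "u \<in> fun_space.span ?S" "v \<in> fun_space.span ?S" "w \<in> fun_space.span ?S" for u v w c
    proof -
      have sm: "smooth u" "smooth v" "smooth w" using that unfolding sp by (auto intro: smooth_Qpoly)
      have "b (fun_scale c u + v) w = (LINT x|lebesgue_on ref_elem. c * (u (to_facet i s x) * w (to_facet i s x)) +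
          v (to_facet i s x) * w (to_facet i s x)) / 2"
        by (simp add: b_def facet_integral_def fun_scale_def algebra_simps)
      also have "\<dots> = (c * (LINT x|lebesgue_on ref_elem. u (to_facet i s x) * w (to_facet i s x)) +
          (LINT x|lebesgue_on ref_elem. v (to_facet i s x) * w (to_facet i s x))) / 2"
        using int[OF sm(1,3)] int[OF sm(2,3)] by (subst Bochner_Integration.integral_add) auto
      finally show ?thesis by (simp add: b_def facet_integral_def add_divide_distrib)
    qed
    show "b u v = b v u" for u v by (simp add: b_def mult.commute)
    show "L (fun_scale c u + v) = c * L u + L v"
      if "u \<in> fun_space.span ?S" "v \<in> fun_space.span ?S" for u v c
    proof -
      have sm: "smooth u" "smooth v" using that unfolding sp by (auto intro: smooth_Qpoly)
      have "L (fun_scale c u + v) = (LINT x|lebesgue_on ref_elem. c * (\<phi> (to_facet i s x) * u (to_facet i s x)) +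
          \<phi> (to_facet i s x) * v (to_facet i s x)) / 2"
        by (simp add: L_def facet_integral_def fun_scale_def algebra_simps)
      also have "\<dots> = (c * (LINT x|lebesgue_on ref_elem. \<phi> (to_facet i s x) * u (to_facet i s x)) +
          (LINT x|lebesgue_on ref_elem. \<phi> (to_facet i s x) * v (to_facet i s x))) / 2"
        using \<phi>[OF sm(1)] \<phi>[OF sm(2)] by (subst Bochner_Integration.integral_add) auto
      finally show ?thesis by (simp add: L_def facet_integral_def add_divide_distrib)
    qed
    show "L u = 0 \<and> (\<forall>v\<in>fun_space.span ?S. b u v = 0)"
      if "u \<in> fun_space.span ?S" "b u u = 0" for u
    proof -
      have "smooth u" using that(1) unfolding sp by (rule smooth_Qpoly)
      then show ?thesis
        using zero_on_facet[OF _ that(2)] by (auto simp: L_def b_def facet_integral_def ref_integral_zero)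
    qed
  qed
  then obtain q where q: "q \<in> Qpoly m" "\<And>r. r \<in> Qpoly m \<Longrightarrow> b q r = L r" unfolding sp by blast
  have "facet_integral i s (\<lambda>x. (\<phi> x - q x) * r x) = 0" if r: "r \<in> Qpoly m" for r
  proof -
    have "(LINT x|lebesgue_on ref_elem. (\<phi> (to_facet i s x) - q (to_facet i s x)) * r (to_facet i s x)) =
        (LINT x|lebesgue_on ref_elem. \<phi> (to_facet i s x) * r (to_facet i s x)) -
        (LINT x|lebesgue_on ref_elem. q (to_facet i s x) * r (to_facet i s x))"
      unfolding left_diff_distrib
      by (rule Bochner_Integration.integral_diff[OF \<phi>[OF smooth_Qpoly[OF r]] int[OF smooth_Qpoly[OF q(1)] smooth_Qpoly[OF r]]])
    then show ?thesis using q(2)[OF r] by (simp add: b_def L_def facet_integral_def)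
  qed
  then show ?thesis using q(1) by blast
qed

context quad_mesh begin

section \<open>The boundary term\<close>

text \<open>
  Cramer's rule expresses the conormal by determinants and so makes its continuity visible.
\<close>

lemma conormal_cramer:
  assumes E: "E \<in> \<T>" and x: "x \<in> ref_elem"
  shows "transpose (DF (F E) x) *v conormal (F E) i s x = axis i s"
    and "conormal (F E) i s x =
      (\<chi> m. det (\<chi> a b. if b = m then axis i s $ a else DF (F E) x $ b $ a) / det (DF (F E) x))"
proof -
  have inv: "invertible (DF (F E) x)" by (rule DF_invertible[OF E x])
  have one: "transpose (DF (F E) x) ** transpose (matrix_inv (DF (F E) x)) = mat 1"
    unfolding matrix_transpose_mul[symmetric] matrix_inv_mult(2)[OF inv] by (rule transpose_mat)
  show *: "transpose (DF (F E) x) *v conormal (F E) i s x = axis i s"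
    unfolding conormal_def matrix_vector_mul_assoc one by (rule matrix_vector_mul_lid)
  have "det (transpose (DF (F E) x)) \<noteq> 0" using inv by (simp add: invertible_det_nz)
  from cramer[OF this, of "conormal (F E) i s x" "axis i s", THEN iffD1, OF *]
  show "conormal (F E) i s x =
      (\<chi> m. det (\<chi> a b. if b = m then axis i s $ a else DF (F E) x $ b $ a) / det (DF (F E) x))"
    unfolding det_transpose by (simp only: transpose_def vec_lambda_beta)
qed

lemma conormal_nonzero:
  assumes "E \<in> \<T>" "x \<in> ref_elem" "s \<noteq> 0"
  shows "conormal (F E) i s x \<noteq> 0"
  using conormal_cramer(1)[OF assms(1,2), of i s] assms(3) by (auto simp: axis_eq_0_iff)

lemma surface_element_continuous:
  assumes E: "E \<in> \<T>"
  shows "continuous_on ref_elem (surface_element (F E) i s)"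
proof -
  have det: "det (DF (F E) x) \<noteq> 0" if "x \<in> ref_elem" for x
    using DF_invertible[OF E that] by (simp add: invertible_det_nz)
  have "continuous_on ref_elem (\<lambda>x. if b = m then axis i s $ a else DF (F E) x $ b $ a)" for a b m
    by (cases "b = m") (auto intro: DF_continuous[OF E] continuous_intros)
  then have "continuous_on ref_elem (\<lambda>x. det (\<chi> a b. if b = m then axis i s $ a else DF (F E) x $ b $ a))" for m
    unfolding det_def by (auto intro!: continuous_intros)
  moreover have "continuous_on ref_elem (\<lambda>x. det (DF (F E) x))"
    unfolding det_def by (intro continuous_intros DF_continuous[OF E])
  ultimately have "continuous_on ref_elem (\<lambda>x. \<chi> m. det (\<chi> a b. if b = m then axis i s $ a else DF (F E) x $ b $ a) / det (DF (F E) x))"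
    using det by (intro continuous_on_vec_lambda continuous_on_divide) auto
  then have "continuous_on ref_elem (conormal (F E) i s)"
    by (rule continuous_on_eq) (simp add: conormal_cramer(2)[OF E])
  then show ?thesis
    unfolding surface_element_def[abs_def] by (intro continuous_intros Jac_continuous[OF E])
qed

lemma surface_element_pos:
  assumes "E \<in> \<T>" "x \<in> ref_elem" "s \<noteq> 0"
  shows "surface_element (F E) i s x > 0"
  unfolding surface_element_def using Jac_pos[OF assms(1,2)] conormal_nonzero[OF assms] by simp

text \<open>
  The boundary data are square integrable with the weight \<open>sqrt (surface_element ...)\<close>, and the inverse
  of this weight is continuous on the compact reference element; hence the projection exists.
\<close>

lemma facet_proj_in_Qpoly:
  assumes g: "g \<in> L2_boundary \<Gamma> \<Omega> \<T> F" and facet: "(E, i, s) \<in> facets_in \<Gamma> \<Omega> \<T> F"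
  shows "facet_proj m i s (g \<circ> F E) \<in> Qpoly m"
proof -
  have E: "E \<in> \<T>" and s: "s = - 1 \<or> s = 1" using facet by (auto simp: facets_in_def boundary_facets_def)
  let ?se = "\<lambda>x. surface_element (F E) i s (to_facet i s x)"
  have h: "square_integrable (lebesgue_on ref_elem) (\<lambda>x. g (F E (to_facet i s x)) * sqrt (?se x))"
    using g facet unfolding L2_boundary_def by blast
  have facet_in: "to_facet i s x \<in> ref_elem" if "x \<in> ref_elem" for x using that s by (auto simp: mem_ref_elem)
  have pos: "?se x > 0" if "x \<in> ref_elem" for x
    using surface_element_pos[OF E facet_in[OF that]] s by auto
  have "continuous_on ref_elem ?se"
    by (rule continuous_on_compose2[OF surface_element_continuous[OF E]])
      (use facet_in in \<open>auto simp: to_facet_eq intro!: continuous_intros\<close>)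
  then have c: "continuous_on ref_elem (\<lambda>x. 1 / sqrt (?se x))"
    by (rule continuous_on_divide[OF continuous_on_const continuous_on_real_sqrt])
      (use pos in \<open>auto simp: less_le\<close>)
  have "integrable (lebesgue_on ref_elem) (\<lambda>x. (g \<circ> F E) (to_facet i s x) * r (to_facet i s x))" if r: "smooth r" for r
  proof -
    have "square_integrable (lebesgue_on ref_elem) (\<lambda>x. 1 / sqrt (?se x) * r (to_facet i s x))"
      by (intro square_integrable_ref_continuous continuous_on_mult c smooth_on_facet_continuous r)
    from square_integrable_mult[OF h this]
    show ?thesis
    proof (rule Bochner_Integration.integrable_cong[THEN iffD1, rotated -1])
      show "g (F E (to_facet i s x)) * sqrt (?se x) * (1 / sqrt (?se x) * r (to_facet i s x)) =
          (g \<circ> F E) (to_facet i s x) * r (to_facet i s x)" if "x \<in> space (lebesgue_on ref_elem)" for x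
        using pos[of x] that by simp
    qed simp
  qed
  from someI_ex[OF facet_projection_exists[where \<phi> = "g \<circ> F E", OF s this, unfolded Bex_def], THEN conjunct1]
  show ?thesis unfolding facet_proj_def .
qed

end

lemma V_ref_polynomial:
  fixes \<iota> :: "nat \<Rightarrow> 'd::finite"
  assumes dim: "CARD('d) = 2 \<or> CARD('d) = 3" and \<iota>: "bij_betw \<iota> {1..CARD('d)} UNIV" and k: "k \<ge> 1"
    and v: "v \<in> V_ref \<iota> k"
  shows "(\<lambda>x. v x $ i) \<in> fun_space.span (range monomial)"
proof -
  have mono: "(\<lambda>x. c * monomial \<alpha> x) \<in> fun_space.span (range monomial)" for c and \<alpha> :: "'d \<Rightarrow> nat"
    using fun_space.span_scale[OF fun_space.span_base[OF rangeI], of c monomial \<alpha>] by (simp add: fun_scale_def)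
  have gen: "(\<lambda>x. g x $ i) \<in> fun_space.span (range monomial)"
    if g: "g \<in> rt_generators k \<union> bubble_generators k" for g
  proof -
    have "\<exists>c \<alpha>. (\<lambda>x. g x $ i) = (\<lambda>x. c * monomial \<alpha> x)"
    proof (cases "g \<in> rt_generators k")
      case True
      then obtain j \<alpha> where "g = (\<lambda>x. axis j (monomial \<alpha> x))" unfolding rt_generators_def by blast
      then show ?thesis by (intro exI[of _ "if i = j then 1 else 0"] exI[of _ \<alpha>]) (simp add: axis_def)
    next
      case False
      then obtain j \<alpha> where gb: "g = bubble j \<alpha>" using g unfolding bubble_generators_def by blast
      show ?thesis
      proof (cases "i = j")
        case True
        then show ?thesis unfolding gb bubble_def
          by (intro exI[of _ "\<Sum>l\<in>UNIV - {j}. real (Suc (\<alpha> l))"] exI[of _ \<alpha>]) simp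
      next
        case False
        then show ?thesis unfolding gb bubble_def
          by (intro exI[of _ "- real (\<alpha> j)"] exI[of _ "\<alpha>(j := \<alpha> j - 1, i := Suc (\<alpha> i))"]) simp
      qed
    qed
    then show ?thesis using mono by auto
  qed
  have "v \<in> fun_space.span (rt_generators k \<union> bubble_generators k)"
    using V_ref_subset_span[OF dim \<iota> k] v by blast
  then show ?thesis
  proof (induction rule: fun_space.span_induct_alt)
    case base
    then show ?case using mono[of 0] by simp
  next
    case (step c g v)
    have "(\<lambda>x. (fun_scale c g + v) x $ i) = fun_scale c (\<lambda>x. g x $ i) + (\<lambda>x. v x $ i)"
      by (simp add: fun_eq_iff fun_scale_def)
    then show ?case using fun_space.span_add[OF fun_space.span_scale[OF gen[OF step(1)]] step(2)] by metis
  qed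
qed

context mfmfe begin

lemma V_ref_smooth: "v \<in> V_ref \<iota> k \<Longrightarrow> smooth (\<lambda>x. v x $ i)"
  by (rule smooth_polynomial[OF V_ref_polynomial[OF dim coordinates degree]])

text \<open>
  The Jacobian factors of the Piola transformation, of the unit normal and of the surface element
  cancel: \<open>(v \<bullet> n) dS\<close> is \<open>s\<close> times the \<open>i\<close>-th component of the reference field.
\<close>

lemma boundary_term_sum:
  assumes g: "g \<in> L2_boundary \<Gamma> \<Omega> \<T> F" and v: "\<And>j. j \<in> J \<Longrightarrow> v j \<in> Vh"
  shows "boundary_term \<iota> k \<Omega> \<Gamma> \<T> F g (\<lambda>x. \<Sum>j\<in>J. c j *\<^sub>R v j x) =
    (\<Sum>j\<in>J. c j * boundary_term \<iota> k \<Omega> \<Gamma> \<T> F g (v j))"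
proof -
  define t where "t E i s w = facet_integral i s
      (\<lambda>x. facet_proj (k - 1) i s (g \<circ> F E) x * (piola (F E) w x \<bullet> unit_normal (F E) i s x) *
           surface_element (F E) i s x)" for E i s w
  have t_eq: "t E i s w = facet_integral i s (\<lambda>x. s * (facet_proj (k - 1) i s (g \<circ> F E) x * w x $ i))"
    if f: "(E, i, s) \<in> facets_in \<Gamma> \<Omega> \<T> F" for E i s w
  proof -
    have E: "E \<in> \<T>" and s: "s = - 1 \<or> s = 1" using f by (auto simp: facets_in_def boundary_facets_def)
    have "(piola (F E) w y \<bullet> unit_normal (F E) i s y) * surface_element (F E) i s y = s * w y $ i"
      if y: "y \<in> ref_elem" for y
    proof -
      have J: "Jac (F E) y \<noteq> 0" using Jac_pos[OF E y] by simp
      have n: "norm (conormal (F E) i s y) \<noteq> 0" using conormal_nonzero[OF E y] s by auto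
      have "(piola (F E) w y \<bullet> unit_normal (F E) i s y) * surface_element (F E) i s y =
          (DF (F E) y *v w y) \<bullet> conormal (F E) i s y"
        using J n by (simp add: piola_def unit_normal_def surface_element_def field_simps)
      also have "\<dots> = w y \<bullet> axis i s"
        unfolding inner_matrix_transpose conormal_cramer(1)[OF E y] ..
      finally show ?thesis by (simp add: inner_axis mult.commute)
    qed
    moreover have "to_facet i s x \<in> ref_elem" if "x \<in> ref_elem" for x using that s by (auto simp: mem_ref_elem)
    ultimately show ?thesis
      unfolding t_def facet_integral_def
      by (intro arg_cong2[of _ _ _ _ "(/)"] refl Bochner_Integration.integral_cong)
        (simp_all add: mult.assoc mult.left_commute)
  qed
  have lin: "t E i s (hat \<iota> k (F E) (\<lambda>x. \<Sum>j\<in>J. c j *\<^sub>R v j x)) = (\<Sum>j\<in>J. c j * t E i s (hat \<iota> k (F E) (v j)))"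
    if f: "(E, i, s) \<in> facets_in \<Gamma> \<Omega> \<T> F" for E i s
  proof -
    have E: "E \<in> \<T>" using f by (auto simp: facets_in_def boundary_facets_def)
    let ?q = "facet_proj (k - 1) i s (g \<circ> F E)"
    have q: "smooth ?q" by (rule smooth_Qpoly[OF facet_proj_in_Qpoly[OF g f]])
    have vs: "smooth (\<lambda>x. s * (?q x * hat \<iota> k (F E) (v j) x $ i))" if "j \<in> J" for j
      by (intro smooth_mult smooth_const q V_ref_smooth[OF hat_V_h(1)[OF E v[OF that]]])
    have "t E i s (hat \<iota> k (F E) (\<lambda>x. \<Sum>j\<in>J. c j *\<^sub>R v j x)) =
        facet_integral i s (\<lambda>x. \<Sum>j\<in>J. c j * (s * (?q x * hat \<iota> k (F E) (v j) x $ i)))"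
    proof -
      have "hat \<iota> k (F E) (\<lambda>x. \<Sum>j\<in>J. c j *\<^sub>R v j x) = (\<lambda>x. \<Sum>j\<in>J. c j *\<^sub>R hat \<iota> k (F E) (v j) x)"
        by (rule hat_sum[OF E]) (rule v)
      then show ?thesis unfolding t_eq[OF f] by (simp add: sum_distrib_left mult.left_commute)
    qed
    also have "\<dots> = (\<Sum>j\<in>J. c j * t E i s (hat \<iota> k (F E) (v j)))"
      unfolding t_eq[OF f] by (rule facet_integral_sum[OF vs])
    finally show ?thesis .
  qed
  have "boundary_term \<iota> k \<Omega> \<Gamma> \<T> F g (\<lambda>x. \<Sum>j\<in>J. c j *\<^sub>R v j x) =
      (\<Sum>(E, i, s)\<in>facets_in \<Gamma> \<Omega> \<T> F. \<Sum>j\<in>J. c j * t E i s (hat \<iota> k (F E) (v j)))"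
    unfolding boundary_term_def t_def[symmetric] by (rule sum.cong) (auto simp: lin)
  also have "\<dots> = (\<Sum>j\<in>J. c j * (\<Sum>(E, i, s)\<in>facets_in \<Gamma> \<Omega> \<T> F. t E i s (hat \<iota> k (F E) (v j))))"
    unfolding case_prod_unfold sum_distrib_left by (rule sum.swap)
  finally show ?thesis unfolding boundary_term_def t_def .
qed

end

section \<open>The algebraic system\<close>

lemma basis_combination:
  fixes b :: "'n::finite \<Rightarrow> 'a \<Rightarrow> 'b::real_vector"
  assumes b: "is_basis b S"
  shows "b i \<in> S" "(\<lambda>x. \<Sum>i\<in>UNIV. c $ i *\<^sub>R b i x) \<in> S"
    "v \<in> S \<Longrightarrow> \<exists>c. v = (\<lambda>x. \<Sum>i\<in>UNIV. c $ i *\<^sub>R b i x)"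
    "(\<lambda>x. \<Sum>i\<in>UNIV. c $ i *\<^sub>R b i x) = 0 \<Longrightarrow> c = 0"
proof -
  have inj: "inj b" and ind: "\<not> fun_space.dependent (range b)" and S: "fun_space.span (range b) = S"
    using b by (auto simp: is_basis_def)
  have eq: "(\<lambda>x. \<Sum>i\<in>UNIV. c $ i *\<^sub>R b i x) = (\<Sum>i\<in>UNIV. fun_scale (c $ i) (b i))" for c :: "real^'n"
    by (simp add: fun_eq_iff sum_fun_apply fun_scale_def)
  show bS: "b i \<in> S" for i unfolding S[symmetric] by (rule fun_space.span_base) simp
  show "(\<lambda>x. \<Sum>i\<in>UNIV. c $ i *\<^sub>R b i x) \<in> S"
    unfolding eq S[symmetric] by (intro fun_space.span_sum fun_space.span_scale fun_space.span_base) simp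
  have reindex: "(\<Sum>v\<in>range b. fun_scale (u v) v) = (\<Sum>i\<in>UNIV. fun_scale (u (b i)) (b i))" for u
    by (subst sum.reindex[OF inj]) simp
  show "\<exists>c. v = (\<lambda>x. \<Sum>i\<in>UNIV. c $ i *\<^sub>R b i x)" if v: "v \<in> S"
  proof -
    obtain u where "v = (\<Sum>w\<in>range b. fun_scale (u w) w)"
      using v unfolding S[symmetric] by (auto simp: fun_space.span_finite)
    then have "v = (\<lambda>x. \<Sum>i\<in>UNIV. (\<chi> i. u (b i)) $ i *\<^sub>R b i x)"
      unfolding reindex eq by simp
    then show ?thesis by blast
  qed
  show "c = 0" if zero: "(\<lambda>x. \<Sum>i\<in>UNIV. c $ i *\<^sub>R b i x) = 0"
  proof (rule ccontr)
    assume "c \<noteq> 0"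
    then obtain i where i: "c $ i \<noteq> 0" by (auto simp: vec_eq_iff)
    define u where "u v = c $ inv b v" for v
    have "(\<Sum>v\<in>range b. fun_scale (u v) v) = 0"
      unfolding reindex using zero by (simp add: eq u_def inv_f_f[OF inj])
    moreover have "u (b i) \<noteq> 0" using i by (simp add: u_def inv_f_f[OF inj])
    ultimately have "fun_space.dependent (range b)"
      by (subst fun_space.dependent_finite) auto
    then show False using ind by simp
  qed
qed

theorem lemma2p7:
  fixes \<Omega> \<Gamma>\<^sub>D \<Gamma>\<^sub>N :: "(real^'d::finite) set"
    and \<iota> :: "nat \<Rightarrow> 'd"
    and k :: nat
    and \<xi> l :: "nat \<Rightarrow> real"
    and \<T> :: "(real^'d) set set"
    and F :: "(real^'d) set \<Rightarrow> real^'d \<Rightarrow> real^'d"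
    and K :: "real^'d \<Rightarrow> real^'d^'d"
    and k0 k1 C :: real
    and f g :: "real^'d \<Rightarrow> real"
    and vb :: "'n::finite \<Rightarrow> real^'d \<Rightarrow> real^'d"
    and wb :: "'m::finite \<Rightarrow> real^'d \<Rightarrow> real"
    and A :: "real^'n^'n" and BT :: "real^'m^'n" and B :: "real^'n^'m"
    and G :: "real^'n" and H :: "real^'m"
  assumes dim: "CARD('d) = 2 \<or> CARD('d) = 3"
    and coordinates: "bij_betw \<iota> {1..CARD('d)} UNIV"
    and degree: "k \<ge> 1"
    and domain: "polytopal_domain \<Omega>"
    and tensor: "admissible_tensor \<Omega> k0 k1 K"
    and mesh: "fe_partition \<Omega> \<T> F" "shape_regular_quasi_uniform C \<T> F"
    and boundary: "boundary_partition \<Omega> \<Gamma>\<^sub>D \<Gamma>\<^sub>N \<T> F"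
    and data: "square_integrable (lebesgue_on \<Omega>) f" "g \<in> L2_boundary \<Gamma>\<^sub>D \<Omega> \<T> F"
    and quadrature: "gauss_lobatto k \<xi> l"
    and bases: "is_basis vb (V_h \<iota> k \<Omega> \<Gamma>\<^sub>D \<T> F)" "is_basis wb (W_h k \<Omega> \<T> F)"
    and A: "A = (\<chi> i j. quad_form \<iota> k \<xi> l \<T> F K (vb i) (vb j))"
    and BT: "BT = (\<chi> i j. - L2_inner \<Omega> (weak_div \<Omega> (vb i)) (wb j))"
    and B: "B = transpose BT"
    and G: "G = (\<chi> i. - boundary_term \<iota> k \<Omega> \<Gamma>\<^sub>D \<T> F g (vb i))"
    and H: "H = (\<chi> j. - L2_inner \<Omega> f (wb j))"
  shows "(\<forall>U P. mfmfe_solution \<iota> k \<xi> l \<Omega> \<Gamma>\<^sub>D \<T> F K f g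
                  (\<lambda>x. \<Sum>i\<in>UNIV. U $ i *\<^sub>R vb i x) (\<lambda>x. \<Sum>j\<in>UNIV. P $ j *\<^sub>R wb j x) \<longleftrightarrow>
                A *v U + BT *v P = G \<and> B *v U = H) \<and>
         invertible A \<and>
         (\<forall>U P. A *v U + BT *v P = G \<and> B *v U = H \<longleftrightarrow>
                U = matrix_inv A *v (G - BT *v P) \<and>
                (B ** matrix_inv A ** BT) *v P = B *v (matrix_inv A *v G) - H) \<and>
         symmetric_positive_definite (B ** matrix_inv A ** BT)"
proof -
  interpret mfmfe \<Omega> \<T> F \<iota> k \<xi> l K k0 k1 \<Gamma>\<^sub>D
    by unfold_locales (rule dim domain mesh coordinates degree tensor quadrature)+
  let ?q = "quad_form \<iota> k \<xi> l \<T> F K" and ?b = "boundary_term \<iota> k \<Omega> \<Gamma>\<^sub>D \<T> F g"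
  define u where "u U = (\<lambda>x. \<Sum>i\<in>UNIV. U $ i *\<^sub>R vb i x)" for U
  define p where "p P = (\<lambda>x. \<Sum>j\<in>UNIV. P $ j *\<^sub>R wb j x)" for P
  note vb = basis_combination[OF bases(1), folded u_def] and wb = basis_combination[OF bases(2), folded p_def]
  have vH: "vb i \<in> H_div \<Omega>" for i using vb(1)[of i] by (simp add: V_h_def V_space_def)
  have wL: "w \<in> W_h k \<Omega> \<T> F \<Longrightarrow> square_integrable (lebesgue_on \<Omega>) w" for w by (simp add: W_h_def)
  have q_right: "?q v (u V) = (\<Sum>i\<in>UNIV. V $ i * ?q v (vb i))" for v V
    unfolding u_def by (rule quad_form_sum_right[OF vb(1)])
  have b_lin: "?b (u V) = (\<Sum>i\<in>UNIV. V $ i * ?b (vb i))" for V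
    unfolding u_def by (rule boundary_term_sum[OF data(2) vb(1)])
  have div_lin: "L2_inner \<Omega> (weak_div \<Omega> (u V)) w = (\<Sum>i\<in>UNIV. V $ i * L2_inner \<Omega> (weak_div \<Omega> (vb i)) w)"
    if "w \<in> W_h k \<Omega> \<T> F" for V w
    unfolding u_def by (rule L2_inner_weak_div_sum[OF \<Omega>(1,2) vH wL[OF that]])
  have w_lin: "L2_inner \<Omega> h (p P) = (\<Sum>j\<in>UNIV. P $ j * L2_inner \<Omega> h (wb j))"
    if h: "square_integrable (lebesgue_on \<Omega>) h" for h P
  proof -
    have "L2_inner \<Omega> (\<lambda>x. \<Sum>j\<in>UNIV. P $ j * wb j x) h = (\<Sum>j\<in>UNIV. P $ j * L2_inner \<Omega> (wb j) h)"
      by (rule L2_inner_sum_left[OF wL[OF wb(1)] h])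
    then show ?thesis by (simp add: p_def L2_inner_commute[of \<Omega> h])
  qed
  have div_sq: "square_integrable (lebesgue_on \<Omega>) (weak_div \<Omega> v)" if "v \<in> H_div \<Omega>" for v
    using that weak_div_AE_eq(1)[OF \<Omega>(1,2)] has_weak_div_square_integrable unfolding H_div_def by blast
  have uH: "u U \<in> H_div \<Omega>" for U using vb(2)[of U] by (simp add: V_h_def V_space_def)
  have AU: "(A *v U) $ i = ?q (u U) (vb i)" for U i
    using q_right[of "vb i" U] by (simp add: A matrix_vector_mult_def mult.commute quad_form_commute[of "u U"])
  have BTP: "(BT *v P) $ i = - L2_inner \<Omega> (weak_div \<Omega> (vb i)) (p P)" for P i
    using w_lin[OF div_sq[OF vH], of i P] by (simp add: BT matrix_vector_mult_def sum_negf mult.commute)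
  have BU: "(B *v U) $ j = - L2_inner \<Omega> (weak_div \<Omega> (u U)) (wb j)" for U j
    using div_lin[OF wb(1), of U j] by (simp add: B BT matrix_vector_mult_def transpose_def sum_negf mult.commute)
  have solution: "mfmfe_solution \<iota> k \<xi> l \<Omega> \<Gamma>\<^sub>D \<T> F K f g (u U) (p P) \<longleftrightarrow> A *v U + BT *v P = G \<and> B *v U = H" for U P
  proof -
    have first: "(\<forall>v\<in>V_h \<iota> k \<Omega> \<Gamma>\<^sub>D \<T> F. ?q (u U) v - L2_inner \<Omega> (p P) (weak_div \<Omega> v) = - ?b v) \<longleftrightarrow>
        A *v U + BT *v P = G" (is "?l \<longleftrightarrow> ?r")
    proof
      assume ?l
      then have "?q (u U) (vb i) - L2_inner \<Omega> (weak_div \<Omega> (vb i)) (p P) = - ?b (vb i)" for i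
        using vb(1)[of i] by (metis L2_inner_commute)
      then show ?r by (simp add: vec_eq_iff AU BTP G)
    next
      assume ?r
      then have r: "?q (u U) (vb i) - L2_inner \<Omega> (weak_div \<Omega> (vb i)) (p P) = - ?b (vb i)" for i
      proof -
        have "(A *v U) $ i + (BT *v P) $ i = - ?b (vb i)"
          using arg_cong[OF \<open>?r\<close>, of "\<lambda>x. x $ i"] by (simp add: G)
        then show ?thesis by (simp add: AU BTP)
      qed
      show ?l
      proof
        fix v assume "v \<in> V_h \<iota> k \<Omega> \<Gamma>\<^sub>D \<T> F"
        then obtain V where v: "v = u V" using vb(3) by blast
        have "?q (u U) v - L2_inner \<Omega> (p P) (weak_div \<Omega> v) =
            (\<Sum>i\<in>UNIV. V $ i * (?q (u U) (vb i) - L2_inner \<Omega> (weak_div \<Omega> (vb i)) (p P)))"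
          unfolding v q_right L2_inner_commute[of \<Omega> "p P"] div_lin[OF wb(2)]
          by (simp add: sum_subtractf right_diff_distrib)
        also have "\<dots> = - ?b v" unfolding v b_lin r by (simp add: sum_negf)
        finally show "?q (u U) v - L2_inner \<Omega> (p P) (weak_div \<Omega> v) = - ?b v" .
      qed
    qed
    have second: "(\<forall>w\<in>W_h k \<Omega> \<T> F. L2_inner \<Omega> (weak_div \<Omega> (u U)) w = L2_inner \<Omega> f w) \<longleftrightarrow> B *v U = H"
      (is "?l \<longleftrightarrow> ?r")
    proof
      assume ?l
      then show ?r using wb(1) by (simp add: vec_eq_iff BU H)
    next
      assume ?r
      then have r: "L2_inner \<Omega> (weak_div \<Omega> (u U)) (wb j) = L2_inner \<Omega> f (wb j)" for j
        using BU[of U j] by (simp add: vec_eq_iff H)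
      show ?l
      proof
        fix w assume "w \<in> W_h k \<Omega> \<T> F"
        then obtain Q where w: "w = p Q" using wb(3) by blast
        show "L2_inner \<Omega> (weak_div \<Omega> (u U)) w = L2_inner \<Omega> f w"
          unfolding w w_lin[OF div_sq[OF uH]] w_lin[OF data(1)] r ..
      qed
    qed
    show ?thesis unfolding mfmfe_solution_def first second using vb(2) wb(2) by simp
  qed
  have spd: "symmetric_positive_definite A"
    unfolding symmetric_positive_definite_def
  proof (intro conjI allI impI)
    show "transpose A = A" by (simp add: A transpose_def vec_eq_iff quad_form_commute)
    fix x :: "real^'n" assume "x \<noteq> 0"
    then have "?q (u x) (u x) > 0" using vb(4)[of x] by (intro quad_form_pos vb(2)) blast
    also have "?q (u x) (u x) = x \<bullet> (A *v x)"
      by (simp add: q_right[of "u x" x] inner_vec_def AU)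
    finally show "x \<bullet> (A *v x) > 0" .
  qed
  then have inv: "invertible A" by (rule spd_invertible)
  have BT_inj: "P = 0" if "BT *v P = 0" for P
  proof -
    have "L2_inner \<Omega> (weak_div \<Omega> (vb i)) (p P) = 0" for i
      using BTP[of P i] that by simp
    then have "L2_inner \<Omega> (weak_div \<Omega> v) (p P) = 0" if "v \<in> V_h \<iota> k \<Omega> \<Gamma>\<^sub>D \<T> F" for v
      using vb(3)[OF that] div_lin[OF wb(2)] by auto
    then have "p P = 0" by (intro divergence_separates_pressures[OF boundary wb(2)]) blast
    then show "P = 0" by (rule wb(4))
  qed
  have schur: "A *v U + BT *v P = G \<and> B *v U = H \<longleftrightarrow>
      U = matrix_inv A *v (G - BT *v P) \<and>
      (B ** matrix_inv A ** BT) *v P = B *v (matrix_inv A *v G) - H" for U P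
  proof -
    have "A *v U + BT *v P = G \<longleftrightarrow> U = matrix_inv A *v (G - BT *v P)"
    proof
      assume "A *v U + BT *v P = G"
      then have "A *v U = G - BT *v P" by (simp add: algebra_simps)
      then show "U = matrix_inv A *v (G - BT *v P)" using matrix_inv_vector(2)[OF inv, of U] by simp
    next
      assume "U = matrix_inv A *v (G - BT *v P)"
      then show "A *v U + BT *v P = G" by (simp add: matrix_inv_vector(1)[OF inv])
    qed
    moreover have "B *v (matrix_inv A *v (G - BT *v P)) = B *v (matrix_inv A *v G) - (B ** matrix_inv A ** BT) *v P"
      by (simp add: matrix_vector_mult_diff_distrib matrix_vector_mul_assoc matrix_mul_assoc)
    ultimately show ?thesis by (auto simp: algebra_simps)
  qed
  have "symmetric_positive_definite (B ** matrix_inv A ** BT)"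
    unfolding B using BT_inj by (intro spd_congruence spd_matrix_inv[OF spd])
  then show ?thesis using solution[unfolded u_def p_def] inv schur by blast
qed

end
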